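(* Let $F_1$ be the Sobolev space of absolutely continuous functions $f:[0,1]\to\mathbb{R}$ with $f'\in L_2([0,1])$, with inner product $\langle f,h\rangle_{F_1}=f(0)h(0)+\int_0^1f'(x)h'(x)\,dx$ (equivalently, the reproducing kernel Hilbert space with kernel $K_1(x,y)=1+\min(x,y)$ on $[0,1]$). For $d=1,2,\dots$ let $F_d=F_1^{\otimes d}$, i.e. the reproducing kernel Hilbert space of real functions on $[0,1]^d$ with kernel $K_d(x,y)=\prod_{j=1}^d(1+\min(x_j,y_j))$, and let $\mathrm{APP}_d:F_d\to L_2([0,1]^d)$ be the embedding $\mathrm{APP}_df=f$. Consider the multivariate approximation problem $\mathbb{APP}=\{\mathrm{APP}_d\}_{d=1}^\infty$. Then: - $\mathbb{APP}$ is quasi-polynomially tractable but not polynomially tractable for the class $\Lambda^{\rm all}$, and the exponent of quasi-polynomial tractability is $t^*=1$. - $\mathbb{APP}$ suffers from the curse of dimensionality for the class $\Lambda^{\rm std}$.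
   Context: Write $S_d=\mathrm{APP}_d$ and $G_d=L_2([0,1]^d)$. Classes of information on $F_d$: $\Lambda^{\rm all}=F_d^*$ is the set of all continuous linear functionals on $F_d$; $\Lambda^{\rm std}$ is the set of all function evaluations $f\mapsto f(t)$, $t\in[0,1]^d$. For $\Lambda\in\{\Lambda^{\rm all},\Lambda^{\rm std}\}$ and $n\ge 1$, $$e_n(S_d,\Lambda)=\inf_{L_1,\dots,L_n\in\Lambda,\,g_1,\dots,g_n\in G_d}\ \sup_{\|f\|_{F_d}\le1}\Big\|S_df-\sum_{j=1}^nL_j(f)g_j\Big\|_{G_d},$$ and $e_0(S_d)=e_0(S_d,\Lambda)=\|S_d\|_{F_d\to G_d}$. The information complexity (normalized error criterion) is $n(\varepsilon,S_d,\Lambda)=\min\{n\ge0:\ e_n(S_d,\Lambda)\le\varepsilon\,e_0(S_d)\}$ for $\varepsilon\in(0,1)$. The sequence $\{S_d\}_{d=1}^\infty$: - suffers from the curse of dimensionality for $\Lambda$ iff there are positive $c,C$ and $\varepsilon_0\in(0,1)$ such that $n(\varepsilon,S_d,\Lambda)\ge C(1+c)^d$ for all $\varepsilon\in(0,\varepsilon_0]$ and infinitely many $d$; - is quasi-polynomially tractable for $\Lambda$ iff there are non-negative $C,t$ such that $n(\varepsilon,S_d,\Lambda)\le C\exp\big(t(1+\ln\varepsilon^{-1})(1+\ln d)\big)$ for all $\varepsilon\in(0,1)$ and $d=1,2,\dots$; the infimum of all $t$ for which such a bound holds (with some $C$ depending on $t$) is the exponent of quasi-polynomial tractability, denoted $t^*$;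 - is polynomially tractable for $\Lambda$ iff there are non-negative $C,p,q$ such that $n(\varepsilon,S_d,\Lambda)\le C\varepsilon^{-p}d^{\,q}$ for all $\varepsilon\in(0,1)$ and $d=1,2,\dots$. *)

theory Defs
  imports "HOL-Analysis.Analysis"
begin

text \<open>
  A function on \<open>X\<close> is represented by a function on the whole type that vanishes outside \<open>X\<close>
  (not by \<^const>\<open>extensional\<close>, which is not closed under pointwise addition).
\<close>

definition ip_norm :: "(('a \<Rightarrow> real) \<Rightarrow> ('a \<Rightarrow> real) \<Rightarrow> real) \<Rightarrow> ('a \<Rightarrow> real) \<Rightarrow> real" where
  "ip_norm ip f = sqrt (ip f f)"

locale hilbert_function_space =
  fixes X :: "'a set"
    and F :: "('a \<Rightarrow> real) set"
    and ip :: "('a \<Rightarrow> real) \<Rightarrow> ('a \<Rightarrow> real) \<Rightarrow> real"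
  assumes zero_outside: "f \<in> F \<Longrightarrow> x \<notin> X \<Longrightarrow> f x = 0"
    and zero_closed: "(\<lambda>x. 0) \<in> F"
    and add_closed: "f \<in> F \<Longrightarrow> g \<in> F \<Longrightarrow> (\<lambda>x. f x + g x) \<in> F"
    and scale_closed: "f \<in> F \<Longrightarrow> (\<lambda>x. c * f x) \<in> F"
    and ip_commute: "f \<in> F \<Longrightarrow> g \<in> F \<Longrightarrow> ip f g = ip g f"
    and ip_add_left: "f \<in> F \<Longrightarrow> g \<in> F \<Longrightarrow> h \<in> F \<Longrightarrow> ip (\<lambda>x. f x + g x) h = ip f h + ip g h"
    and ip_scale_left: "f \<in> F \<Longrightarrow> h \<in> F \<Longrightarrow> ip (\<lambda>x. c * f x) h = c * ip f h"
    and ip_nonneg: "f \<in> F \<Longrightarrow> 0 \<le> ip f f"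
    and ip_definite: "f \<in> F \<Longrightarrow> ip f f = 0 \<Longrightarrow> f = (\<lambda>x. 0)"
    and complete:
      "(\<And>n. u n \<in> F) \<Longrightarrow>
       (\<And>e. e > 0 \<Longrightarrow> \<exists>N. \<forall>m\<ge>N. \<forall>n\<ge>N. ip_norm ip (\<lambda>x. u m x - u n x) < e) \<Longrightarrow>
       \<exists>f\<in>F. (\<lambda>n. ip_norm ip (\<lambda>x. u n x - f x)) \<longlonglongrightarrow> 0"

definition kernel_section :: "'a set \<Rightarrow> ('a \<Rightarrow> 'a \<Rightarrow> real) \<Rightarrow> 'a \<Rightarrow> 'a \<Rightarrow> real" where
  "kernel_section X K y = (\<lambda>x. if x \<in> X then K x y else 0)"

text \<open>By the Moore--Aronszajn theorem, a positive semidefinite kernel \<open>K\<close> on \<open>X\<close> determines \<open>F\<close>,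
  and \<open>ip\<close> on \<open>F\<close>, uniquely.\<close>

locale rkhs = hilbert_function_space X F ip
  for X :: "'a set"
    and F :: "('a \<Rightarrow> real) set"
    and ip :: "('a \<Rightarrow> real) \<Rightarrow> ('a \<Rightarrow> real) \<Rightarrow> real" +
  fixes K :: "'a \<Rightarrow> 'a \<Rightarrow> real"
  assumes section_closed: "y \<in> X \<Longrightarrow> kernel_section X K y \<in> F"
    and reproducing: "f \<in> F \<Longrightarrow> y \<in> X \<Longrightarrow> ip f (kernel_section X K y) = f y"

text \<open>Elements of \<open>L\<^sub>2\<close> are represented by functions; the norm does not depend on the
  representative.\<close>

definition L2_space :: "'a measure \<Rightarrow> ('a \<Rightarrow> real) set" where
  "L2_space M = {g \<in> borel_measurable M. integrable M (\<lambda>x. (g x)\<^sup>2)}"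

definition L2_norm :: "'a measure \<Rightarrow> ('a \<Rightarrow> real) \<Rightarrow> real" where
  "L2_norm M g = sqrt (LINT x|M. (g x)\<^sup>2)"

definition Lambda_all ::
  "('a \<Rightarrow> real) set \<Rightarrow> (('a \<Rightarrow> real) \<Rightarrow> ('a \<Rightarrow> real) \<Rightarrow> real) \<Rightarrow> (('a \<Rightarrow> real) \<Rightarrow> real) set" where
  "Lambda_all F ip =
    {L. (\<forall>f\<in>F. \<forall>g\<in>F. L (\<lambda>x. f x + g x) = L f + L g) \<and>
        (\<forall>f\<in>F. \<forall>c. L (\<lambda>x. c * f x) = c * L f) \<and>
        (\<exists>C. \<forall>f\<in>F. \<bar>L f\<bar> \<le> C * ip_norm ip f)}"

definition Lambda_std :: "'a set \<Rightarrow> (('a \<Rightarrow> real) \<Rightarrow> real) set" where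
  "Lambda_std X = (\<lambda>t f. f t) ` X"

definition unit_ball ::
  "('a \<Rightarrow> real) set \<Rightarrow> (('a \<Rightarrow> real) \<Rightarrow> ('a \<Rightarrow> real) \<Rightarrow> real) \<Rightarrow> ('a \<Rightarrow> real) set" where
  "unit_ball F ip = {f \<in> F. ip_norm ip f \<le> 1}"

text \<open>
  The suprema below are taken in the reals. They are meaningful when \<open>S\<close> is a bounded operator
  from \<open>F\<close> into \<open>L2_space M\<close> and the functionals are continuous on \<open>F\<close>; both hold for the
  approximation problem below, and function evaluations are continuous on any \<^locale>\<open>rkhs\<close>.
\<close>

definition worst_case_error ::
  "('a \<Rightarrow> real) set \<Rightarrow> (('a \<Rightarrow> real) \<Rightarrow> ('a \<Rightarrow> real) \<Rightarrow> real) \<Rightarrow> 'b measure \<Rightarrow>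
   (('a \<Rightarrow> real) \<Rightarrow> ('b \<Rightarrow> real)) \<Rightarrow>
   nat \<Rightarrow> (nat \<Rightarrow> ('a \<Rightarrow> real) \<Rightarrow> real) \<Rightarrow> (nat \<Rightarrow> 'b \<Rightarrow> real) \<Rightarrow> real" where
  "worst_case_error F ip M S n L g =
    (SUP f\<in>unit_ball F ip. L2_norm M (\<lambda>x. S f x - (\<Sum>j<n. L j f * g j x)))"

definition initial_error ::
  "('a \<Rightarrow> real) set \<Rightarrow> (('a \<Rightarrow> real) \<Rightarrow> ('a \<Rightarrow> real) \<Rightarrow> real) \<Rightarrow> 'b measure \<Rightarrow>
   (('a \<Rightarrow> real) \<Rightarrow> ('b \<Rightarrow> real)) \<Rightarrow> real" where
  "initial_error F ip M S = (SUP f\<in>unit_ball F ip. L2_norm M (S f))"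

definition minimal_error ::
  "('a \<Rightarrow> real) set \<Rightarrow> (('a \<Rightarrow> real) \<Rightarrow> ('a \<Rightarrow> real) \<Rightarrow> real) \<Rightarrow> 'b measure \<Rightarrow>
   (('a \<Rightarrow> real) \<Rightarrow> ('b \<Rightarrow> real)) \<Rightarrow> (('a \<Rightarrow> real) \<Rightarrow> real) set \<Rightarrow> nat \<Rightarrow> real" where
  "minimal_error F ip M S \<Lambda> n =
    (if n = 0 then initial_error F ip M S
     else Inf {worst_case_error F ip M S n L g | L g.
                 (\<forall>j<n. L j \<in> \<Lambda>) \<and> (\<forall>j<n. g j \<in> L2_space M)})"

text \<open>The value is \<open>\<infinity>\<close> if no \<open>n\<close> qualifies; otherwise the infimum is attained.\<close>

definition information_complexity ::
  "('a \<Rightarrow> real) set \<Rightarrow> (('a \<Rightarrow> real) \<Rightarrow> ('a \<Rightarrow> real) \<Rightarrow> real) \<Rightarrow> 'b measure \<Rightarrow>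
   (('a \<Rightarrow> real) \<Rightarrow> ('b \<Rightarrow> real)) \<Rightarrow> (('a \<Rightarrow> real) \<Rightarrow> real) set \<Rightarrow> real \<Rightarrow> enat" where
  "information_complexity F ip M S \<Lambda> \<epsilon> =
    Inf {enat n | n. minimal_error F ip M S \<Lambda> n \<le> \<epsilon> * initial_error F ip M S}"

text \<open>In the following, \<open>N \<epsilon> d\<close> stands for the information complexity of the \<open>d\<close>-variate problem, \<open>d \<ge> 1\<close>.\<close>

definition curse_of_dimensionality :: "(real \<Rightarrow> nat \<Rightarrow> enat) \<Rightarrow> bool" where
  "curse_of_dimensionality N \<longleftrightarrow>
    (\<exists>c>0. \<exists>C>0. \<exists>\<epsilon>0\<in>{0<..<1}.
      infinite {d. d \<ge> 1 \<and> (\<forall>\<epsilon>\<in>{0<..\<epsilon>0}. ereal (C * (1 + c) ^ d) \<le> ereal_of_enat (N \<epsilon> d))})"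

definition qpt_bound :: "(real \<Rightarrow> nat \<Rightarrow> enat) \<Rightarrow> real \<Rightarrow> real \<Rightarrow> bool" where
  "qpt_bound N C t \<longleftrightarrow>
    (\<forall>\<epsilon>\<in>{0<..<1}. \<forall>d\<ge>1.
      ereal_of_enat (N \<epsilon> d) \<le> ereal (C * exp (t * (1 + ln (1 / \<epsilon>)) * (1 + ln (real d)))))"

definition quasi_polynomially_tractable :: "(real \<Rightarrow> nat \<Rightarrow> enat) \<Rightarrow> bool" where
  "quasi_polynomially_tractable N \<longleftrightarrow> (\<exists>C\<ge>0. \<exists>t\<ge>0. qpt_bound N C t)"

definition qpt_exponent :: "(real \<Rightarrow> nat \<Rightarrow> enat) \<Rightarrow> real" where
  "qpt_exponent N = Inf {t. t \<ge> 0 \<and> (\<exists>C\<ge>0. qpt_bound N C t)}"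

definition polynomially_tractable :: "(real \<Rightarrow> nat \<Rightarrow> enat) \<Rightarrow> bool" where
  "polynomially_tractable N \<longleftrightarrow>
    (\<exists>C\<ge>0. \<exists>p\<ge>0. \<exists>q\<ge>0. \<forall>\<epsilon>\<in>{0<..<1}. \<forall>d\<ge>1.
      ereal_of_enat (N \<epsilon> d) \<le> ereal (C * \<epsilon> powr (- p) * real d powr q))"

text \<open>Points of \<open>[0,1]\<^sup>d\<close> are functions \<open>{..<d} \<rightarrow>\<^sub>E {0..1}\<close>; this is the space of the product
  measure.\<close>

definition unit_cube :: "nat \<Rightarrow> (nat \<Rightarrow> real) set" where
  "unit_cube d = {..<d} \<rightarrow>\<^sub>E {0..1}"

definition cube_measure :: "nat \<Rightarrow> (nat \<Rightarrow> real) measure" where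
  "cube_measure d = (\<Pi>\<^sub>M j\<in>{..<d}. restrict_space lborel {0..1})"

text \<open>
  The factor \<open>1 + min s t\<close> is the reproducing kernel of the Sobolev space of absolutely continuous
  functions on \<open>[0,1]\<close> with square-integrable derivative and inner product
  \<open>f 0 * h 0 + \<integral> f' * h'\<close>. The kernel of the \<open>d\<close>-fold Hilbert space tensor power of an RKHS is
  the product of the kernels.
\<close>

definition sobolev_kernel :: "nat \<Rightarrow> (nat \<Rightarrow> real) \<Rightarrow> (nat \<Rightarrow> real) \<Rightarrow> real" where
  "sobolev_kernel d x y = (\<Prod>j<d. 1 + min (x j) (y j))"

definition APP :: "nat \<Rightarrow> ((nat \<Rightarrow> real) \<Rightarrow> real) \<Rightarrow> ((nat \<Rightarrow> real) \<Rightarrow> real)" where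
  "APP d f = f"

definition APP_complexity ::
  "(nat \<Rightarrow> ((nat \<Rightarrow> real) \<Rightarrow> real) set) \<Rightarrow>
   (nat \<Rightarrow> ((nat \<Rightarrow> real) \<Rightarrow> real) \<Rightarrow> ((nat \<Rightarrow> real) \<Rightarrow> real) \<Rightarrow> real) \<Rightarrow>
   (nat \<Rightarrow> (((nat \<Rightarrow> real) \<Rightarrow> real) \<Rightarrow> real) set) \<Rightarrow> real \<Rightarrow> nat \<Rightarrow> enat" where
  "APP_complexity F ip \<Lambda> \<epsilon> d =
    information_complexity (F d) (ip d) (cube_measure d) (APP d) (\<Lambda> d) \<epsilon>"

end

theory Submission
  imports Defs
begin

text \<open>
  For \<open>d = 1\<close> the operator with kernel \<open>1 + min x y\<close> has the eigenvalues \<open>1 / w\<^sup>2\<close> and eigenfunctions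
  \<open>cos (w (1 - x))\<close>, where \<open>w\<close> runs through the positive solutions of \<open>w tan w = 1\<close>; one of them lies in
  each \<open>(k \<pi>, k \<pi> + \<pi>/2)\<close>. The \<open>d\<close>-variate eigenvalues are the products, and for linear information the
  complexity counts those above \<open>\<epsilon>\<^sup>2\<close> times the largest one. With \<open>\<mu> k\<close> the \<open>k\<close>-th
  univariate eigenvalue divided by the largest, this number is at most
  \<open>\<epsilon> powr (- 2 \<tau>) * (\<Sum>k. \<mu> k powr \<tau>)^d\<close>. Since \<open>\<mu> k \<le> (k \<pi>) powr (- 2)\<close> for \<open>k \<ge> 1\<close> and \<open>\<pi> > e\<close>, the choice
  \<open>\<tau> = t (1 + ln d) / 2\<close> with \<open>t > 1\<close> makes the second factor bounded. The decay of order \<open>k powr (- 2)\<close>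
  for \<open>d = 1\<close> forces \<open>t \<ge> 1\<close>, and products with \<open>k\<close> factors \<open>\<mu> 1\<close> show that the complexity grows at least
  like \<open>d^k\<close> for suitable \<open>\<epsilon>\<close>.

  For function values, the leading eigenfunction is split orthogonally into a multiple of the kernel
  section at \<open>1/2\<close> and two parts supported in \<open>[0, 1/2]\<close> and \<open>[1/2, 1]\<close>. Expanding its \<open>d\<close>-fold tensor
  power \<open>e\<close>, each sample point sees only terms of total squared norm at most \<open>(1 - \<delta>)^d\<close>. So
  projecting \<open>e\<close> onto \<open>n\<close> kernel sections costs at most \<open>n (1 - \<delta>)^d\<close> of its squared norm, and the
  remainder, which vanishes at the \<open>n\<close> points, has almost the \<open>L\<^sub>2\<close>-norm of \<open>e\<close>.
\<close>

subsection \<open>Hilbert function spaces\<close>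

text \<open>The spaces are given only by the axioms of a reproducing kernel Hilbert space: no
  formula for the norm, no tensor structure, not even measurability of the elements. Facts about
  \<open>F\<close> are therefore drawn from kernel sections: their span is dense, on it everything
  reduces to the kernel, and inequalities pass to limits. The spectral input is a pointwise,
  absolutely convergent expansion of the univariate kernel, because such expansions multiply over
  the coordinates. Orthogonality of the cosines is a calculation; their completeness is the analytic
  difficulty.

  The exponent 1 depends on \<open>pi > exp 1\<close>: for \<open>t\<close> close to 1 the term
  \<open>ln d\<close> must be absorbed by \<open>t * ln d * ln (k * pi)\<close>, which at
  \<open>k = 1\<close> requires \<open>ln pi \<ge> 1\<close>.

  The splitting at \<open>1/2\<close> rests on the kernel: once the value at \<open>1/2\<close> is
  split off, the univariate space falls apart into functions living on either side of
  \<open>1/2\<close>. A sample coordinate meets at most one side, so a fixed share of the squared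
  norm stays invisible in every coordinate, and these shares compound over \<open>d\<close>
  coordinates.\<close>

lemma quadratic_nonneg_discriminant:
  fixes a b c :: real
  assumes "\<And>t. 0 \<le> a + 2 * b * t + c * t\<^sup>2"
  shows "b\<^sup>2 \<le> a * c"
proof (cases "c = 0")
  case True
  have "b = 0"
  proof (rule ccontr)
    assume "b \<noteq> 0"
    then show False
      using assms[of "- (a + 1) / (2 * b)"] True by simp
  qed
  then show ?thesis using True by simp
next
  case False
  have "0 < c"
  proof (rule ccontr)
    assume "\<not> 0 < c"
    with False have c: "c < 0" by simp
    \<comment> \<open>At least 1, and so large that \<open>c * s\<close> lies below
      \<open>- (\<bar>a\<bar> + 2 * \<bar>b\<bar> + 1)\<close>. At \<open>s\<close> the quadratic
      term then outweighs the other two.\<close>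
    define s where "s = (\<bar>a\<bar> + 2 * \<bar>b\<bar> + 1) / (- c) + 1"
    have s1: "s \<ge> 1" using c by (simp add: s_def divide_nonneg_neg)
    have cs: "c * s = - (\<bar>a\<bar> + 2 * \<bar>b\<bar> + 1) + c" using c by (simp add: s_def field_simps)
    have "a \<le> \<bar>a\<bar> * s" using s1 mult_left_mono[OF s1, of "\<bar>a\<bar>"] by linarith
    moreover have "2 * b * s \<le> 2 * \<bar>b\<bar> * s" using s1 by (intro mult_right_mono) auto
    moreover have "c * s\<^sup>2 = (- (\<bar>a\<bar> + 2 * \<bar>b\<bar> + 1) + c) * s"
      unfolding cs[symmetric] by (simp add: power2_eq_square)
    ultimately have "a + 2 * b * s + c * s\<^sup>2 \<le> (c - 1) * s" by (simp add: algebra_simps)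
    also have "\<dots> < 0" using c s1 by (intro mult_neg_pos) auto
    finally show False using assms[of s] by simp
  qed
  have "0 \<le> a + 2 * b * (- b / c) + c * (- b / c)\<^sup>2" by (rule assms)
  also have "\<dots> = a - b\<^sup>2 / c" using False by (simp add: field_simps power2_eq_square)
  finally show ?thesis using \<open>0 < c\<close> by (simp add: field_simps)
qed

section \<open>Inner product algebra and representers on subspaces\<close>

context hilbert_function_space
begin

lemma sum_closed:
  assumes "finite I" "\<And>i. i \<in> I \<Longrightarrow> g i \<in> F"
  shows "(\<lambda>x. \<Sum>i\<in>I. a i * g i x) \<in> F"
  using assms by (induction I) (auto intro!: zero_closed add_closed scale_closed)

lemma diff_closed: "f \<in> F \<Longrightarrow> g \<in> F \<Longrightarrow> (\<lambda>x. f x - g x) \<in> F"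
  using add_closed[of f "\<lambda>x. (-1) * g x"] scale_closed[of g "-1"] by simp

lemma ip_zero_left: "h \<in> F \<Longrightarrow> ip (\<lambda>x. 0) h = 0"
  using ip_scale_left[of h h 0] by simp

lemma ip_sum_left:
  assumes "finite I" "\<And>i. i \<in> I \<Longrightarrow> g i \<in> F" "h \<in> F"
  shows "ip (\<lambda>x. \<Sum>i\<in>I. a i * g i x) h = (\<Sum>i\<in>I. a i * ip (g i) h)"
  using assms(1,2)
proof (induction I)
  case empty
  then show ?case using ip_zero_left assms(3) by simp
next
  case (insert j I)
  then have "ip (\<lambda>x. a j * g j x + (\<Sum>i\<in>I. a i * g i x)) h
      = ip (\<lambda>x. a j * g j x) h + ip (\<lambda>x. \<Sum>i\<in>I. a i * g i x) h"
    by (intro ip_add_left scale_closed sum_closed assms(3)) auto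
  moreover have "ip (\<lambda>x. a j * g j x) h = a j * ip (g j) h"
    using insert.prems by (intro ip_scale_left assms(3)) auto
  moreover have "ip (\<lambda>x. \<Sum>i\<in>I. a i * g i x) h = (\<Sum>i\<in>I. a i * ip (g i) h)"
    using insert by auto
  ultimately show ?case using insert.hyps by simp
qed

lemma ip_add_right: "f \<in> F \<Longrightarrow> g \<in> F \<Longrightarrow> h \<in> F \<Longrightarrow> ip h (\<lambda>x. f x + g x) = ip h f + ip h g"
  using ip_commute[OF _ add_closed, of h f g] ip_add_left[of f g h] ip_commute[of h f] ip_commute[of h g]
  by simp

lemma ip_scale_right: "f \<in> F \<Longrightarrow> h \<in> F \<Longrightarrow> ip h (\<lambda>x. c * f x) = c * ip h f"
  using ip_commute[OF _ scale_closed, of h f c] ip_scale_left[of f h c] ip_commute[of h f] by simp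

lemma ip_diff_left: "f \<in> F \<Longrightarrow> g \<in> F \<Longrightarrow> h \<in> F \<Longrightarrow> ip (\<lambda>x. f x - g x) h = ip f h - ip g h"
  using ip_add_left[of f "\<lambda>x. (-1) * g x" h] scale_closed[of g "-1"] ip_scale_left[of g h "-1"]
  by simp

lemma ip_diff_right: "f \<in> F \<Longrightarrow> g \<in> F \<Longrightarrow> h \<in> F \<Longrightarrow> ip h (\<lambda>x. f x - g x) = ip h f - ip h g"
  using ip_commute[OF _ diff_closed, of h f g] ip_diff_left[of f g h] ip_commute[of h f] ip_commute[of h g]
  by simp

lemma ip_perturb:
  assumes "f \<in> F" "g \<in> F"
  shows "ip (\<lambda>x. f x + t * g x) (\<lambda>x. f x + t * g x) = ip f f + 2 * ip f g * t + ip g g * t\<^sup>2"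
  using assms
  by (simp add: ip_add_left ip_add_right ip_scale_left ip_scale_right add_closed scale_closed
      ip_commute[of g f] power2_eq_square algebra_simps)

lemma ip_diff_diff:
  assumes "f \<in> F" "g \<in> F"
  shows "ip (\<lambda>x. f x - g x) (\<lambda>x. f x - g x) = ip f f - 2 * ip f g + ip g g"
  using ip_perturb[OF assms, of "-1"] by simp

lemma ip_Cauchy_Schwarz:
  assumes "f \<in> F" "g \<in> F"
  shows "(ip f g)\<^sup>2 \<le> ip f f * ip g g"
  by (rule quadratic_nonneg_discriminant, unfold ip_perturb[OF assms, symmetric])
    (intro ip_nonneg add_closed scale_closed assms)

lemma ip_norm_nonneg: "f \<in> F \<Longrightarrow> 0 \<le> ip_norm ip f"
  by (simp add: ip_norm_def ip_nonneg)

lemma ip_norm_sq: "f \<in> F \<Longrightarrow> (ip_norm ip f)\<^sup>2 = ip f f"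
  by (simp add: ip_norm_def ip_nonneg)

lemma abs_ip_le:
  assumes "f \<in> F" "g \<in> F"
  shows "\<bar>ip f g\<bar> \<le> ip_norm ip f * ip_norm ip g"
  using real_sqrt_le_mono[OF ip_Cauchy_Schwarz[OF assms]]
  by (simp add: ip_norm_def real_sqrt_mult)

lemma tendsto_ip_left:
  assumes "\<And>n. u n \<in> F" "h \<in> F" "v \<in> F"
    and lim: "(\<lambda>n. ip_norm ip (\<lambda>x. u n x - h x)) \<longlonglongrightarrow> 0"
  shows "(\<lambda>n. ip (u n) v) \<longlonglongrightarrow> ip h v"
proof -
  have "(\<lambda>n. ip (u n) v - ip h v) \<longlonglongrightarrow> 0"
  proof (rule Lim_null_comparison)
    show "(\<lambda>n. ip_norm ip (\<lambda>x. u n x - h x) * ip_norm ip v) \<longlonglongrightarrow> 0"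
      using tendsto_mult_left_zero[OF lim] .
    show "\<forall>\<^sub>F n in sequentially. norm (ip (u n) v - ip h v) \<le> ip_norm ip (\<lambda>x. u n x - h x) * ip_norm ip v"
      using abs_ip_le[OF diff_closed[OF assms(1,2)] assms(3)] assms(1-3)
      by (simp add: ip_diff_left)
  qed
  then show ?thesis by (rule LIM_zero_cancel)
qed

lemma tendsto_ip_self:
  assumes "\<And>n. u n \<in> F" "h \<in> F"
    and lim: "(\<lambda>n. ip_norm ip (\<lambda>x. u n x - h x)) \<longlonglongrightarrow> 0"
  shows "(\<lambda>n. ip (u n) (u n)) \<longlonglongrightarrow> ip h h"
proof -
  have "(\<lambda>n. (ip_norm ip (\<lambda>x. u n x - h x))\<^sup>2 + 2 * ip (u n) h - ip h h) \<longlonglongrightarrow> 0\<^sup>2 + 2 * ip h h - ip h h"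
    by (intro tendsto_intros lim tendsto_ip_left assms)
  moreover have "(ip_norm ip (\<lambda>x. u n x - h x))\<^sup>2 + 2 * ip (u n) h - ip h h = ip (u n) (u n)" for n
    using assms(1,2) by (simp add: ip_norm_sq diff_closed ip_diff_diff)
  ultimately show ?thesis by simp
qed

definition is_subspace :: "('a \<Rightarrow> real) set \<Rightarrow> bool" where
  "is_subspace V \<longleftrightarrow> V \<subseteq> F \<and> (\<lambda>x. 0) \<in> V \<and> (\<forall>f\<in>V. \<forall>g\<in>V. (\<lambda>x. f x + g x) \<in> V) \<and>
    (\<forall>f\<in>V. \<forall>c. (\<lambda>x. c * f x) \<in> V)"

text \<open>The representer is the limit of a minimizing sequence of \<open>\<parallel>v\<parallel>\<^sup>2 - 2 l v\<close>. Besides the Riesz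
  representation theorem (\<open>V = F\<close>), this yields orthogonal projections (\<open>l v = \<langle>v, f\<rangle>\<close>).\<close>

lemma subspace_representer:
  assumes V: "is_subspace V"
    and ladd: "\<And>f g. f \<in> V \<Longrightarrow> g \<in> V \<Longrightarrow> l (\<lambda>x. f x + g x) = l f + l g"
    and lscale: "\<And>f c. f \<in> V \<Longrightarrow> l (\<lambda>x. c * f x) = c * l f"
    and bound: "\<And>f. f \<in> V \<Longrightarrow> (l f)\<^sup>2 \<le> C * ip f f"
  obtains h u where "h \<in> F" "\<And>n. u n \<in> V"
    "(\<lambda>n. ip_norm ip (\<lambda>x. u n x - h x)) \<longlonglongrightarrow> 0" "\<And>v. v \<in> V \<Longrightarrow> ip v h = l v"
proof -
  have VF: "f \<in> V \<Longrightarrow> f \<in> F" and V0: "(\<lambda>x. 0) \<in> V"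
    and Vadd: "f \<in> V \<Longrightarrow> g \<in> V \<Longrightarrow> (\<lambda>x. f x + g x) \<in> V"
    and Vscale: "f \<in> V \<Longrightarrow> (\<lambda>x. c * f x) \<in> V" for f g c
    using V by (auto simp: is_subspace_def)
  define J where "J v = ip v v - 2 * l v" for v
  define m where "m = Inf (J ` V)"
  have lower: "- \<bar>C\<bar> \<le> J v" if v: "v \<in> V" for v
  proof -
    have *: "(l v)\<^sup>2 \<le> \<bar>C\<bar> * ip v v"
      using bound[OF v] mult_right_mono[OF abs_ge_self[of C] ip_nonneg[OF VF[OF v]]] by linarith
    have "2 * l v \<le> \<bar>C\<bar> + ip v v"
    proof (rule power2_le_imp_le)
      have "4 * (\<bar>C\<bar> * ip v v) \<le> (\<bar>C\<bar> + ip v v)\<^sup>2"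
        using zero_le_power2[of "\<bar>C\<bar> - ip v v"] by (simp add: power2_eq_square algebra_simps)
      then show "(2 * l v)\<^sup>2 \<le> (\<bar>C\<bar> + ip v v)\<^sup>2" using * by (simp add: power_mult_distrib)
      show "0 \<le> \<bar>C\<bar> + ip v v" using ip_nonneg[OF VF[OF v]] by simp
    qed
    then show ?thesis by (simp add: J_def)
  qed
  have mle: "m \<le> J v" if "v \<in> V" for v
    unfolding m_def using that lower by (intro cInf_lower bdd_belowI[of _ "-\<bar>C\<bar>"]) auto
  have "\<exists>v\<in>V. J v < m + 1 / real (Suc n)" for n
  proof -
    have "Inf (J ` V) < m + 1 / real (Suc n)" by (simp add: m_def)
    then obtain y where "y \<in> J ` V" "y < m + 1 / real (Suc n)"
      using V0 cInf_lessD[of "J ` V"] by blast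
    then show ?thesis by auto
  qed
  then obtain u where uV: "\<And>n. u n \<in> V" and uJ: "\<And>n. J (u n) < m + 1 / real (Suc n)" by metis
  have uF: "\<And>n. u n \<in> F" using uV VF by blast
  \<comment> \<open>Parallelogram law: the midpoint \<open>h\<close> lies in \<open>V\<close>, so
    \<open>m \<le> J h\<close>, and this bounds the distance between two almost minimizers. Hence
    the minimizing sequence is Cauchy.\<close>
  have near: "ip (\<lambda>x. u p x - u q x) (\<lambda>x. u p x - u q x) \<le> 2 / real (Suc p) + 2 / real (Suc q)" for p q
  proof -
    define w where "w = (\<lambda>x. u p x + u q x)"
    define h where "h = (\<lambda>x. (1/2) * w x)"
    have wV: "w \<in> V" unfolding w_def by (rule Vadd[OF uV uV])
    have hV: "h \<in> V" unfolding h_def by (rule Vscale[OF wV])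
    have 1: "ip h h = (1/2) * ip w h"
      by (subst (1) h_def) (rule ip_scale_left[OF VF[OF wV] VF[OF hV]])
    have 2: "ip w h = (1/2) * ip w w"
      unfolding h_def by (rule ip_scale_right[OF VF[OF wV] VF[OF wV]])
    have 3: "l h = (1/2) * l w" unfolding h_def by (rule lscale[OF wV])
    have 4: "l w = l (u p) + l (u q)" unfolding w_def by (rule ladd[OF uV uV])
    have 5: "ip w w = ip (u p) (u p) + 2 * ip (u p) (u q) + ip (u q) (u q)"
      using ip_perturb[of "u p" "u q" 1] uF by (simp add: w_def)
    have "m \<le> J h" by (rule mle[OF hV])
    also have "J h = (1/4) * (ip (u p) (u p) + 2 * ip (u p) (u q) + ip (u q) (u q)) - (l (u p) + l (u q))"
      unfolding J_def 1 2 3 4 5 by (simp add: field_simps)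
    finally have "m \<le> (1/4) * (ip (u p) (u p) + 2 * ip (u p) (u q) + ip (u q) (u q)) - (l (u p) + l (u q))" .
    then have "4 * m \<le> ip (u p) (u p) + 2 * ip (u p) (u q) + ip (u q) (u q) - 4 * l (u p) - 4 * l (u q)"
      by (simp add: algebra_simps)
    moreover have "2 * ip (u p) (u p) - 4 * l (u p) < 2 * m + 2 / real (Suc p)"
      "2 * ip (u q) (u q) - 4 * l (u q) < 2 * m + 2 / real (Suc q)"
      using uJ[of p] uJ[of q] unfolding J_def by (simp_all add: field_simps)
    ultimately show ?thesis
      unfolding ip_diff_diff[OF uF uF] by linarith
  qed
  have "\<exists>N. \<forall>p\<ge>N. \<forall>q\<ge>N. ip_norm ip (\<lambda>x. u p x - u q x) < e" if e: "e > 0" for e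
  proof -
    obtain N where N: "1 / real (Suc N) < e\<^sup>2 / 4"
      using e by (metis nat_approx_posE zero_less_power divide_pos_pos zero_less_numeral)
    have "ip_norm ip (\<lambda>x. u p x - u q x) < e" if "p \<ge> N" "q \<ge> N" for p q
    proof -
      have "1 / real (Suc p) \<le> 1 / real (Suc N)" "1 / real (Suc q) \<le> 1 / real (Suc N)"
        using that by (auto intro!: divide_left_mono)
      then have "ip (\<lambda>x. u p x - u q x) (\<lambda>x. u p x - u q x) < e\<^sup>2"
        using near[of p q] N by simp
      then show ?thesis unfolding ip_norm_def using e real_less_lsqrt by simp
    qed
    then show ?thesis by blast
  qed
  from complete[OF uF this] obtain h where h: "h \<in> F"
    and lim: "(\<lambda>n. ip_norm ip (\<lambda>x. u n x - h x)) \<longlonglongrightarrow> 0" by blast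
  have "ip v h = l v" if v: "v \<in> V" for v
  proof -
    \<comment> \<open>The polynomial \<open>J (u n + t v) - m\<close> in \<open>t\<close> is
      nonnegative and its constant term is below \<open>1 / (n + 1)\<close>; the discriminant
      inequality then bounds the defect of \<open>u n\<close> as a representer.\<close>
    have "(ip (u n) v - l v)\<^sup>2 \<le> 1 / real (Suc n) * ip v v" for n
    proof (rule quadratic_nonneg_discriminant)
      fix t
      have "m \<le> J (\<lambda>x. u n x + t * v x)" by (intro mle Vadd Vscale uV v)
      also have "\<dots> = J (u n) + 2 * (ip (u n) v - l v) * t + ip v v * t\<^sup>2"
        unfolding J_def ip_perturb[OF uF VF[OF v]] ladd[OF uV Vscale[OF v]] lscale[OF v]
        by (simp add: algebra_simps)
      finally show "0 \<le> 1 / real (Suc n) + 2 * (ip (u n) v - l v) * t + ip v v * t\<^sup>2"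
        using uJ[of n] by simp
    qed
    moreover have "(\<lambda>n. 1 / real (Suc n) * ip v v) \<longlonglongrightarrow> 0"
      using LIMSEQ_Suc[OF lim_1_over_n] by (intro tendsto_mult_left_zero) auto
    moreover have "(\<lambda>n. (ip (u n) v - l v)\<^sup>2) \<longlonglongrightarrow> (ip h v - l v)\<^sup>2"
      by (intro tendsto_intros tendsto_ip_left[OF uF h VF[OF v] lim])
    ultimately have "(ip h v - l v)\<^sup>2 \<le> 0"
      by (meson LIMSEQ_le)
    then show ?thesis using ip_commute[OF h VF[OF v]] by simp
  qed
  then show thesis by (rule that[OF h uV lim])
qed

lemma is_subspace_carrier: "is_subspace F"
  by (auto simp: is_subspace_def zero_closed add_closed scale_closed)

end

text \<open>Generated inductively, so that measurability and the Parseval identities can be carried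
  from kernel sections to the span by rule induction.\<close>

inductive_set section_span :: "'a set \<Rightarrow> ('a \<Rightarrow> 'a \<Rightarrow> real) \<Rightarrow> ('a \<Rightarrow> real) set"
  for X :: "'a set" and K :: "'a \<Rightarrow> 'a \<Rightarrow> real" where
  zero: "(\<lambda>x. 0) \<in> section_span X K"
| sect: "y \<in> X \<Longrightarrow> kernel_section X K y \<in> section_span X K"
| add: "f \<in> section_span X K \<Longrightarrow> g \<in> section_span X K \<Longrightarrow> (\<lambda>x. f x + g x) \<in> section_span X K"
| scale: "f \<in> section_span X K \<Longrightarrow> (\<lambda>x. c * f x) \<in> section_span X K"

context rkhs
begin

lemma section_span_subset: "f \<in> section_span X K \<Longrightarrow> f \<in> F"
  by (induction rule: section_span.induct) (auto intro: zero_closed section_closed add_closed scale_closed)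

lemma ip_section_section:
  assumes "x \<in> X" "y \<in> X"
  shows "ip (kernel_section X K x) (kernel_section X K y) = K y x"
  using reproducing[OF section_closed[OF assms(1)] assms(2)] assms by (simp add: kernel_section_def)

lemma abs_le_norm:
  assumes "f \<in> F" "x \<in> X"
  shows "\<bar>f x\<bar> \<le> sqrt (K x x) * ip_norm ip f"
  using abs_ip_le[OF assms(1) section_closed[OF assms(2)]] assms
  by (simp add: reproducing ip_section_section ip_norm_def[of ip "kernel_section X K x"] mult.commute)

text \<open>Projecting \<open>f\<close> onto the span yields an \<open>h\<close> with the same inner
  products with all kernel sections, that is, with the same values as \<open>f\<close>. The sequence
  approximating \<open>h\<close> thus approximates \<open>f\<close>.\<close>

lemma section_span_dense:
  assumes f: "f \<in> F"
  obtains u where "\<And>n. u n \<in> section_span X K" "(\<lambda>n. ip_norm ip (\<lambda>x. u n x - f x)) \<longlonglongrightarrow> 0"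
proof -
  have V: "is_subspace (section_span X K)"
    by (auto simp: is_subspace_def intro: section_span_subset section_span.intros)
  have SF: "v \<in> F" if "v \<in> section_span X K" for v using that by (rule section_span_subset)
  obtain h u where h: "h \<in> F" and u: "\<And>n. u n \<in> section_span X K"
    and lim: "(\<lambda>n. ip_norm ip (\<lambda>x. u n x - h x)) \<longlonglongrightarrow> 0"
    and eq: "\<And>v. v \<in> section_span X K \<Longrightarrow> ip v h = ip v f"
  proof (rule subspace_representer[OF V, of "\<lambda>v. ip v f" "ip f f"])
    show "(ip v f)\<^sup>2 \<le> ip f f * ip v v" if "v \<in> section_span X K" for v
      using ip_Cauchy_Schwarz[OF SF[OF that] f] by (simp add: mult.commute)
    show "ip (\<lambda>x. v x + w x) f = ip v f + ip w f"
      if "v \<in> section_span X K" "w \<in> section_span X K" for v w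
      by (rule ip_add_left[OF SF[OF that(1)] SF[OF that(2)] f])
    show "ip (\<lambda>x. c * v x) f = c * ip v f" if "v \<in> section_span X K" for v c
      by (rule ip_scale_left[OF SF[OF that] f])
  qed blast
  have "h x = f x" for x
  proof (cases "x \<in> X")
    case True
    have "h x = ip (kernel_section X K x) h"
      using reproducing[OF h True] ip_commute[OF h section_closed[OF True]] by simp
    also have "\<dots> = ip (kernel_section X K x) f" by (rule eq[OF section_span.sect[OF True]])
    also have "\<dots> = f x"
      using reproducing[OF f True] ip_commute[OF f section_closed[OF True]] by simp
    finally show ?thesis .
  next
    case False
    then show ?thesis using zero_outside[OF f] zero_outside[OF h] by simp
  qed
  then have "h = f" by blast
  with u lim show thesis by (intro that) auto
qed

lemma tendsto_pointwise:
  assumes "\<And>n. u n \<in> F" "h \<in> F"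
    and lim: "(\<lambda>n. ip_norm ip (\<lambda>x. u n x - h x)) \<longlonglongrightarrow> 0" and "x \<in> X"
  shows "(\<lambda>n. u n x) \<longlonglongrightarrow> h x"
  using tendsto_ip_left[OF assms(1,2) section_closed[OF assms(4)] lim] assms
  by (simp add: reproducing)

end

subsection \<open>The univariate eigenvalue problem\<close>

abbreviation unit_measure :: "real measure" where
  "unit_measure \<equiv> restrict_space lborel {0..1}"

lemma finite_unit_measure: "finite_measure unit_measure"
  by (rule finite_measureI) (simp add: emeasure_restrict_space)

lemma integrable_continuous_unit:
  fixes f :: "real \<Rightarrow> real"
  assumes "continuous_on {0..1} f"
  shows "integrable unit_measure f"
proof -
  have "set_integrable lborel {0..1} f" by (rule borel_integrable_atLeastAtMost'[OF assms])
  then show ?thesis by (subst integrable_restrict_space) (auto simp: set_integrable_def)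
qed

lemma integral_unit_eq:
  fixes f :: "real \<Rightarrow> real"
  assumes "continuous_on {0..1} f"
  shows "integral\<^sup>L unit_measure f = integral {0..1} f"
proof -
  have "set_integrable lborel {0..1} f" by (rule borel_integrable_atLeastAtMost'[OF assms])
  from set_borel_integral_eq_integral(2)[OF this] show ?thesis
    by (subst integral_restrict_space) (auto simp: set_lebesgue_integral_def)
qed

lemma integral_unit_FTC:
  fixes f F :: "real \<Rightarrow> real"
  assumes "continuous_on {0..1} f" "\<And>x. (F has_real_derivative f x) (at x)"
  shows "integral\<^sup>L unit_measure f = F 1 - F 0"
proof -
  have "(f has_integral F 1 - F 0) {0..1}"
    using assms(2)
    by (intro fundamental_theorem_of_calculus)
      (auto intro: has_field_derivative_at_within simp flip: has_real_derivative_iff_has_vector_derivative)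
  then show ?thesis unfolding integral_unit_eq[OF assms(1)] by (rule integral_unique)
qed

lemma integral_unit_Cauchy_Schwarz:
  fixes f g :: "real \<Rightarrow> real"
  assumes [continuous_intros]: "continuous_on {0..1} f" "continuous_on {0..1} g"
  shows "(LINT x|unit_measure. f x * g x)\<^sup>2
    \<le> (LINT x|unit_measure. (f x)\<^sup>2) * (LINT x|unit_measure. (g x)\<^sup>2)"
proof (rule quadratic_nonneg_discriminant)
  fix t
  have "0 \<le> (LINT x|unit_measure. (f x + t * g x)\<^sup>2)" by simp
  also have "\<dots> = (LINT x|unit_measure. (f x)\<^sup>2 + 2 * t * (f x * g x) + t\<^sup>2 * (g x)\<^sup>2)"
    by (simp add: power2_eq_square algebra_simps)
  also have "\<dots> = (LINT x|unit_measure. (f x)\<^sup>2) + 2 * t * (LINT x|unit_measure. f x * g x)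
      + t\<^sup>2 * (LINT x|unit_measure. (g x)\<^sup>2)"
    by (subst Bochner_Integration.integral_add
        | intro integrable_continuous_unit continuous_intros integral_mult_right_zero
        | simp)+
  finally show "0 \<le> (LINT x|unit_measure. (f x)\<^sup>2) + 2 * (LINT x|unit_measure. f x * g x) * t
      + (LINT x|unit_measure. (g x)\<^sup>2) * t\<^sup>2"
    by (simp add: algebra_simps)
qed

lemma integral_unit_nonneg_eq_0:
  fixes f :: "real \<Rightarrow> real"
  assumes "continuous_on {0..1} f" "\<And>x. x \<in> {0..1} \<Longrightarrow> 0 \<le> f x"
    and "integral\<^sup>L unit_measure f = 0" "x \<in> {0..1}"
  shows "f x = 0"
proof -
  have "integral {0..1} f = 0" using assms(3) integral_unit_eq[OF assms(1)] by simp
  then show ?thesis using integral_eq_0_iff[OF assms(1)] assms by auto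
qed

lemma integral_cos_cos:
  assumes "a\<^sup>2 \<noteq> b\<^sup>2"
  shows "(LINT x|unit_measure. cos (a * (1 - x)) * cos (b * (1 - x)))
    = (a * sin a * cos b - b * cos a * sin b) / (a\<^sup>2 - b\<^sup>2)"
proof -
  define F where "F x = (b * cos (a * (1 - x)) * sin (b * (1 - x)) - a * sin (a * (1 - x)) * cos (b * (1 - x))) / (a\<^sup>2 - b\<^sup>2)" for x
  have "(LINT x|unit_measure. cos (a * (1 - x)) * cos (b * (1 - x))) = F 1 - F 0"
  proof (rule integral_unit_FTC)
    fix x
    have "((\<lambda>x. b * cos (a * (1 - x)) * sin (b * (1 - x)) - a * sin (a * (1 - x)) * cos (b * (1 - x)))
        has_real_derivative (a\<^sup>2 - b\<^sup>2) * (cos (a * (1 - x)) * cos (b * (1 - x)))) (at x)"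
      by (auto intro!: derivative_eq_intros simp: algebra_simps power2_eq_square)
    from DERIV_cdivide[OF this, of "a\<^sup>2 - b\<^sup>2"]
    show "(F has_real_derivative cos (a * (1 - x)) * cos (b * (1 - x))) (at x)"
      using assms unfolding F_def by simp
  qed (intro continuous_intros)
  also have "\<dots> = (a * sin a * cos b - b * cos a * sin b) / (a\<^sup>2 - b\<^sup>2)"
    by (simp add: F_def diff_divide_distrib)
  finally show ?thesis .
qed

lemma integral_cos_sq:
  assumes "a \<noteq> 0"
  shows "(LINT x|unit_measure. (cos (a * (1 - x)))\<^sup>2) = 1 / 2 + sin a * cos a / (2 * a)"
proof -
  define F where "F x = x / 2 - sin (a * (1 - x)) * cos (a * (1 - x)) / (2 * a)" for x
  have "(LINT x|unit_measure. (cos (a * (1 - x)))\<^sup>2) = F 1 - F 0"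
  proof (rule integral_unit_FTC)
    fix x
    have "(F has_real_derivative 1 / 2 - (- a * cos (a * (1 - x)) * cos (a * (1 - x)) + a * sin (a * (1 - x)) * sin (a * (1 - x))) / (2 * a)) (at x)"
      unfolding F_def using assms
      by (auto intro!: derivative_eq_intros simp: field_simps power2_eq_square)
    moreover have "1 / 2 - (- a * cos (a * (1 - x)) * cos (a * (1 - x)) + a * sin (a * (1 - x)) * sin (a * (1 - x))) / (2 * a)
        = 1 / 2 - ((sin (a * (1 - x)))\<^sup>2 - (cos (a * (1 - x)))\<^sup>2) / 2"
      using assms by (simp add: field_simps power2_eq_square)
    moreover have "\<dots> = (cos (a * (1 - x)))\<^sup>2" by (simp add: sin_squared_eq field_simps)
    ultimately show "(F has_real_derivative (cos (a * (1 - x)))\<^sup>2) (at x)" by simp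
  qed (intro continuous_intros)
  then show ?thesis by (simp add: F_def)
qed

text \<open>Antiderivatives \<open>F\<close> and \<open>G\<close> are used on the two sides of the
  kink of \<open>min\<close> at \<open>x\<close>. Their boundary terms with \<open>sin\<close> at
  \<open>x\<close> cancel, the one at 1 vanishes, and the one at 0 is
  \<open>cos w / w^2 - sin w / w\<close>, which is zero exactly by \<open>eq\<close>.\<close>

lemma integral_kernel_cos:
  assumes w: "w \<noteq> 0" and eq: "w * sin w = cos w" and x: "x \<in> {0..1}"
  shows "(LINT y|unit_measure. (1 + min x y) * cos (w * (1 - y))) = cos (w * (1 - x)) / w\<^sup>2"
proof -
  define F where "F y = cos (w * (1 - y)) / w\<^sup>2 - (1 + y) * sin (w * (1 - y)) / w" for y
  define G where "G y = - (1 + x) * sin (w * (1 - y)) / w" for y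
  have "(F has_real_derivative (1 + y) * cos (w * (1 - y))) (at y)" for y
    unfolding F_def using w
    by (auto intro!: derivative_eq_intros simp: field_simps power2_eq_square)
  then have "((\<lambda>y. (1 + y) * cos (w * (1 - y))) has_integral F x - F 0) {0..x}"
    using x by (intro fundamental_theorem_of_calculus)
      (auto intro: has_field_derivative_at_within simp flip: has_real_derivative_iff_has_vector_derivative)
  then have 1: "((\<lambda>y. (1 + min x y) * cos (w * (1 - y))) has_integral F x - F 0) {0..x}"
    by (rule has_integral_eq[rotated]) auto
  have "(G has_real_derivative (1 + x) * cos (w * (1 - y))) (at y)" for y
    unfolding G_def using w by (auto intro!: derivative_eq_intros simp: field_simps)
  then have "((\<lambda>y. (1 + x) * cos (w * (1 - y))) has_integral G 1 - G x) {x..1}"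
    using x by (intro fundamental_theorem_of_calculus)
      (auto intro: has_field_derivative_at_within simp flip: has_real_derivative_iff_has_vector_derivative)
  then have 2: "((\<lambda>y. (1 + min x y) * cos (w * (1 - y))) has_integral G 1 - G x) {x..1}"
    by (rule has_integral_eq[rotated]) auto
  have "((\<lambda>y. (1 + min x y) * cos (w * (1 - y))) has_integral F x - F 0 + (G 1 - G x)) {0..1}"
    using x by (intro has_integral_combine[OF _ _ 1 2]) auto
  then have "integral {0..1} (\<lambda>y. (1 + min x y) * cos (w * (1 - y))) = F x - F 0 + (G 1 - G x)"
    by (rule integral_unique)
  also have "\<dots> = cos (w * (1 - x)) / w\<^sup>2"
    using w eq[symmetric] by (simp add: F_def G_def field_simps power2_eq_square)
  finally show ?thesis
    by (subst integral_unit_eq) (auto intro!: continuous_intros)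
qed


lemma abs_integral_unit_le:
  fixes f :: "real \<Rightarrow> real"
  assumes "continuous_on {0..1} f" "\<And>x. x \<in> {0..1} \<Longrightarrow> \<bar>f x\<bar> \<le> e"
  shows "\<bar>integral\<^sup>L unit_measure f\<bar> \<le> e"
proof -
  have "norm (integral {0..1} f) \<le> e * (1 - 0)"
    using assms by (intro integral_bound) auto
  then show ?thesis using integral_unit_eq[OF assms(1)] by simp
qed

section \<open>Location of the frequencies\<close>

lemma x_cos_le_sin:
  fixes x :: real
  assumes "0 \<le> x" "x \<le> pi"
  shows "x * cos x \<le> sin x"
proof -
  have "sin 0 - 0 * cos 0 \<le> sin x - x * cos x"
  proof (rule DERIV_nonneg_imp_nondecreasing[OF assms(1)])
    fix y assume "0 \<le> y" "y \<le> x"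
    moreover have "((\<lambda>y. sin y - y * cos y) has_real_derivative y * sin y) (at y)"
      by (auto intro!: derivative_eq_intros)
    ultimately show "\<exists>z. ((\<lambda>y. sin y - y * cos y) has_real_derivative z) (at y) \<and> 0 \<le> z"
      using assms sin_ge_zero[of y] by (intro exI[of _ "y * sin y"]) auto
  qed
  then show ?thesis by simp
qed

lemma abs_cos_diff_le: "\<bar>cos a - cos b\<bar> \<le> \<bar>a - b\<bar>" for a b :: real
proof -
  have "\<bar>cos a - cos b\<bar> = 2 * (\<bar>sin ((a + b) / 2)\<bar> * \<bar>sin ((b - a) / 2)\<bar>)"
    by (simp add: cos_diff_cos abs_mult)
  also have "\<bar>sin ((a + b) / 2)\<bar> * \<bar>sin ((b - a) / 2)\<bar> \<le> 1 * \<bar>(b - a) / 2\<bar>"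
    by (intro mult_mono abs_sin_x_le_abs_x) auto
  finally show ?thesis by simp
qed

text \<open>The positive solutions \<open>k \<pi> + shift k\<close> of \<open>w tan w = 1\<close>.\<close>

lemma shift_exists: "\<exists>d. 0 < d \<and> d < pi / 2 \<and> (real k * pi + d) * sin d = cos d"
proof -
  have "\<exists>d\<ge>0. d \<le> pi / 2 \<and> cos d - (real k * pi + d) * sin d = 0"
  proof (rule IVT2')
    have "0 \<le> real k * pi" by simp
    then show "cos (pi / 2) - (real k * pi + pi / 2) * sin (pi / 2) \<le> 0"
      using pi_gt_zero by (simp only: cos_pi_half sin_pi_half mult_1_right)
  qed (auto intro!: continuous_intros)
  then obtain d where d: "0 \<le> d" "d \<le> pi / 2" "(real k * pi + d) * sin d = cos d" by auto
  have "d \<noteq> 0" using d(3) by auto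
  moreover have "d \<noteq> pi / 2"
  proof
    assume d2: "d = pi / 2"
    have "real k * pi + pi / 2 = 0"
      using d(3) unfolding d2 by (simp only: sin_pi_half cos_pi_half mult_1_right)
    moreover have "0 \<le> real k * pi" by simp
    ultimately show False using pi_gt_zero by linarith
  qed
  ultimately show ?thesis using d by (intro exI[of _ d]) auto
qed

definition shift :: "nat \<Rightarrow> real" where
  "shift k = (SOME d. 0 < d \<and> d < pi / 2 \<and> (real k * pi + d) * sin d = cos d)"

definition freq :: "nat \<Rightarrow> real" where
  "freq k = real k * pi + shift k"

lemma shift: "0 < shift k" "shift k < pi / 2" "freq k * sin (shift k) = cos (shift k)"
  using someI_ex[OF shift_exists[of k]] by (auto simp: shift_def freq_def)

lemma freq_pos: "0 < freq k"
  using shift(1)[of k] by (simp add: freq_def add_nonneg_pos)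

lemma freq_eq: "freq k * sin (freq k) = cos (freq k)"
proof -
  have "sin (freq k) = (- 1) ^ k * sin (shift k)" "cos (freq k) = (- 1) ^ k * cos (shift k)"
    by (simp_all add: freq_def sin_add cos_add)
  then show ?thesis using shift(3)[of k] by simp
qed

lemma freq_bounds: "real k * pi < freq k" "freq k < real (Suc k) * pi"
  using shift(1,2)[of k] pi_gt_zero unfolding freq_def by (simp_all add: algebra_simps)

lemma freq_less: "j < k \<Longrightarrow> freq j < freq k"
proof -
  assume "j < k"
  then have "real (Suc j) * pi \<le> real k * pi" by (intro mult_right_mono) auto
  then show ?thesis using freq_bounds[of j] freq_bounds[of k] by linarith
qed

lemma freq_sq_neq: "j \<noteq> k \<Longrightarrow> (freq j)\<^sup>2 \<noteq> (freq k)\<^sup>2"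
  using freq_less[of j k] freq_less[of k j] freq_pos[of j] freq_pos[of k]
  by (metis less_irrefl linorder_neqE_nat power2_eq_iff_nonneg less_imp_le)

text \<open>As \<open>pi / 4 < 1\<close>, \<open>tan 1 > 1\<close>, so a solution of
  \<open>w tan w = 1\<close> in \<open>(0, pi / 2)\<close> lies below 1. This yields
  \<open>eig 0 > 1\<close> and the bound for \<open>k = 0\<close> in
  \<open>cosfun_near_cosine\<close>.\<close>

lemma freq_0_less_1: "freq 0 < 1"
proof (rule ccontr)
  assume "\<not> freq 0 < 1"
  then have 1: "1 \<le> shift 0" by (simp add: freq_def)
  have "sin (pi / 4) < sin 1"
    using pi_less_4 pi_gt3 by (intro sin_monotone_2pi) auto
  also have "\<dots> \<le> sin (shift 0)"
    using 1 shift(2)[of 0] pi_gt_zero by (intro sin_monotone_2pi_le) auto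
  also have "\<dots> \<le> shift 0 * sin (shift 0)"
    using 1 shift(1,2)[of 0] sin_ge_zero[of "shift 0"] by (simp add: mult_le_cancel_right1)
  also have "\<dots> = cos (shift 0)" using shift(3)[of 0] by (simp add: freq_def)
  also have "\<dots> \<le> cos 1" using 1 shift(2)[of 0] by (intro cos_monotone_0_pi_le) auto
  also have "\<dots> < cos (pi / 4)" using pi_less_4 pi_gt3 by (intro cos_monotone_0_pi) auto
  finally show False by (simp add: sin_45 cos_45)
qed

text \<open>The inequality \<open>d \<le> tan d\<close>, used in the form
  \<open>x_cos_le_sin\<close>, combined with \<open>freq k * tan (shift k) = 1\<close>. The rate
  \<open>1 / k\<close> makes the squared deviations from \<open>k * pi\<close> summable.\<close>

lemma shift_le:
  assumes "k \<ge> 1"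
  shows "shift k \<le> 1 / (real k * pi)"
proof -
  have c: "0 < cos (shift k)" using shift(1,2)[of k] by (intro cos_gt_zero) auto
  have "real k * pi * (shift k * cos (shift k)) \<le> freq k * sin (shift k)"
    using shift(1,2)[of k] x_cos_le_sin[of "shift k"] freq_bounds(1)[of k] freq_pos[of k] pi_gt_zero
      cos_gt_zero[of "shift k"]
    by (intro mult_mono) auto
  also have "\<dots> = 1 * cos (shift k)" by (simp add: shift(3))
  finally have "real k * pi * shift k * cos (shift k) \<le> 1 * cos (shift k)" by (simp add: mult.assoc)
  then have "real k * pi * shift k \<le> 1" by (rule mult_right_le_imp_le[OF _ c])
  then show ?thesis using assms by (simp add: field_simps)
qed


section \<open>Density of cosine polynomials\<close>

lemma cosine_polynomial_times_cos:
  fixes a :: "nat \<Rightarrow> real"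
  shows "\<exists>n b. \<forall>x. cos x * (\<Sum>k<m. a k * cos (real k * x)) = (\<Sum>k<n. b k * cos (real k * x))"
proof -
  define c where "c k = (if k < m then a k else 0)" for k
  \<comment> \<open>From \<open>2 cos x cos (k x) = cos ((k - 1) x) + cos ((k + 1) x)\<close>. For
    \<open>k = 0\<close> both terms on the right are \<open>cos x\<close>, so \<open>c 0\<close>
    enters the coefficient of \<open>cos x\<close> without the factor \<open>1 / 2\<close>.\<close>
  define b where "b k = (if k = 0 then c 1 / 2 else if k = 1 then c 0 + c 2 / 2
    else (c (k - 1) + c (k + 1)) / 2)" for k
  \<comment> \<open>For coefficients without finite support the truncated identity has a boundary
    term, which is what makes the induction go through. It vanishes for \<open>c\<close>, which is
    zero from \<open>m\<close> on.\<close>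
  have step: "(\<Sum>k<Suc (Suc n). c' k * (cos x * cos (real k * x))) =
      (\<Sum>k<Suc (Suc n). (if k = 0 then c' 1 / 2 else if k = 1 then c' 0 + c' 2 / 2
        else (c' (k - 1) + c' (k + 1)) / 2) * cos (real k * x))
      + (c' (Suc n) * cos (real (Suc (Suc n)) * x) - c' (Suc (Suc n)) * cos (real (Suc n) * x)) / 2"
    for c' :: "nat \<Rightarrow> real" and n x
  proof (induction n)
    case 0
    have "cos x * cos x = (1 + cos (2 * x)) / 2" by (simp add: cos_times_cos)
    then have "cos x * (cos x * c' (Suc 0)) = (1 + cos (x * 2)) / 2 * c' (Suc 0)"
      by (simp add: mult_ac)
    then show ?case by (simp add: field_simps numeral_2_eq_2)
  next
    case (Suc n)
    have "real (Suc (Suc n)) * x - x = real (Suc n) * x" "x + real (Suc (Suc n)) * x = real (Suc (Suc (Suc n))) * x"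
      by (simp_all add: algebra_simps)
    then have "cos x * cos (real (Suc (Suc n)) * x) = (cos (real (Suc n) * x) + cos (real (Suc (Suc (Suc n))) * x)) / 2"
      by (metis cos_times_cos cos_minus minus_diff_eq)
    then show ?case using Suc
      by (subst sum.lessThan_Suc, subst (2) sum.lessThan_Suc) (simp add: algebra_simps add_divide_distrib diff_divide_distrib)
  qed
  have "cos x * (\<Sum>k<m. a k * cos (real k * x)) = (\<Sum>k<Suc (Suc m). b k * cos (real k * x))" for x
  proof -
    have "cos x * (\<Sum>k<m. a k * cos (real k * x)) = (\<Sum>k<m. c k * (cos x * cos (real k * x)))"
      by (simp add: sum_distrib_left c_def mult_ac)
    also have "\<dots> = (\<Sum>k<Suc (Suc m). c k * (cos x * cos (real k * x)))"
      by (simp add: c_def)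
    also have "\<dots> = (\<Sum>k<Suc (Suc m). b k * cos (real k * x))"
      unfolding step by (simp add: b_def c_def)
    finally show ?thesis .
  qed
  then show ?thesis by blast
qed

lemma cosine_polynomial_power:
  "\<exists>n b. \<forall>x. cos x ^ m = (\<Sum>k<n. b k * cos (real k * x) :: real)"
proof (induction m)
  case 0
  show ?case by (intro exI[of _ 1] exI[of _ "\<lambda>_. 1"]) simp
next
  case (Suc m)
  then obtain n b where "\<forall>x. cos x ^ m = (\<Sum>k<n. b k * cos (real k * x) :: real)" by blast
  then show ?case using cosine_polynomial_times_cos[of b n] by simp
qed

lemma cosine_polynomial_polynomial:
  "\<exists>n b. \<forall>x. (\<Sum>i\<le>m. a i * cos x ^ i) = (\<Sum>k<n. b k * cos (real k * x) :: real)"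
proof -
  obtain N B where NB: "\<And>i x. cos x ^ i = (\<Sum>k<N i. B i k * cos (real k * x) :: real)"
    using cosine_polynomial_power by metis
  define M where "M = (\<Sum>i\<le>m. N i)"
  have "(\<Sum>i\<le>m. a i * cos x ^ i) = (\<Sum>k<M. (\<Sum>i\<le>m. if k < N i then a i * B i k else 0) * cos (real k * x))" for x
  proof -
    have "(\<Sum>i\<le>m. a i * cos x ^ i) = (\<Sum>i\<le>m. \<Sum>k<M. (if k < N i then a i * B i k else 0) * cos (real k * x))"
    proof (rule sum.cong[OF refl])
      fix i assume "i \<in> {..m}"
      then have le: "N i \<le> M" unfolding M_def by (intro member_le_sum) auto
      have "a i * cos x ^ i = (\<Sum>k<N i. a i * B i k * cos (real k * x))"
        unfolding NB[of x i] by (simp add: sum_distrib_left mult.assoc)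
      also have "\<dots> = (\<Sum>k<M. (if k < N i then a i * B i k else 0) * cos (real k * x))"
        using le by (intro sum.mono_neutral_cong_left) auto
      finally show "a i * cos x ^ i = (\<Sum>k<M. (if k < N i then a i * B i k else 0) * cos (real k * x))" .
    qed
    also have "\<dots> = (\<Sum>k<M. \<Sum>i\<le>m. (if k < N i then a i * B i k else 0) * cos (real k * x))"
      by (rule sum.swap)
    finally show ?thesis by (simp add: sum_distrib_right)
  qed
  then show ?thesis
    by (intro exI[of _ M] exI[of _ "\<lambda>k. \<Sum>i\<le>m. if k < N i then a i * B i k else 0"]) blast
qed

text \<open>The substitution \<open>y = cos (pi * (1 - x))\<close> carries \<open>[0, 1]\<close>
  onto \<open>[-1, 1]\<close>, where the Weierstrass theorem supplies a polynomial in
  \<open>y\<close>, that is, in a cosine.\<close>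

lemma cosine_polynomial_dense:
  assumes h: "continuous_on {0..1} h" and e: "e > 0"
  shows "\<exists>n b. \<forall>x\<in>{0..1}. \<bar>h x - (\<Sum>k<n. b k * cos (real k * pi * (1 - x)))\<bar> < e"
proof -
  have "continuous_on {-1..1} (\<lambda>y. h (1 - arccos y / pi))"
    by (rule continuous_on_compose2[OF h])
      (auto intro!: continuous_intros simp: arccos_lbound arccos_ubound divide_le_eq)
  then obtain g where g: "real_polynomial_function g"
    and gh: "\<And>y. y \<in> {-1..1} \<Longrightarrow> \<bar>h (1 - arccos y / pi) - g y\<bar> < e"
    using Stone_Weierstrass_real_polynomial_function[of "{-1..1}" _ e] e by auto
  obtain a m where "g = (\<lambda>x. \<Sum>i\<le>m. a i * x ^ i)"
    using g real_polynomial_function_iff_sum by auto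
  moreover obtain n b where
    "\<And>x. (\<Sum>i\<le>m. a i * cos x ^ i) = (\<Sum>k<n. b k * cos (real k * x) :: real)"
    using cosine_polynomial_polynomial[of a m] by blast
  ultimately have gb: "g (cos x) = (\<Sum>k<n. b k * cos (real k * x))" for x by simp
  have "\<bar>h x - (\<Sum>k<n. b k * cos (real k * pi * (1 - x)))\<bar> < e" if x: "x \<in> {0..1}" for x
  proof -
    have "arccos (cos (pi * (1 - x))) = pi * (1 - x)"
      using x by (intro arccos_cos) (auto simp: mult_le_cancel_left1)
    then have "h (1 - arccos (cos (pi * (1 - x))) / pi) = h x" by simp
    then show ?thesis using gh[of "cos (pi * (1 - x))"] gb[of "pi * (1 - x)"] by (simp add: mult_ac)
  qed
  then show ?thesis by blast
qed


section \<open>Completeness of the eigenfunctions\<close>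

lemma integral_cosines:
  "(LINT x|unit_measure. cos (real j * pi * (1 - x)) * cos (real k * pi * (1 - x)))
    = (if j = k then if k = 0 then 1 else 1 / 2 else 0)"
proof (cases "j = k")
  case True
  show ?thesis
  proof (cases "k = 0")
    case True
    have "(LINT x|unit_measure. 1 :: real) = 1 - 0"
      by (rule integral_unit_FTC) (auto intro!: derivative_eq_intros)
    with True \<open>j = k\<close> show ?thesis by simp
  next
    case False
    then show ?thesis using \<open>j = k\<close> integral_cos_sq[of "real k * pi"]
      by (simp add: power2_eq_square)
  qed
next
  case False
  have "(real j * pi)\<^sup>2 \<noteq> (real k * pi)\<^sup>2" using False by (simp add: power_mult_distrib)
  from integral_cos_cos[OF this] False show ?thesis by simp
qed

lemma integral_cosine_polynomial_sq:
  "(LINT x|unit_measure. (\<Sum>k<n. b k * cos (real k * pi * (1 - x)))\<^sup>2)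
    = (\<Sum>k<n. (b k)\<^sup>2 * (if k = 0 then 1 else 1 / 2))"
proof -
  have "(LINT x|unit_measure. (\<Sum>k<n. b k * cos (real k * pi * (1 - x)))\<^sup>2)
      = (LINT x|unit_measure. (\<Sum>j<n. \<Sum>k<n. (b j * b k) *
          (cos (real j * pi * (1 - x)) * cos (real k * pi * (1 - x)))))"
    by (simp add: power2_eq_square sum_product mult_ac)
  also have "\<dots> = (\<Sum>j<n. \<Sum>k<n. (b j * b k) *
      (LINT x|unit_measure. cos (real j * pi * (1 - x)) * cos (real k * pi * (1 - x))))"
    by (subst Bochner_Integration.integral_sum
        | intro integrable_continuous_unit continuous_intros sum.cong refl integral_mult_right_zero)+
  also have "\<dots> = (\<Sum>j<n. \<Sum>k<n. if j = k then (b j)\<^sup>2 * (if j = 0 then 1 else 1 / 2) else 0)"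
    unfolding integral_cosines by (intro sum.cong) (auto simp: power2_eq_square)
  also have "\<dots> = (\<Sum>k<n. (b k)\<^sup>2 * (if k = 0 then 1 else 1 / 2))"
    by (intro sum.cong refl) (simp only: sum.delta' finite_lessThan if_True)
  finally show ?thesis .
qed

lemma sum_inverse_squares_le: "(\<Sum>k<n. 1 / (real k + 1)\<^sup>2) \<le> pi\<^sup>2 / 6"
  using inverse_squares_sums sum_le_suminf[of "\<lambda>n. 1 / (real n + 1)\<^sup>2" "{..<n}"]
  by (simp add: sums_iff add.commute)

definition cosfun :: "nat \<Rightarrow> real \<Rightarrow> real" where
  "cosfun k x = cos (freq k * (1 - x))"

lemma continuous_on_cosfun [continuous_intros]: "continuous_on A (cosfun k)"
  unfolding cosfun_def[abs_def] by (intro continuous_intros)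

text \<open>For \<open>k = 0\<close> the argument of the cosine stays in \<open>[0, 1]\<close>, and
  \<open>1 \<le> pi / 3\<close>. For larger \<open>k\<close> the cosine is 1-Lipschitz and the two
  frequencies differ by \<open>shift k\<close>.\<close>

lemma cosfun_near_cosine:
  assumes x: "x \<in> {0..1}"
  shows "\<bar>cos (real k * pi * (1 - x)) - cosfun k x\<bar> \<le> (if k = 0 then 1 / 2 else 1 / (real k * pi))"
proof (cases "k = 0")
  case True
  have "freq 0 * (1 - x) \<le> 1 * 1"
    using freq_pos[of 0] freq_0_less_1 x by (intro mult_mono) auto
  with freq_pos[of 0] x have *: "0 \<le> freq 0 * (1 - x)" "freq 0 * (1 - x) \<le> 1" by auto
  have "cos (pi / 3) \<le> cos (freq 0 * (1 - x))"
    using * pi_gt3 by (intro cos_monotone_0_pi_le) auto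
  then show ?thesis using True by (simp add: cosfun_def cos_60)
next
  case False
  have "\<bar>cos (real k * pi * (1 - x)) - cosfun k x\<bar> \<le> \<bar>real k * pi * (1 - x) - freq k * (1 - x)\<bar>"
    unfolding cosfun_def by (rule abs_cos_diff_le)
  also have "\<dots> = shift k * (1 - x)"
    using shift(1)[of k] x by (simp add: freq_def algebra_simps flip: left_diff_distrib)
  also have "\<dots> \<le> shift k * 1" using shift(1)[of k] x by (intro mult_left_mono) auto
  also have "\<dots> \<le> 1 / (real k * pi)" using shift_le[of k] False by simp
  finally show ?thesis using False by simp
qed

text \<open>The eigenfunctions are quadratically close to the orthogonal basis \<open>cos (k \<pi> (1 - x))\<close>, so
  that no nonzero function is orthogonal to all of them (an argument of Birkhoff and Rota).\<close>

lemma cosfun_complete: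
  assumes h: "continuous_on {0..1} h"
    and orth: "\<And>k. (LINT x|unit_measure. h x * cosfun k x) = 0" and x: "x \<in> {0..1}"
  shows "h x = 0"
proof -
  note [continuous_intros] = h
  define H where "H = (LINT x|unit_measure. (h x)\<^sup>2)"
  have H0: "0 \<le> H" by (simp add: H_def)
  define \<gamma> :: "nat \<Rightarrow> real" where "\<gamma> k = (if k = 0 then 1 else 1 / 2)" for k
  define g where "g k x = cos (real k * pi * (1 - x))" for k x
  have [continuous_intros]: "continuous_on A (g k)" for A k
    unfolding g_def[abs_def] by (intro continuous_intros)
  define r where "r k = (LINT x|unit_measure. h x * g k x)" for k
  \<comment> \<open>Orthogonality of \<open>h\<close> to \<open>cosfun k\<close> permits subtracting
    \<open>cosfun k\<close> from the cosine, so the coefficient is controlled by the difference of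
    the two functions.\<close>
  have r_le: "(r k)\<^sup>2 \<le> H * (if k = 0 then 1 / 2 else 1 / (real k * pi))\<^sup>2" for k
  proof -
    have "r k = (LINT x|unit_measure. h x * g k x) - (LINT x|unit_measure. h x * cosfun k x)"
      by (simp add: r_def orth)
    also have "\<dots> = (LINT x|unit_measure. h x * (g k x - cosfun k x))"
      by (subst Bochner_Integration.integral_diff[symmetric])
        (auto intro!: integrable_continuous_unit continuous_intros simp: algebra_simps)
    finally have "(r k)\<^sup>2 \<le> H * (LINT x|unit_measure. (g k x - cosfun k x)\<^sup>2)"
      unfolding H_def using integral_unit_Cauchy_Schwarz[of h "\<lambda>x. g k x - cosfun k x"]
      by (simp add: continuous_intros)
    also have "\<bar>(LINT x|unit_measure. (g k x - cosfun k x)\<^sup>2)\<bar> \<le> (if k = 0 then 1 / 2 else 1 / (real k * pi))\<^sup>2"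
    proof (rule abs_integral_unit_le)
      fix x :: real assume "x \<in> {0..1}"
      then show "\<bar>(g k x - cosfun k x)\<^sup>2\<bar> \<le> (if k = 0 then 1 / 2 else 1 / (real k * pi))\<^sup>2"
        using cosfun_near_cosine[of x k] unfolding g_def
        by (metis abs_ge_zero abs_power2 power2_abs power_mono)
    qed (intro continuous_intros)
    then have "H * (LINT x|unit_measure. (g k x - cosfun k x)\<^sup>2) \<le> H * (if k = 0 then 1 / 2 else 1 / (real k * pi))\<^sup>2"
      using H0 by (intro mult_left_mono) auto
    finally show ?thesis .
  qed
  \<comment> \<open>The index 0 contributes \<open>1 / 4\<close>, the others \<open>2 / pi^2\<close>
    times \<open>pi^2 / 6\<close>, that is \<open>1 / 3\<close>. Decisive is that the total
    \<open>7 / 12\<close> is below 1.\<close>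
  have rsum: "(\<Sum>k<n. (r k)\<^sup>2 / \<gamma> k) \<le> 7 / 12 * H" for n
  proof (cases n)
    case (Suc m)
    have "(\<Sum>k<n. (r k)\<^sup>2 / \<gamma> k) = (r 0)\<^sup>2 + (\<Sum>k<m. 2 * (r (Suc k))\<^sup>2)"
      unfolding Suc by (subst sum.lessThan_Suc_shift) (simp add: \<gamma>_def mult.commute)
    also have "\<dots> \<le> H * (1 / 2)\<^sup>2 + (\<Sum>k<m. 2 * (H * (1 / (real (Suc k) * pi))\<^sup>2))"
      using r_le[of 0] r_le[of "Suc k" for k] by (intro add_mono sum_mono) auto
    also have "(\<Sum>k<m. 2 * (H * (1 / (real (Suc k) * pi))\<^sup>2)) = 2 * H / pi\<^sup>2 * (\<Sum>k<m. 1 / (real k + 1)\<^sup>2)"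
      unfolding sum_distrib_left
      by (intro sum.cong) (simp_all add: power_mult_distrib power_divide add.commute)
    also have "\<dots> \<le> 2 * H / pi\<^sup>2 * (pi\<^sup>2 / 6)"
      using H0 by (intro mult_left_mono sum_inverse_squares_le) auto
    also have "\<dots> = H / 3" by simp
    finally show ?thesis by (simp add: power2_eq_square)
  qed (use H0 in simp)
  have "\<exists>n b. \<forall>x\<in>{0..1}. \<bar>h x - (\<Sum>k<n. b k * g k x)\<bar> < 1 / real (Suc m)" for m
    unfolding g_def by (rule cosine_polynomial_dense[OF h]) simp
  then obtain N B where NB: "\<And>m x. x \<in> {0..1} \<Longrightarrow> \<bar>h x - (\<Sum>k<N m. B m k * g k x)\<bar> < 1 / real (Suc m)"
    by metis
  define p where "p m x = (\<Sum>k<N m. B m k * g k x)" for m x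
  have [continuous_intros]: "continuous_on A (p m)" for A m
    unfolding p_def[abs_def] by (intro continuous_intros)
  \<comment> \<open>Cauchy-Schwarz for finite sums with the weights \<open>\<gamma> k\<close>, the
    squared norms of the cosines; they turn the first factor into the squared norm of
    \<open>p m\<close>.\<close>
  have ineq: "(LINT x|unit_measure. h x * p m x)\<^sup>2 \<le> (LINT x|unit_measure. (p m x)\<^sup>2) * (7 / 12 * H)" for m
  proof -
    have "(LINT x|unit_measure. h x * p m x) = (LINT x|unit_measure. (\<Sum>k<N m. B m k * (h x * g k x)))"
      by (simp add: p_def sum_distrib_left mult_ac)
    also have "\<dots> = (\<Sum>k<N m. B m k * r k)"
      unfolding r_def
      by (subst Bochner_Integration.integral_sum
          | intro integrable_continuous_unit continuous_intros sum.cong refl integral_mult_right_zero)+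
    also have "\<dots> = (\<Sum>k<N m. (B m k * sqrt (\<gamma> k)) * (r k / sqrt (\<gamma> k)))"
      by (intro sum.cong) (auto simp: \<gamma>_def)
    finally have "(LINT x|unit_measure. h x * p m x)\<^sup>2
        \<le> (\<Sum>k<N m. (B m k * sqrt (\<gamma> k))\<^sup>2) * (\<Sum>k<N m. (r k / sqrt (\<gamma> k))\<^sup>2)"
      by (simp only: Cauchy_Schwarz_ineq_sum)
    also have "(\<Sum>k<N m. (B m k * sqrt (\<gamma> k))\<^sup>2) = (LINT x|unit_measure. (p m x)\<^sup>2)"
      unfolding p_def g_def integral_cosine_polynomial_sq \<gamma>_def
      by (intro sum.cong) (auto simp: power_mult_distrib)
    also have "(\<Sum>k<N m. (r k / sqrt (\<gamma> k))\<^sup>2) = (\<Sum>k<N m. (r k)\<^sup>2 / \<gamma> k)"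
      by (intro sum.cong) (auto simp: power_divide \<gamma>_def)
    also have "(LINT x|unit_measure. (p m x)\<^sup>2) * (\<Sum>k<N m. (r k)\<^sup>2 / \<gamma> k)
        \<le> (LINT x|unit_measure. (p m x)\<^sup>2) * (7 / 12 * H)"
      by (intro mult_left_mono rsum) simp
    finally show ?thesis .
  qed
  have "bounded (h ` {0..1})" by (intro compact_imp_bounded compact_continuous_image[OF h]) simp
  then obtain C where "\<forall>y\<in>h ` {0..1}. norm y \<le> C" unfolding bounded_iff by blast
  then have C: "\<bar>h x\<bar> \<le> C" if "x \<in> {0..1}" for x using that by auto
  have C0: "0 \<le> C" using C[OF x] by linarith
  have inv: "(\<lambda>m. 1 / real (Suc m)) \<longlonglongrightarrow> 0" using LIMSEQ_Suc[OF lim_1_over_n] .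
  have "(\<lambda>m. (LINT x|unit_measure. h x * p m x) - H) \<longlonglongrightarrow> 0"
  proof (rule Lim_null_comparison)
    show "(\<lambda>m. C * (1 / real (Suc m))) \<longlonglongrightarrow> 0" using tendsto_mult_right_zero[OF inv] .
    have "norm ((LINT x|unit_measure. h x * p m x) - H) \<le> C * (1 / real (Suc m))" for m
    proof -
      have "(LINT x|unit_measure. h x * p m x) - H = (LINT x|unit_measure. h x * (p m x - h x))"
        unfolding H_def by (subst Bochner_Integration.integral_diff[symmetric])
          (auto intro!: integrable_continuous_unit continuous_intros simp: algebra_simps power2_eq_square)
      also have "\<bar>\<dots>\<bar> \<le> C * (1 / real (Suc m))"
      proof (rule abs_integral_unit_le)
        fix x :: real assume "x \<in> {0..1}"
        with C[of x] NB[of x m] C0 show "\<bar>h x * (p m x - h x)\<bar> \<le> C * (1 / real (Suc m))"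
          unfolding abs_mult p_def by (intro mult_mono) auto
      qed (intro continuous_intros)
      finally show ?thesis by simp
    qed
    then show "\<forall>\<^sub>F m in sequentially. norm ((LINT x|unit_measure. h x * p m x) - H) \<le> C * (1 / real (Suc m))"
      by simp
  qed
  then have 1: "(\<lambda>m. LINT x|unit_measure. h x * p m x) \<longlonglongrightarrow> H" by (rule LIM_zero_cancel)
  have "(\<lambda>m. (LINT x|unit_measure. (p m x)\<^sup>2) - H) \<longlonglongrightarrow> 0"
  proof (rule Lim_null_comparison)
    show "(\<lambda>m. (2 * C + 1) * (1 / real (Suc m))) \<longlonglongrightarrow> 0" using tendsto_mult_right_zero[OF inv] .
    have "norm ((LINT x|unit_measure. (p m x)\<^sup>2) - H) \<le> (2 * C + 1) * (1 / real (Suc m))" for m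
    proof -
      have "(LINT x|unit_measure. (p m x)\<^sup>2) - H = (LINT x|unit_measure. (p m x + h x) * (p m x - h x))"
        unfolding H_def by (subst Bochner_Integration.integral_diff[symmetric])
          (auto intro!: integrable_continuous_unit continuous_intros simp: algebra_simps power2_eq_square)
      also have "\<bar>\<dots>\<bar> \<le> (2 * C + 1) * (1 / real (Suc m))"
      proof (rule abs_integral_unit_le)
        fix x :: real assume x: "x \<in> {0..1}"
        have "1 / real (Suc m) \<le> 1" by simp
        then have "\<bar>p m x + h x\<bar> \<le> 2 * C + 1"
          using C[OF x] NB[OF x, of m] unfolding p_def by linarith
        with NB[OF x, of m] C0 show "\<bar>(p m x + h x) * (p m x - h x)\<bar> \<le> (2 * C + 1) * (1 / real (Suc m))"
          unfolding abs_mult p_def by (intro mult_mono) auto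
      qed (intro continuous_intros)
      finally show ?thesis by simp
    qed
    then show "\<forall>\<^sub>F m in sequentially. norm ((LINT x|unit_measure. (p m x)\<^sup>2) - H) \<le> (2 * C + 1) * (1 / real (Suc m))"
      by simp
  qed
  then have 2: "(\<lambda>m. LINT x|unit_measure. (p m x)\<^sup>2) \<longlonglongrightarrow> H" by (rule LIM_zero_cancel)
  have "H\<^sup>2 \<le> H * (7 / 12 * H)"
    by (rule LIMSEQ_le[OF tendsto_power[OF 1] tendsto_mult_right[OF 2]]) (use ineq in auto)
  \<comment> \<open>In the limit \<open>p m\<close> has become \<open>h\<close>; since
    \<open>7 / 12 < 1\<close>, only \<open>H = 0\<close> is possible.\<close>
  then have "H = 0" using H0 by (simp add: power2_eq_square mult_le_0_iff)
  then have "(h x)\<^sup>2 = 0"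
    unfolding H_def
    by (intro integral_unit_nonneg_eq_0[of "\<lambda>x. (h x)\<^sup>2"] continuous_intros x) auto
  then show ?thesis by simp
qed


section \<open>Normalized eigenfunctions and the univariate kernel expansion\<close>

definition eig :: "nat \<Rightarrow> real" where
  "eig k = 1 / (freq k)\<^sup>2"

definition kernel1 :: "real \<Rightarrow> real \<Rightarrow> real" where
  "kernel1 x y = 1 + min x y"

definition cosfun_sq :: "nat \<Rightarrow> real" where
  "cosfun_sq k = (LINT x|unit_measure. (cosfun k x)\<^sup>2)"

text \<open>Normalized to have norm 1 in the Sobolev space, and hence \<open>L\<^sub>2\<close>-norm \<open>sqrt (eig k)\<close>.\<close>

definition eigfun :: "nat \<Rightarrow> real \<Rightarrow> real" where
  "eigfun k x = cosfun k x / (freq k * sqrt (cosfun_sq k))"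

lemma eig_pos: "0 < eig k"
  using freq_pos[of k] by (simp add: eig_def)

lemma eig_Suc_le: "eig (Suc k) \<le> 1 / (real (Suc k) * pi)\<^sup>2"
  unfolding eig_def using freq_bounds(1)[of "Suc k"] freq_pos[of "Suc k"]
  by (intro divide_left_mono power_mono) (auto intro!: mult_pos_pos)

lemma eig_ge: "1 / (real (Suc k) * pi)\<^sup>2 \<le> eig k"
  unfolding eig_def using freq_bounds(2)[of k] freq_pos[of k]
  by (intro divide_left_mono power_mono) (auto intro!: mult_pos_pos)

lemma eig_0_gt_1: "1 < eig 0"
  using freq_pos[of 0] freq_0_less_1 by (simp add: eig_def power_less_one_iff)

lemma eig_antimono: "j \<le> k \<Longrightarrow> eig k \<le> eig j"
  using freq_less[of j k] freq_pos[of j] freq_pos[of k]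
  by (cases "j = k") (auto simp: eig_def intro!: divide_left_mono power_mono)

lemma summable_eig: "summable eig"
proof (rule summable_Suc_iff[THEN iffD1, OF summable_comparison_test'])
  have "summable (\<lambda>n. 1 / pi\<^sup>2 * (1 / (real n + 1)\<^sup>2))"
    using inverse_squares_sums by (intro summable_mult) (simp add: sums_iff add.commute)
  then show "summable (\<lambda>n. 1 / (real (Suc n) * pi)\<^sup>2)"
    by (simp add: power_mult_distrib add.commute mult.commute)
  show "norm (eig (Suc n)) \<le> 1 / (real (Suc n) * pi)\<^sup>2" if "n \<ge> 0" for n
    using eig_Suc_le[of n] eig_pos[of "Suc n"] by simp
qed

text \<open>By the frequency equation the boundary term \<open>sin w * cos w / (2 * w)\<close>
  equals \<open>(sin w)^2 / 2\<close> and is nonnegative. A lower bound uniform in \<open>k\<close>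
  makes \<open>(eigfun k x)^2\<close> at most a constant times \<open>eig k\<close>, hence
  summable.\<close>

lemma cosfun_sq_ge: "1 / 2 \<le> cosfun_sq k"
proof -
  have "cosfun_sq k = 1 / 2 + sin (freq k) * (freq k * sin (freq k)) / (2 * freq k)"
    unfolding cosfun_sq_def cosfun_def freq_eq using freq_pos[of k] by (simp add: integral_cos_sq)
  also have "\<dots> = 1 / 2 + (sin (freq k))\<^sup>2 / 2"
    using freq_pos[of k] by (simp add: power2_eq_square)
  finally show ?thesis by simp
qed

lemma continuous_on_eigfun [continuous_intros]: "continuous_on A (eigfun k)"
  unfolding eigfun_def[abs_def] using freq_pos[of k] cosfun_sq_ge[of k]
  by (intro continuous_intros) auto

lemma continuous_on_kernel1 [continuous_intros]:
  fixes f g :: "real \<Rightarrow> real"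
  assumes "continuous_on A f" "continuous_on A g"
  shows "continuous_on A (\<lambda>y. kernel1 (f y) (g y))"
  unfolding kernel1_def by (intro continuous_intros assms)

lemma kernel1_commute: "kernel1 x y = kernel1 y x"
  by (simp add: kernel1_def min.commute)

lemma abs_kernel1_le: "x \<in> {0..1} \<Longrightarrow> y \<in> {0..1} \<Longrightarrow> \<bar>kernel1 x y\<bar> \<le> 2"
  by (auto simp: kernel1_def)

lemma integral_kernel1_cosfun:
  assumes "x \<in> {0..1}"
  shows "(LINT y|unit_measure. kernel1 x y * cosfun k y) = eig k * cosfun k x"
  unfolding kernel1_def cosfun_def eig_def
  using integral_kernel_cos[OF _ freq_eq assms] freq_pos[of k] by simp

lemma integral_kernel1_eigfun:
  assumes "x \<in> {0..1}"
  shows "(LINT y|unit_measure. kernel1 x y * eigfun k y) = eig k * eigfun k x"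
proof -
  have "(LINT y|unit_measure. kernel1 x y * eigfun k y)
      = (LINT y|unit_measure. 1 / (freq k * sqrt (cosfun_sq k)) * (kernel1 x y * cosfun k y))"
    by (simp add: eigfun_def)
  also have "\<dots> = 1 / (freq k * sqrt (cosfun_sq k)) * (eig k * cosfun k x)"
    unfolding integral_mult_right_zero integral_kernel1_cosfun[OF assms] ..
  finally show ?thesis by (simp add: eigfun_def)
qed

lemma integral_eigfun_cosfun:
  "(LINT x|unit_measure. eigfun j x * cosfun k x) = (if j = k then sqrt (cosfun_sq k) / freq k else 0)"
proof -
  have "(LINT x|unit_measure. eigfun j x * cosfun k x)
      = (LINT x|unit_measure. 1 / (freq j * sqrt (cosfun_sq j)) * (cosfun j x * cosfun k x))"
    by (simp add: eigfun_def)
  also have "\<dots> = 1 / (freq j * sqrt (cosfun_sq j)) * (LINT x|unit_measure. cosfun j x * cosfun k x)"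
    by (rule integral_mult_right_zero)
  also have "(LINT x|unit_measure. cosfun j x * cosfun k x) = (if j = k then cosfun_sq k else 0)"
  proof (cases "j = k")
    case False
    have "freq j * sin (freq j) * cos (freq k) = freq k * cos (freq j) * sin (freq k)"
      unfolding freq_eq[symmetric, of k] freq_eq[symmetric, of j] by simp
    with integral_cos_cos[OF freq_sq_neq[OF False]] False show ?thesis
      by (simp add: cosfun_def)
  qed (simp add: cosfun_sq_def power2_eq_square)
  also have "1 / (freq j * sqrt (cosfun_sq j)) * (if j = k then cosfun_sq k else 0)
      = (if j = k then sqrt (cosfun_sq k) / freq k else 0)"
    using cosfun_sq_ge[of k] freq_pos[of k] by (auto simp: divide_simps)
  finally show ?thesis .
qed

lemma integral_eigfun_eigfun:
  "(LINT x|unit_measure. eigfun j x * eigfun k x) = (if j = k then eig k else 0)"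
proof -
  have "(LINT x|unit_measure. eigfun j x * eigfun k x)
      = (LINT x|unit_measure. 1 / (freq k * sqrt (cosfun_sq k)) * (eigfun j x * cosfun k x))"
    by (simp add: eigfun_def[of k])
  also have "\<dots> = 1 / (freq k * sqrt (cosfun_sq k)) * (if j = k then sqrt (cosfun_sq k) / freq k else 0)"
    unfolding integral_mult_right_zero integral_eigfun_cosfun ..
  also have "\<dots> = (if j = k then eig k else 0)"
    using cosfun_sq_ge[of k] by (auto simp: eig_def power2_eq_square)
  finally show ?thesis .
qed

lemma eigfun_sq_le: "(eigfun k x)\<^sup>2 \<le> 2 * eig k"
proof -
  have "(cosfun k x)\<^sup>2 \<le> 1" by (simp add: cosfun_def abs_square_le_1)
  also have "\<dots> \<le> 2 * cosfun_sq k" using cosfun_sq_ge[of k] by simp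
  finally have "(cosfun k x)\<^sup>2 / cosfun_sq k \<le> 2"
    using cosfun_sq_ge[of k] by (simp add: divide_le_eq)
  then have "(cosfun k x)\<^sup>2 / cosfun_sq k * eig k \<le> 2 * eig k"
    using eig_pos[of k] by (intro mult_right_mono) auto
  then show ?thesis using cosfun_sq_ge[of k]
    by (simp add: eigfun_def eig_def power_divide power_mult_distrib mult.commute)
qed

lemma abs_eigfun_mult_le: "\<bar>eigfun k x * eigfun k y\<bar> \<le> 2 * eig k"
proof -
  have "2 * \<bar>eigfun k x * eigfun k y\<bar> \<le> (eigfun k x)\<^sup>2 + (eigfun k y)\<^sup>2"
    using sum_squares_bound[of "\<bar>eigfun k x\<bar>" "\<bar>eigfun k y\<bar>"] by (simp add: abs_mult)
  then show ?thesis using eigfun_sq_le[of k x] eigfun_sq_le[of k y] by linarith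
qed

lemma sums_integral_unit:
  fixes f :: "nat \<Rightarrow> real \<Rightarrow> real"
  assumes cont: "\<And>k. continuous_on {0..1} (f k)" and sum: "summable b"
    and le: "\<And>k x. x \<in> {0..1} \<Longrightarrow> \<bar>f k x\<bar> \<le> b k"
  shows "(\<lambda>k. integral\<^sup>L unit_measure (f k)) sums (LINT x|unit_measure. (\<Sum>k. f k x))"
proof (rule sums_integral)
  show "integrable unit_measure (f k)" for k by (rule integrable_continuous_unit[OF cont])
  have "summable (\<lambda>k. norm (f k x))" if "x \<in> {0..1}" for x
    using le[OF that] by (intro summable_comparison_test'[OF sum]) auto
  then show "AE x in unit_measure. summable (\<lambda>k. norm (f k x))"
    by (intro AE_I2) (simp add: space_restrict_space)
  show "summable (\<lambda>k. LINT x|unit_measure. norm (f k x))"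
  proof (rule summable_comparison_test'[OF sum])
    show "norm (LINT x|unit_measure. norm (f k x)) \<le> b k" for k
      using le unfolding real_norm_def by (intro abs_integral_unit_le continuous_intros cont) auto
  qed
qed

text \<open>The series converges uniformly, with majorant \<open>2 * eig k\<close>, so its sum
  \<open>\<Phi>\<close> is continuous. The difference \<open>kernel1 x y - \<Phi> y\<close> is
  orthogonal in \<open>y\<close> to every \<open>cosfun j\<close>, and completeness makes it
  zero.\<close>

lemma kernel1_Mercer:
  assumes x: "x \<in> {0..1}" and y: "y \<in> {0..1}"
  shows "(\<lambda>k. eigfun k x * eigfun k y) sums kernel1 x y"
proof -
  have sb: "summable (\<lambda>k. 2 * eig k)" using summable_eig by (intro summable_mult)
  define \<Phi> where "\<Phi> y = (\<Sum>k. eigfun k x * eigfun k y)" for y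
  have sums: "(\<lambda>k. eigfun k x * eigfun k y) sums \<Phi> y" for y
    unfolding \<Phi>_def using abs_eigfun_mult_le
    by (intro summable_sums summable_comparison_test'[OF sb]) auto
  have "uniform_limit {0..1} (\<lambda>n y. \<Sum>k<n. eigfun k x * eigfun k y) \<Phi> sequentially"
    unfolding \<Phi>_def[abs_def] using abs_eigfun_mult_le by (intro Weierstrass_m_test[OF _ sb]) auto
  then have [continuous_intros]: "continuous_on {0..1} \<Phi>"
    by (rule uniform_limit_theorem[rotated]) (auto intro!: continuous_intros always_eventually)
  have "(LINT y|unit_measure. (kernel1 x y - \<Phi> y) * cosfun j y) = 0" for j
  proof -
    have "(\<lambda>k. LINT y|unit_measure. eigfun k x * eigfun k y * cosfun j y) sums
        (LINT y|unit_measure. (\<Sum>k. eigfun k x * eigfun k y * cosfun j y))"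
    proof (rule sums_integral_unit[OF _ sb])
      show "\<bar>eigfun k x * eigfun k y * cosfun j y\<bar> \<le> 2 * eig k" for k y
        using mult_mono[OF abs_eigfun_mult_le[of k x y], of "\<bar>cosfun j y\<bar>" 1] eig_pos[of k]
        by (simp add: abs_mult cosfun_def)
    qed (intro continuous_intros)
    moreover have "(LINT y|unit_measure. eigfun k x * eigfun k y * cosfun j y)
        = (if k = j then eigfun j x * (sqrt (cosfun_sq j) / freq j) else 0)" for k
      using integral_eigfun_cosfun[of k j] by (simp add: mult.assoc)
    moreover have "(\<Sum>k. eigfun k x * eigfun k y * cosfun j y) = \<Phi> y * cosfun j y" for y
      using sums_mult2[OF sums[of y], of "cosfun j y"] by (simp add: sums_iff)
    ultimately have "(\<lambda>k. if k = j then eigfun j x * (sqrt (cosfun_sq j) / freq j) else 0) sums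
        (LINT y|unit_measure. \<Phi> y * cosfun j y)"
      by simp
    then have "(LINT y|unit_measure. \<Phi> y * cosfun j y) = eigfun j x * (sqrt (cosfun_sq j) / freq j)"
      using sums_single[of j "\<lambda>k. eigfun j x * (sqrt (cosfun_sq j) / freq j)"] sums_unique2 by blast
    also have "\<dots> = eig j * cosfun j x"
      using cosfun_sq_ge[of j] by (simp add: eigfun_def eig_def power2_eq_square)
    finally show ?thesis
      using integral_kernel1_cosfun[OF x, of j]
      by (simp add: left_diff_distrib)
        (subst Bochner_Integration.integral_diff, auto intro!: integrable_continuous_unit continuous_intros)
  qed
  then have "kernel1 x y - \<Phi> y = 0"
    by (intro cosfun_complete[of "\<lambda>y. kernel1 x y - \<Phi> y"] continuous_intros y) auto
  then show ?thesis using sums[of y] by simp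
qed

text \<open>The iterated kernel, that is, the \<open>L\<^sub>2\<close> inner product of two kernel
  sections: the expansion of one factor is integrated termwise against the other. It is the
  univariate source of the \<open>L\<^sub>2\<close> Parseval identity.\<close>

lemma integral_kernel1_kernel1:
  assumes x: "x \<in> {0..1}" and y: "y \<in> {0..1}"
  shows "(\<lambda>k. eig k * (eigfun k x * eigfun k y)) sums (LINT z|unit_measure. kernel1 x z * kernel1 y z)"
proof -
  have "(\<lambda>k. LINT z|unit_measure. eigfun k x * eigfun k z * kernel1 y z) sums
      (LINT z|unit_measure. (\<Sum>k. eigfun k x * eigfun k z * kernel1 y z))"
  proof (rule sums_integral_unit)
    show "summable (\<lambda>k. 2 * eig k * 2)" using summable_eig by (intro summable_mult summable_mult2)
    show "\<bar>eigfun k x * eigfun k z * kernel1 y z\<bar> \<le> 2 * eig k * 2" if "z \<in> {0..1}" for k z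
      using mult_mono[OF abs_eigfun_mult_le[of k x z] abs_kernel1_le[OF y that]] eig_pos[of k]
      by (simp add: abs_mult)
  qed (intro continuous_intros)
  moreover have "(LINT z|unit_measure. eigfun k x * eigfun k z * kernel1 y z) = eig k * (eigfun k x * eigfun k y)" for k
  proof -
    have "(LINT z|unit_measure. eigfun k x * eigfun k z * kernel1 y z)
        = (LINT z|unit_measure. eigfun k x * (kernel1 y z * eigfun k z))"
      by (simp only: mult_ac)
    also have "\<dots> = eigfun k x * (eig k * eigfun k y)"
      unfolding integral_mult_right_zero integral_kernel1_eigfun[OF y] ..
    finally show ?thesis by simp
  qed
  moreover have "(LINT z|unit_measure. (\<Sum>k. eigfun k x * eigfun k z * kernel1 y z))
      = (LINT z|unit_measure. kernel1 x z * kernel1 y z)"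
  proof (rule Bochner_Integration.integral_cong[OF refl])
    fix z assume "z \<in> space unit_measure"
    then have "z \<in> {0..1}" by (simp add: space_restrict_space)
    from sums_mult2[OF kernel1_Mercer[OF x this], of "kernel1 y z"]
    show "(\<Sum>k. eigfun k x * eigfun k z * kernel1 y z) = kernel1 x z * kernel1 y z"
      by (simp add: sums_iff)
  qed
  ultimately show ?thesis by simp
qed

subsection \<open>Eigenfunctions of the multivariate problem\<close>

text \<open>A finite set of choice functions lies in the box of its coordinate projections, and over
  a box the sum of products factorizes. Finite partial sums are thus bounded by the product of the
  coordinate sums.\<close>

lemma abs_summable_on_prod_PiE:
  fixes f :: "'a \<Rightarrow> 'b \<Rightarrow> real"
  assumes A: "finite A" and f: "\<And>i. i \<in> A \<Longrightarrow> (\<lambda>k. norm (f i k)) summable_on B i"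
  shows "(\<lambda>g. norm (\<Prod>i\<in>A. f i (g i))) summable_on PiE A B"
proof (rule nonneg_bdd_above_summable_on)
  define s where "s i = infsum (\<lambda>k. norm (f i k)) (B i)" for i
  show "bdd_above (sum (\<lambda>g. norm (\<Prod>i\<in>A. f i (g i))) ` {P. P \<subseteq> PiE A B \<and> finite P})"
  proof (rule bdd_aboveI2)
    fix P assume "P \<in> {P. P \<subseteq> PiE A B \<and> finite P}"
    then have P: "P \<subseteq> PiE A B" "finite P" by auto
    define C where "C i = (\<lambda>g. g i) ` P" for i
    have C: "finite (C i)" for i using P by (simp add: C_def)
    have "P \<subseteq> PiE A C" using P by (auto simp: C_def PiE_def)
    then have "(\<Sum>g\<in>P. norm (\<Prod>i\<in>A. f i (g i))) \<le> (\<Sum>g\<in>PiE A C. norm (\<Prod>i\<in>A. f i (g i)))"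
      using A C by (intro sum_mono2 finite_PiE) auto
    also have "\<dots> = (\<Prod>i\<in>A. \<Sum>k\<in>C i. norm (f i k))"
      using A C by (subst prod_sum_PiE) (auto simp: abs_prod)
    also have "\<dots> \<le> (\<Prod>i\<in>A. s i)"
    proof (intro prod_mono conjI sum_nonneg)
      fix i assume i: "i \<in> A"
      have "C i \<subseteq> B i" using P i by (auto simp: C_def PiE_def Pi_def)
      then show "(\<Sum>k\<in>C i. norm (f i k)) \<le> s i"
        unfolding s_def using C f[OF i] by (intro finite_sum_le_infsum) auto
    qed auto
    finally show "(\<Sum>g\<in>P. norm (\<Prod>i\<in>A. f i (g i))) \<le> (\<Prod>i\<in>A. s i)" .
  qed
qed auto

lemma has_sum_prod_PiE:
  fixes f :: "'a \<Rightarrow> 'b \<Rightarrow> real"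
  assumes A: "finite A" and f: "\<And>i. i \<in> A \<Longrightarrow> (\<lambda>k. norm (f i k)) summable_on B i"
    and sum: "\<And>i. i \<in> A \<Longrightarrow> (f i has_sum S i) (B i)"
  shows "((\<lambda>g. \<Prod>i\<in>A. f i (g i)) has_sum (\<Prod>i\<in>A. S i)) (PiE A B)"
  unfolding has_sum_iff
proof
  show "(\<lambda>g. \<Prod>i\<in>A. f i (g i)) summable_on PiE A B"
    by (rule abs_summable_summable[OF abs_summable_on_prod_PiE[OF A f]])
  have "infsum (\<lambda>g. \<Prod>i\<in>A. f i (g i)) (PiE A B) = (\<Prod>i\<in>A. infsum (f i) (B i))"
    by (rule infsum_prod_PiE_abs[OF A f])
  also have "\<dots> = (\<Prod>i\<in>A. S i)" by (intro prod.cong refl infsumI sum)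
  finally show "infsum (\<lambda>g. \<Prod>i\<in>A. f i (g i)) (PiE A B) = (\<Prod>i\<in>A. S i)" .
qed

text \<open>Gaussian elimination. It serves to find, among combinations of more than
  \<open>n\<close> eigenfunctions, a nonzero one annihilated by \<open>n\<close> given
  functionals.\<close>

lemma underdetermined_system:
  fixes m :: "nat \<Rightarrow> 'i \<Rightarrow> real"
  assumes "finite B" "card B > n"
  shows "\<exists>a. (\<exists>i\<in>B. a i \<noteq> 0) \<and> (\<forall>j<n. (\<Sum>i\<in>B. a i * m j i) = 0)"
  using assms
proof (induction n arbitrary: B m)
  case 0
  then obtain i where "i \<in> B" by fastforce
  then show ?case by (intro exI[of _ "\<lambda>_. 1"]) auto
next
  case (Suc n)
  show ?case
  proof (cases "\<forall>i\<in>B. m n i = 0")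
    case True
    obtain a where a: "\<exists>i\<in>B. a i \<noteq> 0" "\<And>j. j < n \<Longrightarrow> (\<Sum>i\<in>B. a i * m j i) = 0"
      using Suc.IH[of B m] Suc.prems by auto
    have "(\<Sum>i\<in>B. a i * m j i) = 0" if "j < Suc n" for j
      using a(2)[of j] True that by (cases "j = n") auto
    then show ?thesis using a(1) by blast
  next
    case False
    then obtain p where p: "p \<in> B" "m n p \<noteq> 0" by blast
    \<comment> \<open>The system after equation \<open>n\<close> has been solved for the unknown at
      the pivot \<open>p\<close> and the result substituted.\<close>
    define m' where "m' j i = m j i - m n i / m n p * m j p" for j i
    have "card (B - {p}) > n" using Suc.prems p by simp
    then obtain a where a: "\<exists>i\<in>B - {p}. a i \<noteq> 0" "\<And>j. j < n \<Longrightarrow> (\<Sum>i\<in>B - {p}. a i * m' j i) = 0"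
      using Suc.IH[of "B - {p}" m'] Suc.prems by auto
    define c where "c = (\<Sum>i\<in>B - {p}. a i * m n i) / m n p"
    define b where "b = a(p := - c)"
    have b: "(\<Sum>i\<in>B. b i * m j i) = (\<Sum>i\<in>B - {p}. a i * m' j i)" for j
    proof -
      have "(\<Sum>i\<in>B. b i * m j i) = b p * m j p + (\<Sum>i\<in>B - {p}. b i * m j i)"
        using Suc.prems p by (intro sum.remove) auto
      also have "(\<Sum>i\<in>B - {p}. b i * m j i) = (\<Sum>i\<in>B - {p}. a i * m j i)"
        by (intro sum.cong) (auto simp: b_def)
      also have "b p * m j p = - (\<Sum>i\<in>B - {p}. a i * (m n i / m n p * m j p))"
        unfolding b_def c_def by (simp add: sum_distrib_right sum_divide_distrib mult.assoc)
      finally show ?thesis by (simp add: m'_def right_diff_distrib sum_subtractf)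
    qed
    have "m' n i = 0" for i using p by (simp add: m'_def)
    then have "(\<Sum>i\<in>B. b i * m j i) = 0" if "j < Suc n" for j
      unfolding b using a(2)[of j] that by (cases "j = n") auto
    moreover have "\<exists>i\<in>B. b i \<noteq> 0" using a(1) by (auto simp: b_def)
    ultimately show ?thesis by blast
  qed
qed

section \<open>Tensor products of eigenfunctions on the cube\<close>

abbreviation multi_indices :: "nat \<Rightarrow> (nat \<Rightarrow> nat) set" where
  "multi_indices d \<equiv> {..<d} \<rightarrow>\<^sub>E UNIV"

definition eigp :: "nat \<Rightarrow> (nat \<Rightarrow> nat) \<Rightarrow> real" where
  "eigp d s = (\<Prod>j<d. eig (s j))"

text \<open>Zero outside the cube, as elements of \<open>F\<close> have to be.\<close>

definition eigfunp :: "nat \<Rightarrow> (nat \<Rightarrow> nat) \<Rightarrow> (nat \<Rightarrow> real) \<Rightarrow> real" where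
  "eigfunp d s x = (if x \<in> unit_cube d then \<Prod>j<d. eigfun (s j) (x j) else 0)"

lemma eigp_pos: "0 < eigp d s"
  by (simp add: eigp_def prod_pos eig_pos)

lemma eigp_le: "eigp d s \<le> eig 0 ^ d"
proof -
  have "eigp d s \<le> (\<Prod>j<d. eig 0)"
    unfolding eigp_def by (intro prod_mono) (auto simp: eig_antimono less_imp_le[OF eig_pos])
  then show ?thesis by simp
qed

lemma sobolev_kernel_eq: "sobolev_kernel d x y = (\<Prod>j<d. kernel1 (x j) (y j))"
  by (simp add: sobolev_kernel_def kernel1_def)

lemma unit_cube_nth: "x \<in> unit_cube d \<Longrightarrow> j < d \<Longrightarrow> x j \<in> {0..1}"
  by (auto simp: unit_cube_def PiE_def Pi_def)

lemma space_cube_measure: "space (cube_measure d) = unit_cube d"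
  by (simp add: cube_measure_def space_PiM unit_cube_def space_restrict_space)

lemma product_sigma_finite_unit: "product_sigma_finite (\<lambda>_. unit_measure)"
proof -
  interpret finite_measure unit_measure by (rule finite_unit_measure)
  show ?thesis by standard
qed

lemma integral_cube_prod:
  fixes f :: "nat \<Rightarrow> real \<Rightarrow> real"
  assumes "\<And>j. j < d \<Longrightarrow> continuous_on {0..1} (f j)"
  shows "(LINT x|cube_measure d. (\<Prod>j<d. f j (x j))) = (\<Prod>j<d. integral\<^sup>L unit_measure (f j))"
proof -
  interpret product_sigma_finite "\<lambda>_. unit_measure" by (rule product_sigma_finite_unit)
  show ?thesis unfolding cube_measure_def
    using assms by (intro product_integral_prod integrable_continuous_unit) auto
qed

lemma integrable_cube_prod:
  fixes f :: "nat \<Rightarrow> real \<Rightarrow> real"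
  assumes "\<And>j. j < d \<Longrightarrow> continuous_on {0..1} (f j)"
  shows "integrable (cube_measure d) (\<lambda>x. \<Prod>j<d. f j (x j))"
proof -
  interpret product_sigma_finite "\<lambda>_. unit_measure" by (rule product_sigma_finite_unit)
  show ?thesis unfolding cube_measure_def
    using assms by (intro product_integrable_prod integrable_continuous_unit) auto
qed

lemma finite_cube_measure: "finite_measure (cube_measure d)"
proof -
  have "integrable (cube_measure d) (\<lambda>x. \<Prod>j<d. 1 :: real)"
    by (rule integrable_cube_prod) (intro continuous_intros)
  then have "integrable (cube_measure d) (\<lambda>x. 1 :: real)" by simp
  then show ?thesis
    by (intro finite_measureI) (auto simp: integrable_iff_bounded)
qed

lemma measure_cube: "measure (cube_measure d) (space (cube_measure d)) = 1"
proof -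
  have "(LINT x|unit_measure. 1 :: real) = 1 - 0"
    by (rule integral_unit_FTC) (auto intro!: derivative_eq_intros)
  moreover have "(LINT x|cube_measure d. (\<Prod>j<d. 1 :: real)) = (\<Prod>j<d. (LINT x|unit_measure. 1))"
    by (rule integral_cube_prod) (intro continuous_intros)
  ultimately show ?thesis by simp
qed

lemma integrable_cube_bounded:
  fixes f :: "(nat \<Rightarrow> real) \<Rightarrow> real"
  assumes "f \<in> borel_measurable (cube_measure d)" "\<And>x. x \<in> unit_cube d \<Longrightarrow> \<bar>f x\<bar> \<le> C"
  shows "integrable (cube_measure d) f"
proof -
  interpret finite_measure "cube_measure d" by (rule finite_cube_measure)
  show ?thesis using assms
    by (intro integrable_const_bound[of _ C] AE_I2) (auto simp: space_cube_measure)
qed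

lemma abs_integral_cube_le:
  fixes f :: "(nat \<Rightarrow> real) \<Rightarrow> real"
  assumes f: "f \<in> borel_measurable (cube_measure d)" and le: "\<And>x. x \<in> unit_cube d \<Longrightarrow> \<bar>f x\<bar> \<le> C"
  shows "\<bar>LINT x|cube_measure d. f x\<bar> \<le> C"
proof -
  interpret finite_measure "cube_measure d" by (rule finite_cube_measure)
  have "\<bar>LINT x|cube_measure d. f x\<bar> \<le> (LINT x|cube_measure d. \<bar>f x\<bar>)" by (rule integral_abs_bound)
  also have "\<dots> \<le> (LINT x|cube_measure d. C)"
    using le by (intro integral_mono integrable_abs integrable_cube_bounded[OF f])
      (auto simp: space_cube_measure)
  also have "\<dots> = C" using measure_cube by simp
  finally show ?thesis .
qed

lemma borel_measurable_eigfunp: "eigfunp d s \<in> borel_measurable (cube_measure d)"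
proof -
  have "(\<lambda>x. \<Prod>j<d. eigfun (s j) (x j)) \<in> borel_measurable (cube_measure d)"
    by (intro borel_measurable_integrable integrable_cube_prod continuous_intros)
  then show ?thesis
    by (rule measurable_cong[THEN iffD1, rotated]) (simp add: eigfunp_def space_cube_measure)
qed

lemma borel_measurable_kernel_section:
  assumes "y \<in> unit_cube d"
  shows "kernel_section (unit_cube d) (sobolev_kernel d) y \<in> borel_measurable (cube_measure d)"
proof -
  have "(\<lambda>x. \<Prod>j<d. kernel1 (x j) (y j)) \<in> borel_measurable (cube_measure d)"
    by (intro borel_measurable_integrable integrable_cube_prod continuous_intros)
  then show ?thesis
    by (rule measurable_cong[THEN iffD1, rotated])
      (simp add: kernel_section_def space_cube_measure sobolev_kernel_eq)
qed

lemma abs_eigfunp_le: "\<exists>C. \<forall>x. \<bar>eigfunp d s x\<bar> \<le> C"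
proof -
  have *: "\<bar>eigfun k y\<bar> \<le> sqrt (2 * eig k)" for k y
    using real_sqrt_le_mono[OF eigfun_sq_le[of k y]] by simp
  have "\<bar>eigfunp d s x\<bar> \<le> (\<Prod>j<d. sqrt (2 * eig (s j)))" for x
    unfolding eigfunp_def using * by (auto simp: abs_prod intro!: prod_mono prod_nonneg less_imp_le[OF eig_pos])
  then show ?thesis by blast
qed

lemma integral_eigfunp_eigfunp:
  assumes "s \<in> multi_indices d" "r \<in> multi_indices d"
  shows "(LINT x|cube_measure d. eigfunp d s x * eigfunp d r x) = (if s = r then eigp d s else 0)"
proof -
  have "(LINT x|cube_measure d. eigfunp d s x * eigfunp d r x)
      = (LINT x|cube_measure d. (\<Prod>j<d. eigfun (s j) (x j) * eigfun (r j) (x j)))"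
    by (intro Bochner_Integration.integral_cong) (auto simp: eigfunp_def space_cube_measure prod.distrib)
  also have "\<dots> = (\<Prod>j<d. if s j = r j then eig (s j) else 0)"
    by (subst integral_cube_prod) (auto intro!: continuous_intros prod.cong simp: integral_eigfun_eigfun)
  also have "\<dots> = (if s = r then eigp d s else 0)"
  proof (cases "s = r")
    case False
    then obtain j where "j < d" "s j \<noteq> r j"
      using PiE_ext[OF assms] by auto
    then show ?thesis using False by (auto intro!: prod_zero)
  qed (simp add: eigp_def)
  finally show ?thesis .
qed

lemma eigfun_abs_summable:
  "summable (\<lambda>k. norm (eigfun k x * eigfun k y))"
  "summable (\<lambda>k. norm (eig k * (eigfun k x * eigfun k y)))"
proof -
  show "summable (\<lambda>k. norm (eigfun k x * eigfun k y))"
    using abs_eigfun_mult_le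
    by (intro summable_comparison_test'[OF summable_mult[OF summable_eig, of 2]]) auto
  have "norm (eig k * (eigfun k x * eigfun k y)) \<le> 2 * eig 0 * eig k" for k
    using mult_mono[OF eig_antimono[of 0 k] abs_eigfun_mult_le[of k x y]] eig_pos[of k] eig_pos[of 0]
    by (simp add: abs_mult mult_ac)
  then show "summable (\<lambda>k. norm (eig k * (eigfun k x * eigfun k y)))"
    by (intro summable_comparison_test'[OF summable_mult[OF summable_eig, of "2 * eig 0"]]) auto
qed

text \<open>The product over the coordinates of the univariate expansions, which may be multiplied
  out because they converge absolutely. Multi-indices carry no natural enumeration, hence unordered
  summation.\<close>

lemma sobolev_kernel_Mercer:
  assumes x: "x \<in> unit_cube d" and y: "y \<in> unit_cube d"
  shows "((\<lambda>s. eigfunp d s x * eigfunp d s y) has_sum sobolev_kernel d x y) (multi_indices d)"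
proof -
  have "((\<lambda>s. \<Prod>j<d. eigfun (s j) (x j) * eigfun (s j) (y j)) has_sum sobolev_kernel d x y) (multi_indices d)"
    unfolding sobolev_kernel_eq
  proof (rule has_sum_prod_PiE)
    fix j assume "j \<in> {..<d}"
    then show "((\<lambda>k. eigfun k (x j) * eigfun k (y j)) has_sum kernel1 (x j) (y j)) UNIV"
      using unit_cube_nth[OF x, of j] unit_cube_nth[OF y, of j]
      by (intro norm_summable_imp_has_sum kernel1_Mercer eigfun_abs_summable) auto
    show "(\<lambda>k. norm (eigfun k (x j) * eigfun k (y j))) summable_on UNIV"
      using eigfun_abs_summable(1)[of "x j" "y j"] by (intro norm_summable_imp_summable_on) simp
  qed simp
  then show ?thesis using x y by (simp add: eigfunp_def prod.distrib)
qed

lemma integral_sobolev_kernel_Mercer: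
  assumes x: "x \<in> unit_cube d" and y: "y \<in> unit_cube d"
  shows "((\<lambda>s. eigp d s * (eigfunp d s x * eigfunp d s y)) has_sum
    (LINT z|cube_measure d. kernel_section (unit_cube d) (sobolev_kernel d) x z *
      kernel_section (unit_cube d) (sobolev_kernel d) y z)) (multi_indices d)"
proof -
  have "(LINT z|cube_measure d. kernel_section (unit_cube d) (sobolev_kernel d) x z *
      kernel_section (unit_cube d) (sobolev_kernel d) y z)
    = (LINT z|cube_measure d. (\<Prod>j<d. kernel1 (x j) (z j) * kernel1 (y j) (z j)))"
    by (intro Bochner_Integration.integral_cong)
      (auto simp: kernel_section_def space_cube_measure sobolev_kernel_eq prod.distrib kernel1_commute)
  also have "\<dots> = (\<Prod>j<d. LINT z|unit_measure. kernel1 (x j) z * kernel1 (y j) z)"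
    by (rule integral_cube_prod) (intro continuous_intros)
  finally have eq: "(LINT z|cube_measure d. kernel_section (unit_cube d) (sobolev_kernel d) x z *
      kernel_section (unit_cube d) (sobolev_kernel d) y z)
    = (\<Prod>j<d. LINT z|unit_measure. kernel1 (x j) z * kernel1 (y j) z)" .
  have "((\<lambda>s. \<Prod>j<d. eig (s j) * (eigfun (s j) (x j) * eigfun (s j) (y j))) has_sum
      (\<Prod>j<d. LINT z|unit_measure. kernel1 (x j) z * kernel1 (y j) z)) (multi_indices d)"
  proof (rule has_sum_prod_PiE)
    fix j assume "j \<in> {..<d}"
    then show "((\<lambda>k. eig k * (eigfun k (x j) * eigfun k (y j))) has_sum
        (LINT z|unit_measure. kernel1 (x j) z * kernel1 (y j) z)) UNIV"
      using unit_cube_nth[OF x, of j] unit_cube_nth[OF y, of j]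
      by (intro norm_summable_imp_has_sum integral_kernel1_kernel1 eigfun_abs_summable) auto
    show "(\<lambda>k. norm (eig k * (eigfun k (x j) * eigfun k (y j)))) summable_on UNIV"
      using eigfun_abs_summable(2)[of "x j" "y j"] by (intro norm_summable_imp_summable_on) simp
  qed simp
  then show ?thesis unfolding eq using x y by (simp add: eigfunp_def eigp_def prod.distrib)
qed

lemma integral_sobolev_kernel_eigfunp:
  assumes x: "x \<in> unit_cube d"
  shows "(LINT z|cube_measure d. kernel_section (unit_cube d) (sobolev_kernel d) x z * eigfunp d s z)
    = eigp d s * eigfunp d s x"
proof -
  have "(LINT z|cube_measure d. kernel_section (unit_cube d) (sobolev_kernel d) x z * eigfunp d s z)
    = (LINT z|cube_measure d. (\<Prod>j<d. kernel1 (x j) (z j) * eigfun (s j) (z j)))"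
    by (intro Bochner_Integration.integral_cong)
      (auto simp: kernel_section_def eigfunp_def space_cube_measure sobolev_kernel_eq prod.distrib kernel1_commute)
  also have "\<dots> = (\<Prod>j<d. LINT z|unit_measure. kernel1 (x j) z * eigfun (s j) z)"
    by (rule integral_cube_prod) (intro continuous_intros)
  also have "\<dots> = (\<Prod>j<d. eig (s j) * eigfun (s j) (x j))"
    using unit_cube_nth[OF x] by (intro prod.cong refl integral_kernel1_eigfun) auto
  also have "\<dots> = eigp d s * eigfunp d s x"
    using x by (simp add: eigp_def eigfunp_def prod.distrib)
  finally show ?thesis .
qed

section \<open>Eigenfunction expansions in the reproducing kernel space\<close>

locale sobolev_space = rkhs "unit_cube d" F ip "sobolev_kernel d"
  for d :: nat and F ip
begin

abbreviation ksection :: "(nat \<Rightarrow> real) \<Rightarrow> (nat \<Rightarrow> real) \<Rightarrow> real" where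
  "ksection y \<equiv> kernel_section (unit_cube d) (sobolev_kernel d) y"

abbreviation M :: "(nat \<Rightarrow> real) measure" where
  "M \<equiv> cube_measure d"

lemma kernel_diag_le: "x \<in> unit_cube d \<Longrightarrow> sqrt (sobolev_kernel d x x) \<le> sqrt (2 ^ d)"
proof -
  assume x: "x \<in> unit_cube d"
  have "(\<Prod>j<d. kernel1 (x j) (x j)) \<le> (\<Prod>j<d. 2)"
    using unit_cube_nth[OF x] by (intro prod_mono) (auto simp: kernel1_def)
  then show ?thesis by (simp add: sobolev_kernel_eq)
qed

lemma abs_F_le:
  assumes "f \<in> F" "x \<in> unit_cube d"
  shows "\<bar>f x\<bar> \<le> sqrt (2 ^ d) * ip_norm ip f"
  using abs_le_norm[OF assms] mult_right_mono[OF kernel_diag_le[OF assms(2)] ip_norm_nonneg[OF assms(1)]]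
  by linarith

lemma measurable_span: "f \<in> section_span (unit_cube d) (sobolev_kernel d) \<Longrightarrow> f \<in> borel_measurable M"
  by (induction rule: section_span.induct) (auto intro: borel_measurable_kernel_section)

text \<open>The axioms impose no regularity on elements of \<open>F\<close>. They are, however,
  pointwise limits of combinations of kernel sections, which are measurable.\<close>

lemma measurable_F:
  assumes f: "f \<in> F"
  shows "f \<in> borel_measurable M"
proof -
  obtain u where u: "\<And>n. u n \<in> section_span (unit_cube d) (sobolev_kernel d)"
    and lim: "(\<lambda>n. ip_norm ip (\<lambda>x. u n x - f x)) \<longlonglongrightarrow> 0"
    using section_span_dense[OF f] by blast
  show ?thesis
  proof (rule borel_measurable_LIMSEQ_real)
    show "(\<lambda>n. u n x) \<longlonglongrightarrow> f x" if "x \<in> space M" for x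
      using that by (intro tendsto_pointwise[OF section_span_subset[OF u] f lim]) (simp add: space_cube_measure)
    show "u n \<in> borel_measurable M" for n by (rule measurable_span[OF u])
  qed
qed

lemma integrable_F_mult:
  assumes f: "f \<in> F" and g: "g \<in> borel_measurable M" "\<And>x. x \<in> unit_cube d \<Longrightarrow> \<bar>g x\<bar> \<le> C"
  shows "integrable M (\<lambda>x. f x * g x)"
proof (rule integrable_cube_bounded)
  show "(\<lambda>x. f x * g x) \<in> borel_measurable M" using measurable_F[OF f] g by simp
  show "\<bar>f x * g x\<bar> \<le> (sqrt (2 ^ d) * ip_norm ip f) * C" if "x \<in> unit_cube d" for x
    unfolding abs_mult using abs_F_le[OF f that] g(2)[OF that] by (intro mult_mono) auto
qed

lemma integrable_F_F: "f \<in> F \<Longrightarrow> g \<in> F \<Longrightarrow> integrable M (\<lambda>x. f x * g x)"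
  by (rule integrable_F_mult[OF _ measurable_F abs_F_le])

lemma abs_integral_F_F_le:
  assumes f: "f \<in> F" and g: "g \<in> F"
  shows "\<bar>LINT x|M. f x * g x\<bar> \<le> 2 ^ d * ip_norm ip f * ip_norm ip g"
proof (rule abs_integral_cube_le)
  show "(\<lambda>x. f x * g x) \<in> borel_measurable M" using measurable_F[OF f] measurable_F[OF g] by simp
  show "\<bar>f x * g x\<bar> \<le> 2 ^ d * ip_norm ip f * ip_norm ip g" if "x \<in> unit_cube d" for x
  proof -
    have "\<bar>f x * g x\<bar> \<le> (sqrt (2 ^ d) * ip_norm ip f) * (sqrt (2 ^ d) * ip_norm ip g)"
      unfolding abs_mult using abs_F_le[OF f that] abs_F_le[OF g that] by (intro mult_mono) auto
    also have "\<dots> = (sqrt (2 ^ d) * sqrt (2 ^ d)) * (ip_norm ip f * ip_norm ip g)" by (simp only: mult_ac)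
    finally show ?thesis by simp
  qed
qed

text \<open>That \<open>F\<close> contains the products of eigenfunctions has to be derived from the axioms: such a product
  is a multiple of the representer of the functional that integrates against it.\<close>

lemma eigfunp_F:
  shows "eigfunp d s \<in> F" and "f \<in> F \<Longrightarrow> ip f (eigfunp d s) = (LINT x|M. f x * eigfunp d s x) / eigp d s"
proof -
  obtain C where C: "\<And>x. \<bar>eigfunp d s x\<bar> \<le> C" using abs_eigfunp_le by blast
  define l where "l f = (LINT x|M. f x * eigfunp d s x)" for f
  have int: "integrable M (\<lambda>x. f x * eigfunp d s x)" if "f \<in> F" for f
    by (rule integrable_F_mult[OF that borel_measurable_eigfunp C])
  obtain h u where h: "h \<in> F" and rep: "\<And>f. f \<in> F \<Longrightarrow> ip f h = l f"
  proof (rule subspace_representer[OF is_subspace_carrier, of l "2 ^ d * C\<^sup>2"])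
    show "l (\<lambda>x. f x + g x) = l f + l g" if "f \<in> F" "g \<in> F" for f g
      unfolding l_def using int[OF that(1)] int[OF that(2)] by (simp add: distrib_right)
    show "l (\<lambda>x. c * f x) = c * l f" for f c
      unfolding l_def by (simp add: mult.assoc)
    show "(l f)\<^sup>2 \<le> 2 ^ d * C\<^sup>2 * ip f f" if f: "f \<in> F" for f
    proof -
      have "\<bar>l f\<bar> \<le> sqrt (2 ^ d) * ip_norm ip f * C" unfolding l_def
      proof (rule abs_integral_cube_le)
        show "(\<lambda>x. f x * eigfunp d s x) \<in> borel_measurable M"
          using measurable_F[OF f] borel_measurable_eigfunp by simp
        show "\<bar>f x * eigfunp d s x\<bar> \<le> sqrt (2 ^ d) * ip_norm ip f * C" if "x \<in> unit_cube d" for x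
          unfolding abs_mult using abs_F_le[OF f that] C[of x] ip_norm_nonneg[OF f]
          by (intro mult_mono) auto
      qed
      then have "\<bar>l f\<bar>\<^sup>2 \<le> (sqrt (2 ^ d) * ip_norm ip f * C)\<^sup>2" by (rule power_mono) simp
      then show ?thesis by (simp add: power_mult_distrib ip_norm_sq[OF f] mult_ac)
    qed
  qed blast
  \<comment> \<open>The value of the representer at \<open>x\<close> is \<open>l\<close> applied to
    the kernel section at \<open>x\<close>, that is, the integral operator applied to
    \<open>eigfunp d s\<close>.\<close>
  have eq: "h x = eigp d s * eigfunp d s x" for x
  proof (cases "x \<in> unit_cube d")
    case True
    have "h x = ip (ksection x) h"
      using reproducing[OF h True] ip_commute[OF h section_closed[OF True]] by simp
    also have "\<dots> = eigp d s * eigfunp d s x"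
      unfolding rep[OF section_closed[OF True]] l_def by (rule integral_sobolev_kernel_eigfunp[OF True])
    finally show ?thesis .
  next
    case False
    then show ?thesis using zero_outside[OF h] by (simp add: eigfunp_def)
  qed
  have eig: "eigfunp d s = (\<lambda>x. 1 / eigp d s * h x)"
    using eigp_pos[of d s] by (simp add: eq)
  show "eigfunp d s \<in> F" unfolding eig by (rule scale_closed[OF h])
  show "ip f (eigfunp d s) = (LINT x|M. f x * eigfunp d s x) / eigp d s" if "f \<in> F"
  proof -
    have "ip f (eigfunp d s) = 1 / eigp d s * ip f h"
      unfolding eig by (rule ip_scale_right[OF h that])
    then show ?thesis by (simp add: rep[OF that] l_def)
  qed
qed

lemma ip_eigfunp_eigfunp:
  assumes "s \<in> multi_indices d" "r \<in> multi_indices d"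
  shows "ip (eigfunp d s) (eigfunp d r) = (if s = r then 1 else 0)"
  using eigfunp_F(2)[OF eigfunp_F(1), of s r] integral_eigfunp_eigfunp[OF assms] eigp_pos[of d r]
  by simp

lemma ip_section_eigfunp: "x \<in> unit_cube d \<Longrightarrow> ip (ksection x) (eigfunp d s) = eigfunp d s x"
  using reproducing[OF eigfunp_F(1)] ip_commute[OF eigfunp_F(1) section_closed] by simp

text \<open>Both identities are bilinear in \<open>f\<close> and \<open>g\<close>, and for two
  kernel sections they are the expansions of the kernel and of the iterated kernel. They extend
  first in the left argument, then by symmetry in the right one.\<close>

lemma span_Parseval:
  assumes "f \<in> section_span (unit_cube d) (sobolev_kernel d)"
    and "g \<in> section_span (unit_cube d) (sobolev_kernel d)"
  shows "((\<lambda>s. ip f (eigfunp d s) * ip g (eigfunp d s)) has_sum ip f g) (multi_indices d)"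
    and "((\<lambda>s. eigp d s * (ip f (eigfunp d s) * ip g (eigfunp d s))) has_sum (LINT x|M. f x * g x)) (multi_indices d)"
proof -
  let ?P = "\<lambda>f g. ((\<lambda>s. ip f (eigfunp d s) * ip g (eigfunp d s)) has_sum ip f g) (multi_indices d) \<and>
    ((\<lambda>s. eigp d s * (ip f (eigfunp d s) * ip g (eigfunp d s))) has_sum (LINT x|M. f x * g x)) (multi_indices d)"
  note SF = section_span_subset
  have Pzero: "?P (\<lambda>x. 0) g" if g: "g \<in> F" for g
    using g by (simp add: ip_zero_left eigfunp_F(1))
  have Padd: "?P (\<lambda>x. f x + f' x) g" if "?P f g" "?P f' g" and F: "f \<in> F" "f' \<in> F" "g \<in> F" for f f' g
  proof
    have 1: "ip (\<lambda>x. f x + f' x) h = ip f h + ip f' h" if "h \<in> F" for h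
      using F that by (intro ip_add_left) auto
    have 2: "(LINT x|M. (f x + f' x) * g x) = (LINT x|M. f x * g x) + (LINT x|M. f' x * g x)"
      using integrable_F_F F by (simp add: distrib_right)
    show "((\<lambda>s. ip (\<lambda>x. f x + f' x) (eigfunp d s) * ip g (eigfunp d s)) has_sum ip (\<lambda>x. f x + f' x) g) (multi_indices d)"
      unfolding 1[OF F(3)] 1[OF eigfunp_F(1)] distrib_right using that(1,2) by (intro has_sum_add) auto
    show "((\<lambda>s. eigp d s * (ip (\<lambda>x. f x + f' x) (eigfunp d s) * ip g (eigfunp d s))) has_sum (LINT x|M. (f x + f' x) * g x)) (multi_indices d)"
      unfolding 2 1[OF eigfunp_F(1)] unfolding distrib_right distrib_left using that(1,2) by (intro has_sum_add) auto
  qed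
  have Pscale: "?P (\<lambda>x. c * f x) g" if "?P f g" and F: "f \<in> F" "g \<in> F" for c f g
  proof
    have 1: "ip (\<lambda>x. c * f x) h = c * ip f h" if "h \<in> F" for h
      using F that by (intro ip_scale_left) auto
    have 2: "(LINT x|M. (c * f x) * g x) = c * (LINT x|M. f x * g x)"
      by (simp add: mult.assoc)
    show "((\<lambda>s. ip (\<lambda>x. c * f x) (eigfunp d s) * ip g (eigfunp d s)) has_sum ip (\<lambda>x. c * f x) g) (multi_indices d)"
      unfolding 1[OF F(2)] 1[OF eigfunp_F(1)] mult.assoc using that(1) by (intro has_sum_cmult_right) auto
    show "((\<lambda>s. eigp d s * (ip (\<lambda>x. c * f x) (eigfunp d s) * ip g (eigfunp d s))) has_sum (LINT x|M. (c * f x) * g x)) (multi_indices d)"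
      unfolding 2 1[OF eigfunp_F(1)] using has_sum_cmult_right[OF conjunct2[OF that(1)], of c]
      by (simp only: mult_ac)
  qed
  have sym: "?P g f" if "?P f g" "f \<in> F" "g \<in> F" for f g
    using that ip_commute[OF that(2,3)] by (simp add: mult.commute)
  have base: "?P (ksection y) (ksection x)" if "x \<in> unit_cube d" "y \<in> unit_cube d" for x y
    using sobolev_kernel_Mercer[OF that(1,2)] integral_sobolev_kernel_Mercer[OF that(2,1)] that
    by (simp add: ip_section_eigfunp ip_section_section mult.commute)
  have 1: "?P f (ksection x)" if "x \<in> unit_cube d" "f \<in> section_span (unit_cube d) (sobolev_kernel d)" for f x
    using that(2)
  proof (induction rule: section_span.induct)
    case zero then show ?case by (rule Pzero[OF section_closed[OF that(1)]])
  next
    case (sect y) then show ?case by (rule base[OF that(1)])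
  next
    case (add f g) then show ?case by (intro Padd[OF _ _ SF SF section_closed[OF that(1)]])
  next
    case (scale f c) then show ?case by (intro Pscale[OF _ SF section_closed[OF that(1)]])
  qed
  have "?P f g" using assms(2)
  proof (induction rule: section_span.induct)
    case zero then show ?case by (intro sym[OF Pzero[OF SF[OF assms(1)]]] zero_closed SF[OF assms(1)])
  next
    case (sect y) then show ?case by (rule 1[OF _ assms(1)])
  next
    case (add g h)
    have "?P (\<lambda>x. g x + h x) f"
      by (intro Padd[OF sym sym] add.IH SF add.hyps assms(1))
    then show ?case by (rule sym) (intro add_closed SF add.hyps assms(1))+
  next
    case (scale g c)
    have "?P (\<lambda>x. c * g x) f" by (intro Pscale[OF sym] scale.IH SF scale.hyps assms(1))
    then show ?case by (rule sym) (intro scale_closed SF scale.hyps assms(1))+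
  qed
  then show "((\<lambda>s. ip f (eigfunp d s) * ip g (eigfunp d s)) has_sum ip f g) (multi_indices d)"
    "((\<lambda>s. eigp d s * (ip f (eigfunp d s) * ip g (eigfunp d s))) has_sum (LINT x|M. f x * g x)) (multi_indices d)"
    by blast+
qed

text \<open>Termwise comparison of the two Parseval series: off \<open>A\<close> the weight
  \<open>eigp d s\<close> is replaced by \<open>\<eta>\<close>, on \<open>A\<close> the whole term
  is kept on the right.\<close>

lemma span_tail_le:
  assumes f: "f \<in> section_span (unit_cube d) (sobolev_kernel d)"
    and A: "finite A" "A \<subseteq> multi_indices d"
    and \<eta>: "0 \<le> \<eta>" "\<And>s. s \<in> multi_indices d - A \<Longrightarrow> eigp d s \<le> \<eta>"
  shows "(LINT x|M. f x * f x) \<le> \<eta> * ip f f + (\<Sum>s\<in>A. eigp d s * (ip f (eigfunp d s) * ip f (eigfunp d s)))"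
proof (rule has_sum_mono)
  let ?t = "\<lambda>s. eigp d s * (ip f (eigfunp d s) * ip f (eigfunp d s))"
  show "(?t has_sum (LINT x|M. f x * f x)) (multi_indices d)" by (rule span_Parseval(2)[OF f f])
  have "(?t has_sum sum ?t A) A" using A(1) by (rule has_sum_finite)
  then have "((\<lambda>s. if s \<in> A then ?t s else 0) has_sum sum ?t A) (multi_indices d)"
    by (rule has_sum_cong_neutral[THEN iffD1, rotated 3]) (use A(2) in auto)
  then show "((\<lambda>s. \<eta> * (ip f (eigfunp d s) * ip f (eigfunp d s)) + (if s \<in> A then ?t s else 0)) has_sum (\<eta> * ip f f + sum ?t A)) (multi_indices d)"
    by (intro has_sum_add has_sum_cmult_right span_Parseval(1)[OF f f])
  show "?t s \<le> \<eta> * (ip f (eigfunp d s) * ip f (eigfunp d s)) + (if s \<in> A then ?t s else 0)" if "s \<in> multi_indices d" for s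
    using \<eta> that mult_right_mono[of "eigp d s" \<eta> "ip f (eigfunp d s) * ip f (eigfunp d s)"] by auto
qed

text \<open>Both sides are continuous in the norm of \<open>F\<close>, the sum because
  \<open>A\<close> is finite, so the inequality passes from the dense span to \<open>F\<close>
  without a Parseval identity for general elements.\<close>

lemma F_tail_le:
  assumes f: "f \<in> F"
    and A: "finite A" "A \<subseteq> multi_indices d"
    and \<eta>: "0 \<le> \<eta>" "\<And>s. s \<in> multi_indices d - A \<Longrightarrow> eigp d s \<le> \<eta>"
  shows "(LINT x|M. f x * f x) \<le> \<eta> * ip f f + (\<Sum>s\<in>A. eigp d s * (ip f (eigfunp d s) * ip f (eigfunp d s)))"
proof -
  obtain u where u: "\<And>n. u n \<in> section_span (unit_cube d) (sobolev_kernel d)"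
    and lim: "(\<lambda>n. ip_norm ip (\<lambda>x. u n x - f x)) \<longlonglongrightarrow> 0"
    using section_span_dense[OF f] by blast
  have uF: "u n \<in> F" for n by (rule section_span_subset[OF u])
  have uf: "(\<lambda>x. u n x - f x) \<in> F" for n by (rule diff_closed[OF uF f])
  have 1: "(\<lambda>n. \<eta> * ip (u n) (u n) + (\<Sum>s\<in>A. eigp d s * (ip (u n) (eigfunp d s) * ip (u n) (eigfunp d s)))) \<longlonglongrightarrow>
      \<eta> * ip f f + (\<Sum>s\<in>A. eigp d s * (ip f (eigfunp d s) * ip f (eigfunp d s)))"
    by (intro tendsto_intros tendsto_ip_self[OF uF f lim] tendsto_ip_left[OF uF f eigfunp_F(1) lim])
  have "(\<lambda>n. (LINT x|M. u n x * u n x) - (LINT x|M. f x * f x)) \<longlonglongrightarrow> 0"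
  proof (rule Lim_null_comparison)
    let ?e = "\<lambda>n. ip_norm ip (\<lambda>x. u n x - f x)"
    show "(\<lambda>n. 2 ^ d * ?e n * ?e n + 2 * (2 ^ d * ?e n * ip_norm ip f)) \<longlonglongrightarrow> 0"
      using tendsto_add[OF tendsto_mult[OF tendsto_mult_right_zero[OF lim, of "2 ^ d"] lim]
          tendsto_mult_right_zero[OF tendsto_mult_left_zero[OF tendsto_mult_right_zero[OF lim, of "2 ^ d"]], of 2 "ip_norm ip f"]]
      by simp
    have "norm ((LINT x|M. u n x * u n x) - (LINT x|M. f x * f x)) \<le> 2 ^ d * ?e n * ?e n + 2 * (2 ^ d * ?e n * ip_norm ip f)" for n
    proof -
      have "(LINT x|M. u n x * u n x) - (LINT x|M. f x * f x)
          = (LINT x|M. u n x * u n x - f x * f x)"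
        by (intro Bochner_Integration.integral_diff[symmetric] integrable_F_F uF f)
      also have "\<dots> = (LINT x|M. (u n x - f x) * (u n x - f x) + 2 * ((u n x - f x) * f x))"
        by (simp add: algebra_simps)
      also have "\<dots> = (LINT x|M. (u n x - f x) * (u n x - f x)) + 2 * (LINT x|M. (u n x - f x) * f x)"
        using integrable_F_F[OF uf uf] integrable_F_F[OF uf f] by simp
      finally show ?thesis
        using abs_integral_F_F_le[OF uf uf, of n n] abs_integral_F_F_le[OF uf f, of n]
        unfolding real_norm_def by linarith
    qed
    then show "\<forall>\<^sub>F n in sequentially. norm ((LINT x|M. u n x * u n x) - (LINT x|M. f x * f x))
        \<le> 2 ^ d * ?e n * ?e n + 2 * (2 ^ d * ?e n * ip_norm ip f)" by simp
  qed
  then have 2: "(\<lambda>n. LINT x|M. u n x * u n x) \<longlonglongrightarrow> (LINT x|M. f x * f x)" by (rule LIM_zero_cancel)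
  show ?thesis
    by (rule LIMSEQ_le[OF 2 1]) (use span_tail_le[OF u A \<eta>] in auto)
qed

end

subsection \<open>Minimal errors and information complexity\<close>

context sobolev_space
begin

lemma L2_norm_eq: "L2_norm M f = sqrt (LINT x|M. f x * f x)"
  by (simp add: L2_norm_def power2_eq_square)

lemma unit_ball_iff: "f \<in> unit_ball F ip \<longleftrightarrow> f \<in> F \<and> ip f f \<le> 1"
  by (auto simp: unit_ball_def ip_norm_def)

lemma unit_ball_zero: "(\<lambda>x. 0) \<in> unit_ball F ip"
  by (simp add: unit_ball_iff zero_closed ip_zero_left)

lemma F_L2_space: "f \<in> F \<Longrightarrow> f \<in> L2_space M"
  using measurable_F integrable_F_F[of f f] by (simp add: L2_space_def power2_eq_square)

lemma abs_unit_ball_le: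
  assumes "f \<in> unit_ball F ip" "x \<in> unit_cube d"
  shows "\<bar>f x\<bar> \<le> sqrt (2 ^ d)"
proof -
  have f: "f \<in> F" "ip_norm ip f \<le> 1" using assms(1) by (auto simp: unit_ball_def)
  have "\<bar>f x\<bar> \<le> sqrt (2 ^ d) * ip_norm ip f" by (rule abs_F_le[OF f(1) assms(2)])
  also have "\<dots> \<le> sqrt (2 ^ d) * 1" using f(2) by (intro mult_left_mono) auto
  finally show ?thesis by simp
qed

text \<open>A supremum in the reals says nothing about an unbounded set, so boundedness has to be
  secured before errors can be bounded from below. The integrable majorant \<open>b\<close> comes
  from \<open>(a - c)^2 \<le> 2 a^2 + 2 c^2\<close> and Cauchy-Schwarz for the sum of
  \<open>n\<close> terms.\<close>

lemma bdd_above_errors: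
  fixes n :: nat
  assumes L: "\<And>j. j < n \<Longrightarrow> \<exists>C. \<forall>f\<in>unit_ball F ip. \<bar>L j f\<bar> \<le> C"
    and g: "\<And>j. j < n \<Longrightarrow> g j \<in> L2_space M"
  shows "bdd_above ((\<lambda>f. L2_norm M (\<lambda>x. APP d f x - (\<Sum>j<n. L j f * g j x))) ` unit_ball F ip)"
proof -
  obtain C where C: "\<And>j f. j < n \<Longrightarrow> f \<in> unit_ball F ip \<Longrightarrow> \<bar>L j f\<bar> \<le> C j"
    using L by metis
  define b where "b x = 2 * 2 ^ d + 2 * ((\<Sum>j<n. (C j)\<^sup>2 * (g j x)\<^sup>2) * real n)" for x
  interpret finite_measure M by (rule finite_cube_measure)
  have int: "integrable M b"
    unfolding b_def using g by (intro Bochner_Integration.integrable_add integrable_mult_right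
        integrable_mult_left Bochner_Integration.integrable_sum) (auto simp: L2_space_def)
  have "L2_norm M (\<lambda>x. APP d f x - (\<Sum>j<n. L j f * g j x)) \<le> sqrt (integral\<^sup>L M b)"
    if f: "f \<in> unit_ball F ip" for f
    unfolding L2_norm_def
  proof (intro real_sqrt_le_mono integral_mono'[OF int])
    fix x assume "x \<in> space M"
    then have x: "x \<in> unit_cube d" by (simp add: space_cube_measure)
    have fx: "(f x)\<^sup>2 \<le> 2 ^ d"
      using power_mono[OF abs_unit_ball_le[OF f x], of 2] by simp
    have "(\<Sum>j<n. L j f * g j x)\<^sup>2 \<le> (\<Sum>j<n. (L j f * g j x)\<^sup>2) * real n"
      using sum_squared_le_sum_of_squares[of "\<lambda>j. L j f * g j x" "{..<n}"] by simp
    also have "\<dots> \<le> (\<Sum>j<n. (C j)\<^sup>2 * (g j x)\<^sup>2) * real n"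
    proof (intro mult_right_mono sum_mono)
      fix j assume "j \<in> {..<n}"
      then have "(L j f)\<^sup>2 \<le> (C j)\<^sup>2" using power_mono[OF C[OF _ f, of j], of 2] by simp
      then show "(L j f * g j x)\<^sup>2 \<le> (C j)\<^sup>2 * (g j x)\<^sup>2"
        unfolding power_mult_distrib by (rule mult_right_mono) simp
    qed simp
    finally have S: "(\<Sum>j<n. L j f * g j x)\<^sup>2 \<le> (\<Sum>j<n. (C j)\<^sup>2 * (g j x)\<^sup>2) * real n" .
    have "(a - c)\<^sup>2 \<le> 2 * a\<^sup>2 + 2 * c\<^sup>2" for a c :: real
      using zero_le_power2[of "a + c"] by (simp add: power2_eq_square algebra_simps)
    from this[of "f x" "\<Sum>j<n. L j f * g j x"] fx S
    show "(APP d f x - (\<Sum>j<n. L j f * g j x))\<^sup>2 \<le> b x" unfolding APP_def b_def by linarith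
    show "0 \<le> b x" unfolding b_def by (intro add_nonneg_nonneg mult_nonneg_nonneg sum_nonneg) auto
  qed
  then show ?thesis by (intro bdd_aboveI2)
qed

lemma Lambda_all_bounded:
  assumes "L \<in> Lambda_all F ip"
  shows "\<exists>C. \<forall>f\<in>unit_ball F ip. \<bar>L f\<bar> \<le> C"
proof -
  have "\<exists>C. \<forall>f\<in>F. \<bar>L f\<bar> \<le> C * ip_norm ip f"
    using assms unfolding Lambda_all_def by blast
  then obtain C where C: "\<And>f. f \<in> F \<Longrightarrow> \<bar>L f\<bar> \<le> C * ip_norm ip f" by auto
  have "\<bar>L f\<bar> \<le> \<bar>C\<bar>" if "f \<in> unit_ball F ip" for f
  proof -
    have f: "f \<in> F" "ip_norm ip f \<le> 1" using that by (auto simp: unit_ball_def)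
    have "\<bar>L f\<bar> \<le> C * ip_norm ip f" by (rule C[OF f(1)])
    also have "\<dots> \<le> \<bar>C\<bar> * 1" using f ip_norm_nonneg[OF f(1)] by (intro mult_mono) auto
    finally show ?thesis by simp
  qed
  then show ?thesis by blast
qed

lemma Lambda_std_bounded:
  assumes "L \<in> Lambda_std (unit_cube d)"
  shows "\<exists>C. \<forall>f\<in>unit_ball F ip. \<bar>L f\<bar> \<le> C"
  using assms abs_unit_ball_le by (auto simp: Lambda_std_def)

text \<open>Fooling principle: if all information on \<open>f\<close> vanishes, the algorithm
  returns 0 for \<open>f\<close> whatever the \<open>g j\<close> are, and its error there is the
  norm of \<open>f\<close>.\<close>

lemma L2_norm_le_worst_case_error:
  assumes "\<And>j. j < n \<Longrightarrow> \<exists>C. \<forall>f\<in>unit_ball F ip. \<bar>L j f\<bar> \<le> C"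
    and "\<And>j. j < n \<Longrightarrow> g j \<in> L2_space M"
    and f: "f \<in> unit_ball F ip" "\<And>j. j < n \<Longrightarrow> L j f = 0"
  shows "L2_norm M f \<le> worst_case_error F ip M (APP d) n L g"
proof -
  have "L2_norm M f = L2_norm M (\<lambda>x. APP d f x - (\<Sum>j<n. L j f * g j x))"
    using f(2) by (simp add: APP_def)
  also have "\<dots> \<le> worst_case_error F ip M (APP d) n L g"
    unfolding worst_case_error_def by (intro cSUP_upper f(1) bdd_above_errors assms(1,2))
  finally show ?thesis .
qed

lemma worst_case_error_nonneg:
  assumes L: "\<And>j. j < n \<Longrightarrow> L j \<in> Lambda_all F ip"
    and g: "\<And>j. j < n \<Longrightarrow> g j \<in> L2_space M"
  shows "0 \<le> worst_case_error F ip M (APP d) n L g"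
proof -
  have "L j (\<lambda>x. 0) = 0" if "j < n" for j
  proof -
    have "\<forall>f\<in>F. \<forall>c. L j (\<lambda>x. c * f x) = c * L j f"
      using L[OF that] unfolding Lambda_all_def by blast
    from this[rule_format, OF zero_closed, of 0] show ?thesis by simp
  qed
  then have "L2_norm M (\<lambda>x. 0) \<le> worst_case_error F ip M (APP d) n L g"
    using L g by (intro L2_norm_le_worst_case_error Lambda_all_bounded unit_ball_zero) auto
  then show ?thesis by (simp add: L2_norm_def)
qed

lemma initial_error_eq_worst_case:
  "initial_error F ip M (APP d) = worst_case_error F ip M (APP d) 0 L g"
  by (simp add: initial_error_def worst_case_error_def)

lemma minimal_error_ge:
  assumes \<Lambda>: "\<And>L. L \<in> \<Lambda> \<Longrightarrow> \<exists>C. \<forall>f\<in>unit_ball F ip. \<bar>L f\<bar> \<le> C" "\<Lambda> \<noteq> {}"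
    and ex: "\<And>L. (\<And>j. j < n \<Longrightarrow> L j \<in> \<Lambda>) \<Longrightarrow>
      \<exists>f\<in>unit_ball F ip. (\<forall>j<n. L j f = 0) \<and> \<eta> \<le> L2_norm M f"
  shows "\<eta> \<le> minimal_error F ip M (APP d) \<Lambda> n"
proof -
  have *: "\<eta> \<le> worst_case_error F ip M (APP d) n L g"
    if "\<forall>j<n. L j \<in> \<Lambda>" "\<forall>j<n. g j \<in> L2_space M" for L g
  proof -
    have "\<exists>f\<in>unit_ball F ip. (\<forall>j<n. L j f = 0) \<and> \<eta> \<le> L2_norm M f"
      using that by (intro ex) auto
    then obtain f where f: "f \<in> unit_ball F ip" "\<And>j. j < n \<Longrightarrow> L j f = 0" "\<eta> \<le> L2_norm M f"
      by auto
    have "L2_norm M f \<le> worst_case_error F ip M (APP d) n L g"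
      using that by (intro L2_norm_le_worst_case_error \<Lambda> f) auto
    then show ?thesis using f(3) by simp
  qed
  show ?thesis
  proof (cases "n = 0")
    case True
    then show ?thesis
      using *[of undefined undefined] initial_error_eq_worst_case by (simp add: minimal_error_def)
  next
    case False
    \<comment> \<open>\<open>\<Lambda>\<close> is nonempty, so the infimum is over a nonempty set of
      errors; otherwise its value in the reals would carry no information.\<close>
    obtain L0 where "L0 \<in> \<Lambda>" using \<Lambda>(2) by blast
    then have "worst_case_error F ip M (APP d) n (\<lambda>_. L0) (\<lambda>_ _. 0) \<in>
        {worst_case_error F ip M (APP d) n L g | L g. (\<forall>j<n. L j \<in> \<Lambda>) \<and> (\<forall>j<n. g j \<in> L2_space M)}"
      using F_L2_space[OF zero_closed] by blast
    then have "\<eta> \<le> Inf {worst_case_error F ip M (APP d) n L g | L g. (\<forall>j<n. L j \<in> \<Lambda>) \<and> (\<forall>j<n. g j \<in> L2_space M)}"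
      using * by (intro cInf_greatest) blast+
    then show ?thesis using False by (simp add: minimal_error_def)
  qed
qed

section \<open>Minimal errors for linear information\<close>

lemma ip_functional_Lambda_all:
  assumes "h \<in> F"
  shows "(\<lambda>f. ip f h) \<in> Lambda_all F ip"
proof -
  have "\<forall>f\<in>F. \<bar>ip f h\<bar> \<le> ip_norm ip h * ip_norm ip f"
    using abs_ip_le[OF _ assms] by (simp add: mult.commute)
  then show ?thesis using assms by (auto simp: Lambda_all_def ip_add_left ip_scale_left)
qed

text \<open>The algorithm truncates the eigenfunction expansion to \<open>A\<close>. The remainder
  of an \<open>f\<close> in the unit ball has norm at most 1 and no components in \<open>A\<close>,
  so \<open>F_tail_le\<close> leaves only the term with \<open>\<eta>\<close>. \<open>A\<close> is
  nonempty because \<open>minimal_error\<close> treats \<open>n = 0\<close> separately.\<close>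

lemma minimal_error_Lambda_all_le:
  assumes A: "finite A" "A \<subseteq> multi_indices d" "A \<noteq> {}"
    and \<eta>: "0 \<le> \<eta>" "\<And>s. s \<in> multi_indices d - A \<Longrightarrow> eigp d s \<le> \<eta>"
  shows "minimal_error F ip M (APP d) (Lambda_all F ip) (card A) \<le> sqrt \<eta>"
proof -
  obtain e where e: "bij_betw e {0..<card A} A" using ex_bij_betw_nat_finite[OF A(1)] by blast
  define L where "L j f = ip f (eigfunp d (e j))" for j f
  define g where "g j = eigfunp d (e j)" for j
  have LA: "L j \<in> Lambda_all F ip" for j
    unfolding L_def[abs_def] by (rule ip_functional_Lambda_all[OF eigfunp_F(1)])
  have gL: "g j \<in> L2_space M" for j unfolding g_def by (rule F_L2_space[OF eigfunp_F(1)])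
  have "worst_case_error F ip M (APP d) (card A) L g \<le> sqrt \<eta>"
    unfolding worst_case_error_def
  proof (rule cSUP_least)
    show "unit_ball F ip \<noteq> {}" using unit_ball_zero by blast
    fix f assume "f \<in> unit_ball F ip"
    then have f: "f \<in> F" "ip f f \<le> 1" by (auto simp: unit_ball_iff)
    define p where "p x = (\<Sum>s\<in>A. ip f (eigfunp d s) * eigfunp d s x)" for x
    have p: "p \<in> F" unfolding p_def[abs_def] by (rule sum_closed[OF A(1) eigfunp_F(1)])
    define h where "h x = f x - p x" for x
    have h: "h \<in> F" unfolding h_def[abs_def] by (rule diff_closed[OF f(1) p])
    have pe: "ip p v = (\<Sum>s\<in>A. ip f (eigfunp d s) * ip (eigfunp d s) v)" if "v \<in> F" for v
      unfolding p_def[abs_def] by (rule ip_sum_left[OF A(1) eigfunp_F(1) that])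
    have pr: "ip p (eigfunp d r) = ip f (eigfunp d r)" if "r \<in> A" for r
    proof -
      have "ip p (eigfunp d r) = (\<Sum>s\<in>A. ip f (eigfunp d s) * (if s = r then 1 else 0))"
        unfolding pe[OF eigfunp_F(1)] using A that
        by (intro sum.cong refl arg_cong2[where f = "(*)"] ip_eigfunp_eigfunp) auto
      also have "\<dots> = (\<Sum>s\<in>A. if s = r then ip f (eigfunp d s) else 0)"
        by (intro sum.cong) auto
      also have "\<dots> = ip f (eigfunp d r)" using A(1) that by simp
      finally show ?thesis .
    qed
    have hr: "ip h (eigfunp d r) = 0" if "r \<in> A" for r
      unfolding h_def[abs_def] ip_diff_left[OF f(1) p eigfunp_F(1)] by (simp add: pr[OF that])
    have "ip p h = 0"
      unfolding pe[OF h] using hr ip_commute[OF eigfunp_F(1) h] by simp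
    then have "ip f p = ip p p"
      using ip_diff_right[OF f(1) p p] ip_commute[OF f(1) p] unfolding h_def[abs_def] by simp
    then have "ip h h = ip f f - ip p p"
      using ip_diff_diff[OF f(1) p] unfolding h_def[abs_def] by simp
    then have "ip h h \<le> 1" using f(2) ip_nonneg[OF p] by simp
    then have "\<eta> * ip h h \<le> \<eta>" using \<eta>(1) by (simp add: mult_left_le)
    moreover have "(LINT x|M. h x * h x) \<le> \<eta> * ip h h"
      using F_tail_le[OF h A(1,2) \<eta>] hr by simp
    ultimately have "L2_norm M h \<le> sqrt \<eta>"
      unfolding L2_norm_eq by (intro real_sqrt_le_mono) simp
    moreover have "p x = (\<Sum>j<card A. L j f * g j x)" for x
      unfolding p_def L_def g_def using sum.reindex_bij_betw[OF e, of "\<lambda>s. ip f (eigfunp d s) * eigfunp d s x"]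
      by (simp add: atLeast0LessThan)
    ultimately show "L2_norm M (\<lambda>x. APP d f x - (\<Sum>j<card A. L j f * g j x)) \<le> sqrt \<eta>"
      by (simp add: APP_def h_def[abs_def])
  qed
  moreover have "Inf {worst_case_error F ip M (APP d) (card A) L g | L g.
      (\<forall>j<card A. L j \<in> Lambda_all F ip) \<and> (\<forall>j<card A. g j \<in> L2_space M)}
    \<le> worst_case_error F ip M (APP d) (card A) L g"
  proof (rule cInf_lower)
    show "bdd_below {worst_case_error F ip M (APP d) (card A) L g | L g.
      (\<forall>j<card A. L j \<in> Lambda_all F ip) \<and> (\<forall>j<card A. g j \<in> L2_space M)}"
      using worst_case_error_nonneg by (intro bdd_belowI[of _ 0]) blast
  qed (use LA gL in blast)
  moreover have "card A \<noteq> 0" using A by simp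
  ultimately show ?thesis by (simp add: minimal_error_def)
qed

text \<open>Fewer than \<open>card B\<close> functionals have a common nontrivial zero in the span
  of the eigenfunctions from \<open>B\<close>. On this span the \<open>L\<^sub>2\<close>-norm is at
  least \<open>\<eta>\<close> times the norm of \<open>F\<close>, as the eigenfunctions are
  orthogonal for both inner products.\<close>

lemma minimal_error_Lambda_all_ge:
  assumes B: "finite B" "B \<subseteq> multi_indices d" "n < card B"
    and \<eta>: "0 \<le> \<eta>" "\<And>s. s \<in> B \<Longrightarrow> \<eta>\<^sup>2 \<le> eigp d s"
  shows "\<eta> \<le> minimal_error F ip M (APP d) (Lambda_all F ip) n"
proof (rule minimal_error_ge[OF Lambda_all_bounded])
  show "Lambda_all F ip \<noteq> {}" using ip_functional_Lambda_all[OF zero_closed] by blast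
  fix L assume L: "\<And>j. j < n \<Longrightarrow> L j \<in> Lambda_all F ip"
  obtain a where a: "\<exists>s\<in>B. a s \<noteq> 0" "\<And>j. j < n \<Longrightarrow> (\<Sum>s\<in>B. a s * L j (eigfunp d s)) = 0"
    using underdetermined_system[OF B(1,3), of "\<lambda>j s. L j (eigfunp d s)"] by blast
  define q where "q = (\<Sum>s\<in>B. (a s)\<^sup>2)"
  have q: "0 < q" unfolding q_def using a(1) B(1) by (auto intro!: sum_pos2)
  \<comment> \<open>Normalization to a unit vector of \<open>F\<close>: the eigenfunctions are
    orthonormal there.\<close>
  define b where "b s = a s / sqrt q" for s
  have b2: "(\<Sum>s\<in>B. (b s)\<^sup>2) = 1"
    using q by (simp add: b_def power_divide q_def flip: sum_divide_distrib)
  define f where "f x = (\<Sum>s\<in>B. b s * eigfunp d s x)" for x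
  have f: "f \<in> F" unfolding f_def[abs_def] by (rule sum_closed[OF B(1) eigfunp_F(1)])
  have fe: "ip f v = (\<Sum>s\<in>B. b s * ip (eigfunp d s) v)" if "v \<in> F" for v
    unfolding f_def[abs_def] by (rule ip_sum_left[OF B(1) eigfunp_F(1) that])
  have fr: "ip f (eigfunp d r) = b r" if "r \<in> B" for r
  proof -
    have "ip f (eigfunp d r) = (\<Sum>s\<in>B. b s * (if s = r then 1 else 0))"
      unfolding fe[OF eigfunp_F(1)] using B that
      by (intro sum.cong refl arg_cong2[where f = "(*)"] ip_eigfunp_eigfunp) auto
    also have "\<dots> = (\<Sum>s\<in>B. if s = r then b s else 0)" by (intro sum.cong) auto
    also have "\<dots> = b r" using B(1) that by simp
    finally show ?thesis .
  qed
  have "ip f f = (\<Sum>s\<in>B. b s * b s)"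
    unfolding fe[OF f] by (intro sum.cong refl) (simp add: ip_commute[OF eigfunp_F(1) f] fr)
  then have ball: "f \<in> unit_ball F ip" using f b2 by (simp add: unit_ball_iff power2_eq_square)
  have "L j f = 0" if j: "j < n" for j
  proof -
    have add: "L j (\<lambda>x. u x + v x) = L j u + L j v" and scale: "L j (\<lambda>x. c * u x) = c * L j u"
      if "u \<in> F" "v \<in> F" for u v c
      using L[OF j] that by (auto simp: Lambda_all_def)
    have "L j (\<lambda>x. \<Sum>s\<in>C. b s * eigfunp d s x) = (\<Sum>s\<in>C. b s * L j (eigfunp d s))" if "finite C" for C
      using that
    proof (induction C)
      case empty
      show ?case using scale[OF zero_closed zero_closed, of 0] by simp
    next
      case (insert s C)
      have "L j (\<lambda>x. b s * eigfunp d s x + (\<Sum>s\<in>C. b s * eigfunp d s x))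
          = L j (\<lambda>x. b s * eigfunp d s x) + L j (\<lambda>x. \<Sum>s\<in>C. b s * eigfunp d s x)"
        by (rule add[OF scale_closed[OF eigfunp_F(1)] sum_closed[OF insert.hyps(1) eigfunp_F(1)]])
      then show ?case using insert scale[OF eigfunp_F(1) zero_closed] by simp
    qed
    from this[OF B(1)] have "L j f = (\<Sum>s\<in>B. a s * L j (eigfunp d s)) / sqrt q"
      by (simp add: f_def[abs_def] b_def sum_divide_distrib)
    then show ?thesis using a(2)[OF j] by simp
  qed
  moreover have "\<eta> \<le> L2_norm M f"
  proof -
    have "(LINT x|M. f x * f x) = (LINT x|M. (\<Sum>s\<in>B. b s * (f x * eigfunp d s x)))"
      by (subst (2) f_def) (simp add: sum_distrib_left mult_ac)
    also have "\<dots> = (\<Sum>s\<in>B. b s * (LINT x|M. f x * eigfunp d s x))"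
      by (subst Bochner_Integration.integral_sum)
        (auto intro!: integrable_mult_right integrable_F_F f eigfunp_F(1))
    also have "\<dots> = (\<Sum>s\<in>B. eigp d s * (b s)\<^sup>2)"
    proof (intro sum.cong refl)
      fix s assume "s \<in> B"
      then have "(LINT x|M. f x * eigfunp d s x) = eigp d s * b s"
        using eigfunp_F(2)[OF f, of s] fr[of s] eigp_pos[of d s] by (simp add: field_simps)
      then show "b s * (LINT x|M. f x * eigfunp d s x) = eigp d s * (b s)\<^sup>2"
        by (simp add: power2_eq_square)
    qed
    finally have "(LINT x|M. f x * f x) = (\<Sum>s\<in>B. eigp d s * (b s)\<^sup>2)" .
    moreover have "(\<Sum>s\<in>B. \<eta>\<^sup>2 * (b s)\<^sup>2) \<le> (\<Sum>s\<in>B. eigp d s * (b s)\<^sup>2)"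
      using \<eta>(2) by (intro sum_mono mult_right_mono) auto
    then have "\<eta>\<^sup>2 \<le> (\<Sum>s\<in>B. eigp d s * (b s)\<^sup>2)"
      using b2 by (simp flip: sum_distrib_left)
    ultimately show ?thesis unfolding L2_norm_eq using \<eta>(1) by (simp add: real_le_rsqrt)
  qed
  ultimately show "\<exists>f\<in>unit_ball F ip. (\<forall>j<n. L j f = 0) \<and> \<eta> \<le> L2_norm M f"
    using ball by blast
qed

section \<open>Initial error and complexity as an eigenvalue count\<close>

definition zero_index :: "nat \<Rightarrow> nat" where
  "zero_index = (\<lambda>j\<in>{..<d}. 0)"

lemma zero_index: "zero_index \<in> multi_indices d" "eigp d zero_index = eig 0 ^ d"
  by (auto simp: zero_index_def eigp_def)

text \<open>The upper bound is the tail estimate with \<open>A\<close> empty; the lower bound is the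
  fooling argument with no functionals and only the leading eigenfunction.\<close>

lemma initial_error_eq: "initial_error F ip M (APP d) = sqrt (eig 0 ^ d)"
proof (rule antisym)
  have "L2_norm M (APP d f) \<le> sqrt (eig 0 ^ d)" if "f \<in> unit_ball F ip" for f
  proof -
    have f: "f \<in> F" "ip f f \<le> 1" using that by (auto simp: unit_ball_iff)
    have "(LINT x|M. f x * f x) \<le> eig 0 ^ d * ip f f"
      using F_tail_le[OF f(1), of "{}" "eig 0 ^ d"] eigp_le eig_pos[of 0] by simp
    also have "\<dots> \<le> eig 0 ^ d" using f(2) eig_pos[of 0] by (simp add: mult_left_le)
    finally show ?thesis by (simp add: L2_norm_eq APP_def)
  qed
  then show "initial_error F ip M (APP d) \<le> sqrt (eig 0 ^ d)"
    unfolding initial_error_def using unit_ball_zero by (intro cSUP_least) auto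
  have "sqrt (eig 0 ^ d) \<le> minimal_error F ip M (APP d) (Lambda_all F ip) 0"
    by (rule minimal_error_Lambda_all_ge[of "{zero_index}"])
      (use zero_index eig_pos[of 0] in auto)
  then show "sqrt (eig 0 ^ d) \<le> initial_error F ip M (APP d)" by (simp add: minimal_error_def)
qed

lemma complexity_ge:
  assumes "\<And>n. n < N \<Longrightarrow> \<epsilon> * sqrt (eig 0 ^ d) < minimal_error F ip M (APP d) \<Lambda> n"
  shows "enat N \<le> information_complexity F ip M (APP d) \<Lambda> \<epsilon>"
  unfolding information_complexity_def initial_error_eq
proof (rule Inf_greatest)
  fix m assume "m \<in> {enat n |n. minimal_error F ip M (APP d) \<Lambda> n \<le> \<epsilon> * sqrt (eig 0 ^ d)}"
  then obtain n where "m = enat n" "minimal_error F ip M (APP d) \<Lambda> n \<le> \<epsilon> * sqrt (eig 0 ^ d)" by blast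
  with assms[of n] show "enat N \<le> m" by (cases "n < N") auto
qed

lemma complexity_Lambda_all_le:
  assumes A: "finite A" "A \<subseteq> multi_indices d" "A \<noteq> {}" and \<epsilon>: "0 \<le> \<epsilon>"
    and le: "\<And>s. s \<in> multi_indices d - A \<Longrightarrow> eigp d s \<le> \<epsilon>\<^sup>2 * eig 0 ^ d"
  shows "information_complexity F ip M (APP d) (Lambda_all F ip) \<epsilon> \<le> enat (card A)"
  unfolding information_complexity_def initial_error_eq
proof (rule Inf_lower)
  have "minimal_error F ip M (APP d) (Lambda_all F ip) (card A) \<le> sqrt (\<epsilon>\<^sup>2 * eig 0 ^ d)"
    using eig_pos[of 0] by (intro minimal_error_Lambda_all_le A le) auto
  also have "\<dots> = \<epsilon> * sqrt (eig 0 ^ d)" using \<epsilon> by (simp add: real_sqrt_mult)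
  finally show "enat (card A) \<in> {enat n |n. minimal_error F ip M (APP d) (Lambda_all F ip) n \<le> \<epsilon> * sqrt (eig 0 ^ d)}"
    by blast
qed

lemma complexity_Lambda_all_ge:
  assumes B: "finite B" "B \<subseteq> multi_indices d" and \<epsilon>: "0 \<le> \<epsilon>"
    and ge: "\<And>s. s \<in> B \<Longrightarrow> \<epsilon>\<^sup>2 * eig 0 ^ d < eigp d s"
  shows "enat (card B) \<le> information_complexity F ip M (APP d) (Lambda_all F ip) \<epsilon>"
proof (cases "B = {}")
  case False
  show ?thesis
  proof (rule complexity_ge)
    fix n assume n: "n < card B"
    \<comment> \<open>The least eigenvalue in the finite set \<open>B\<close> is still strictly
      above the threshold. Strictness is needed, since an \<open>n\<close> whose error equals the
      threshold would qualify.\<close>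
    define \<eta> where "\<eta> = sqrt (Min (eigp d ` B))"
    have Min: "Min (eigp d ` B) \<in> eigp d ` B" using B False by (intro Min_in) auto
    then have m0: "0 < Min (eigp d ` B)" using eigp_pos by auto
    have "\<epsilon>\<^sup>2 * eig 0 ^ d < Min (eigp d ` B)" using Min ge by auto
    then have "sqrt (\<epsilon>\<^sup>2 * eig 0 ^ d) < \<eta>" unfolding \<eta>_def by (rule real_sqrt_less_mono)
    moreover have "sqrt (\<epsilon>\<^sup>2 * eig 0 ^ d) = \<epsilon> * sqrt (eig 0 ^ d)" using \<epsilon> by (simp add: real_sqrt_mult)
    moreover have "\<eta> \<le> minimal_error F ip M (APP d) (Lambda_all F ip) n"
      using m0 B(1) by (intro minimal_error_Lambda_all_ge[OF B n]) (auto simp: \<eta>_def)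
    ultimately show "\<epsilon> * sqrt (eig 0 ^ d) < minimal_error F ip M (APP d) (Lambda_all F ip) n" by simp
  qed
qed (simp add: zero_enat_def[symmetric])

end

subsection \<open>Function values: fooling functions\<close>

text \<open>A decomposition \<open>u = h 0 + h 1 + h 2\<close> of a unit vector of the univariate space into orthogonal
  parts of squared norms \<open>p 0, p 1, p 2\<close>, the last two being supported in \<open>[0, a]\<close> and \<open>[a, 1]\<close>. The
  orthogonality is only needed in the form of Bessel's inequality for combinations of kernel sections.\<close>

locale splitting =
  fixes a :: real and u :: "real \<Rightarrow> real" and h :: "nat \<Rightarrow> real \<Rightarrow> real" and p :: "nat \<Rightarrow> real"
  assumes u_eq: "x \<in> {0..1} \<Longrightarrow> u x = (\<Sum>i<3. h i x)"
    and left: "x \<in> {0..1} \<Longrightarrow> x \<le> a \<Longrightarrow> h 2 x = 0"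
    and right: "x \<in> {0..1} \<Longrightarrow> a \<le> x \<Longrightarrow> h 1 x = 0"
    and p_pos: "i < 3 \<Longrightarrow> 0 < p i"
    and p_sum: "(\<Sum>i<3. p i) = 1"
    and Bessel: "finite (I :: nat set) \<Longrightarrow> (\<And>k. k \<in> I \<Longrightarrow> t k \<in> {0..1}) \<Longrightarrow>
      (\<Sum>i<3. (\<Sum>k\<in>I. c k * h i (t k))\<^sup>2 / p i) \<le> (\<Sum>k\<in>I. \<Sum>l\<in>I. c k * c l * kernel1 (t k) (t l))"

lemma sum_lessThan_3: "(\<Sum>i<3. f i) = f 0 + f 1 + (f 2 :: real)" for f :: "nat \<Rightarrow> real"
  by (simp add: eval_nat_numeral)

lemma sum_UN_le:
  fixes f :: "'a \<Rightarrow> real"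
  assumes "finite I" "\<And>i. i \<in> I \<Longrightarrow> finite (A i)" "\<And>i x. i \<in> I \<Longrightarrow> x \<in> A i \<Longrightarrow> 0 \<le> f x"
  shows "sum f (\<Union>i\<in>I. A i) \<le> (\<Sum>i\<in>I. sum f (A i))"
  using assms
proof (induction I)
  case (insert j I)
  have "sum f (A j \<union> (\<Union>i\<in>I. A i)) + sum f (A j \<inter> (\<Union>i\<in>I. A i)) = sum f (A j) + sum f (\<Union>i\<in>I. A i)"
    using insert by (intro sum.union_inter) auto
  moreover have "0 \<le> sum f (A j \<inter> (\<Union>i\<in>I. A i))" using insert.prems by (intro sum_nonneg) auto
  moreover have "sum f (\<Union>i\<in>I. A i) \<le> (\<Sum>i\<in>I. sum f (A i))" using insert by auto
  ultimately show ?case using insert.hyps by simp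
qed simp

lemma PiE_lessThan_Suc:
  "{..<Suc n} \<rightarrow>\<^sub>E B = (\<lambda>(i, s). s(n := i)) ` (B \<times> ({..<n} \<rightarrow>\<^sub>E B))"
  using PiE_insert_eq[of n "{..<n}" "\<lambda>_. B"] by (simp add: lessThan_Suc)

lemma sum_PiE_lessThan_Suc:
  fixes f :: "(nat \<Rightarrow> 'a) \<Rightarrow> real"
  shows "(\<Sum>s\<in>{..<Suc n} \<rightarrow>\<^sub>E B. f s) = (\<Sum>s\<in>{..<n} \<rightarrow>\<^sub>E B. \<Sum>i\<in>B. f (s(n := i)))"
proof -
  have inj: "inj_on (\<lambda>(i, s). s(n := i)) (B \<times> ({..<n} \<rightarrow>\<^sub>E B))"
    by (rule inj_combinator) simp
  have "(\<Sum>s\<in>{..<Suc n} \<rightarrow>\<^sub>E B. f s) = (\<Sum>(i, s)\<in>B \<times> ({..<n} \<rightarrow>\<^sub>E B). f (s(n := i)))"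
    unfolding PiE_lessThan_Suc sum.reindex[OF inj] by (simp add: case_prod_unfold)
  also have "\<dots> = (\<Sum>i\<in>B. \<Sum>s\<in>{..<n} \<rightarrow>\<^sub>E B. f (s(n := i)))"
    by (rule sum.cartesian_product[symmetric])
  also have "\<dots> = (\<Sum>s\<in>{..<n} \<rightarrow>\<^sub>E B. \<Sum>i\<in>B. f (s(n := i)))"
    by (rule sum.swap)
  finally show ?thesis .
qed

lemma kernel1_form_sums:
  fixes A :: "nat \<Rightarrow> nat \<Rightarrow> real"
  assumes "finite I" "\<And>k. k \<in> I \<Longrightarrow> t k \<in> {0..1}"
  shows "(\<lambda>m. \<Sum>k\<in>I. \<Sum>l\<in>I. (c k * eigfun m (t k)) * (c l * eigfun m (t l)) * A k l) sums
    (\<Sum>k\<in>I. \<Sum>l\<in>I. c k * c l * (A k l * kernel1 (t k) (t l)))"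
proof (intro sums_sum)
  fix k l assume "k \<in> I" "l \<in> I"
  then have "(\<lambda>m. (c k * c l * A k l) * (eigfun m (t k) * eigfun m (t l))) sums ((c k * c l * A k l) * kernel1 (t k) (t l))"
    by (intro sums_mult kernel1_Mercer assms)
  then show "(\<lambda>m. (c k * eigfun m (t k)) * (c l * eigfun m (t l)) * A k l) sums (c k * c l * (A k l * kernel1 (t k) (t l)))"
    by (simp only: mult_ac)
qed

context splitting
begin

text \<open>By induction on \<open>n\<close>: expand one kernel factor by Mercer's theorem, apply the induction
  hypothesis to each summand, resum, and apply the univariate inequality.\<close>

lemma Bessel_prod:
  fixes I :: "nat set" and t :: "nat \<Rightarrow> nat \<Rightarrow> real"
  assumes I: "finite I" and t: "\<And>k j. k \<in> I \<Longrightarrow> j < n \<Longrightarrow> t k j \<in> {0..1}"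
  shows "(\<Sum>s\<in>{..<n} \<rightarrow>\<^sub>E {..<3}. (\<Sum>k\<in>I. c k * (\<Prod>j<n. h (s j) (t k j)))\<^sup>2 / (\<Prod>j<n. p (s j)))
    \<le> (\<Sum>k\<in>I. \<Sum>l\<in>I. c k * c l * (\<Prod>j<n. kernel1 (t k j) (t l j)))"
  using t
proof (induction n arbitrary: c)
  case 0
  then show ?case by (simp add: power2_eq_square sum_product)
next
  case (Suc n)
  let ?S = "{..<n} \<rightarrow>\<^sub>E {..<3 :: nat}"
  let ?K = "\<lambda>k l. \<Prod>j<n. kernel1 (t k j) (t l j)"
  let ?H = "\<lambda>s k. \<Prod>j<n. h (s j) (t k j)"
  let ?P = "\<lambda>s. \<Prod>j<n. p (s j)"
  have tn: "t k n \<in> {0..1}" if "k \<in> I" for k using Suc.prems[OF that] by simp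
  have pos: "0 < ?P s" if "s \<in> ?S" for s
    using that by (intro prod_pos p_pos) (auto simp: PiE_def Pi_def)
  \<comment> \<open>Stated for arbitrary coefficients, because it is applied for every
    \<open>m\<close> with \<open>c k * eigfun m (t k n)\<close> in place of
    \<open>c k\<close>.\<close>
  have IH: "(\<Sum>s\<in>?S. (\<Sum>k\<in>I. c k * ?H s k)\<^sup>2 / ?P s) \<le> (\<Sum>k\<in>I. \<Sum>l\<in>I. c k * c l * ?K k l)" for c
    using Suc.prems by (intro Suc.IH) simp
  have 1: "(\<lambda>m. \<Sum>s\<in>?S. (\<Sum>k\<in>I. (c k * eigfun m (t k n)) * ?H s k)\<^sup>2 / ?P s) sums
      (\<Sum>s\<in>?S. (\<Sum>k\<in>I. \<Sum>l\<in>I. c k * c l * (?H s k * ?H s l * kernel1 (t k n) (t l n))) / ?P s)"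
  proof (intro sums_sum sums_divide)
    fix s
    have "(\<Sum>k\<in>I. (c k * eigfun m (t k n)) * ?H s k)\<^sup>2
        = (\<Sum>k\<in>I. \<Sum>l\<in>I. (c k * eigfun m (t k n)) * (c l * eigfun m (t l n)) * (?H s k * ?H s l))" for m
      unfolding power2_eq_square sum_product by (intro sum.cong refl) (simp only: mult_ac)
    then show "(\<lambda>m. (\<Sum>k\<in>I. (c k * eigfun m (t k n)) * ?H s k)\<^sup>2) sums
        (\<Sum>k\<in>I. \<Sum>l\<in>I. c k * c l * (?H s k * ?H s l * kernel1 (t k n) (t l n)))"
      using kernel1_form_sums[OF I tn, where c = c and A = "\<lambda>k l. ?H s k * ?H s l"] by simp
  qed
  have "(\<Sum>s\<in>{..<Suc n} \<rightarrow>\<^sub>E {..<3}. (\<Sum>k\<in>I. c k * (\<Prod>j<Suc n. h (s j) (t k j)))\<^sup>2 / (\<Prod>j<Suc n. p (s j)))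
      = (\<Sum>s\<in>?S. \<Sum>i<3. (\<Sum>k\<in>I. c k * (?H s k * h i (t k n)))\<^sup>2 / (?P s * p i))"
    unfolding sum_PiE_lessThan_Suc by simp
  also have "\<dots> = (\<Sum>s\<in>?S. (\<Sum>i<3. (\<Sum>k\<in>I. (c k * ?H s k) * h i (t k n))\<^sup>2 / p i) / ?P s)"
    by (simp only: sum_divide_distrib divide_divide_eq_left mult_ac)
  also have "\<dots> \<le> (\<Sum>s\<in>?S. (\<Sum>k\<in>I. \<Sum>l\<in>I. (c k * ?H s k) * (c l * ?H s l) * kernel1 (t k n) (t l n)) / ?P s)"
    by (intro sum_mono divide_right_mono Bessel I tn less_imp_le[OF pos])
  also have "\<dots> = (\<Sum>s\<in>?S. (\<Sum>k\<in>I. \<Sum>l\<in>I. c k * c l * (?H s k * ?H s l * kernel1 (t k n) (t l n))) / ?P s)"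
    by (simp only: mult_ac)
  also have "\<dots> \<le> (\<Sum>k\<in>I. \<Sum>l\<in>I. c k * c l * (?K k l * kernel1 (t k n) (t l n)))"
    by (rule sums_le[OF _ 1 kernel1_form_sums[OF I tn]]) (rule IH)
  also have "\<dots> = (\<Sum>k\<in>I. \<Sum>l\<in>I. c k * c l * (\<Prod>j<Suc n. kernel1 (t k j) (t l j)))"
    by simp
  finally show ?case .
qed

text \<open>A sample coordinate rules out part 1 or part 2, never part 0. Hence at least this share
  of the squared norm is lost per coordinate.\<close>

definition \<delta> :: real where
  "\<delta> = min (p 1) (p 2)"

lemma \<delta>: "0 < \<delta>" "\<delta> < 1"
  using p_pos[of 0] p_pos[of 1] p_pos[of 2] p_sum by (auto simp: \<delta>_def sum_lessThan_3 min_def)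

text \<open>Only the products of parts that do not vanish at some point \<open>t k\<close> contribute; for each \<open>k\<close>,
  one of the three parts is excluded in each coordinate.\<close>

lemma point_functional_le:
  fixes t :: "nat \<Rightarrow> nat \<Rightarrow> real"
  assumes t: "\<And>k j. k < n \<Longrightarrow> j < d \<Longrightarrow> t k j \<in> {0..1}"
  shows "(\<Sum>k<n. c k * (\<Prod>j<d. u (t k j)))\<^sup>2
    \<le> real n * (1 - \<delta>) ^ d * (\<Sum>k<n. \<Sum>l<n. c k * c l * (\<Prod>j<d. kernel1 (t k j) (t l j)))"
proof -
  define S where "S = {..<d} \<rightarrow>\<^sub>E {..<3 :: nat}"
  have finS: "finite S" unfolding S_def by (intro finite_PiE) auto
  define P where "P s = (\<Prod>j<d. p (s j))" for s
  have P: "0 < P s" if "s \<in> S" for s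
    using that unfolding S_def P_def by (intro prod_pos p_pos) (auto simp: PiE_def Pi_def)
  define b where "b s = (\<Sum>k<n. c k * (\<Prod>j<d. h (s j) (t k j)))" for s
  \<comment> \<open>The index of a part that vanishes at \<open>x\<close>; at \<open>x = a\<close>
    both do, and 2 is taken.\<close>
  define q where "q x = (if x \<le> a then 2 else 1 :: nat)" for x
  have hq: "h (q x) x = 0" if "x \<in> {0..1}" for x
    using left[OF that] right[OF that] by (auto simp: q_def)
  \<comment> \<open>The products of parts that can be nonzero at the \<open>k\<close>-th sample
    point.\<close>
  define D where "D k = PiE {..<d} (\<lambda>j. {..<3} - {q (t k j)})" for k
  have DS: "D k \<subseteq> S" for k unfolding D_def S_def by (intro PiE_mono) auto
  define E where "E = (\<Union>k<n. D k)"
  have ES: "E \<subseteq> S" using DS by (auto simp: E_def)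
  have b0: "b s = 0" if "s \<in> S - E" for s
    unfolding b_def
  proof (intro sum.neutral ballI)
    fix k assume k: "k \<in> {..<n}"
    then have "s \<notin> D k" "s \<in> S" using that by (auto simp: E_def)
    then obtain j where j: "j < d" "s j = q (t k j)"
      unfolding D_def S_def PiE_iff by auto
    then have "h (s j) (t k j) = 0" using hq[OF t[of k j]] k by simp
    then have "(\<Prod>j<d. h (s j) (t k j)) = 0" using j by (intro prod_zero bexI[of _ j]) auto
    then show "c k * (\<Prod>j<d. h (s j) (t k j)) = 0" by simp
  qed
  have "(\<Prod>j<d. u (t k j)) = (\<Sum>s\<in>S. \<Prod>j<d. h (s j) (t k j))" if "k < n" for k
  proof -
    have "(\<Prod>j<d. u (t k j)) = (\<Prod>j<d. \<Sum>i<3. h i (t k j))"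
      using t[OF that] by (intro prod.cong u_eq) auto
    also have "\<dots> = (\<Sum>s\<in>S. \<Prod>j<d. h (s j) (t k j))"
      unfolding S_def by (rule prod_sum_PiE) auto
    finally show ?thesis .
  qed
  then have "(\<Sum>k<n. c k * (\<Prod>j<d. u (t k j))) = (\<Sum>k<n. \<Sum>s\<in>S. c k * (\<Prod>j<d. h (s j) (t k j)))"
    by (simp add: sum_distrib_left)
  also have "\<dots> = (\<Sum>s\<in>S. b s)" unfolding b_def by (rule sum.swap)
  also have "\<dots> = (\<Sum>s\<in>E. b s)" using b0 by (intro sum.mono_neutral_right finS ES) auto
  \<comment> \<open>The weights are chosen so that Cauchy-Schwarz separates the total squared norm
    of the visible products from the sum bounded by \<open>Bessel_prod\<close>.\<close>
  also have "\<dots> = (\<Sum>s\<in>E. sqrt (P s) * (b s / sqrt (P s)))"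
    using P ES by (intro sum.cong) (auto simp: less_imp_neq[symmetric] dest!: subsetD)
  finally have "(\<Sum>k<n. c k * (\<Prod>j<d. u (t k j)))\<^sup>2 \<le> (\<Sum>s\<in>E. (sqrt (P s))\<^sup>2) * (\<Sum>s\<in>E. (b s / sqrt (P s))\<^sup>2)"
    by (simp only: Cauchy_Schwarz_ineq_sum)
  also have "(\<Sum>s\<in>E. (sqrt (P s))\<^sup>2) = (\<Sum>s\<in>E. P s)"
    using P ES by (intro sum.cong) (auto intro!: less_imp_le)
  also have "(\<Sum>s\<in>E. (b s / sqrt (P s))\<^sup>2) = (\<Sum>s\<in>E. (b s)\<^sup>2 / P s)"
  proof (intro sum.cong refl)
    fix s assume "s \<in> E"
    then have "0 \<le> P s" using P ES by (intro less_imp_le) auto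
    then show "(b s / sqrt (P s))\<^sup>2 = (b s)\<^sup>2 / P s" by (simp add: power_divide)
  qed
  also have "(\<Sum>s\<in>E. P s) * (\<Sum>s\<in>E. (b s)\<^sup>2 / P s)
      \<le> (real n * (1 - \<delta>) ^ d) * (\<Sum>k<n. \<Sum>l<n. c k * c l * (\<Prod>j<d. kernel1 (t k j) (t l j)))"
  proof (intro mult_mono)
    \<comment> \<open>Union bound over the sample points, the source of the factor \<open>n\<close>;
      for each point the total mass factorizes over the coordinates.\<close>
    have "(\<Sum>s\<in>E. P s) \<le> (\<Sum>k<n. \<Sum>s\<in>D k. P s)"
      unfolding E_def using P DS
      by (intro sum_UN_le) (auto intro: finite_subset[OF _ finS] less_imp_le)
    also have "\<dots> \<le> (\<Sum>k<n. (1 - \<delta>) ^ d)"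
    proof (rule sum_mono)
      fix k assume "k \<in> {..<n}"
      have "(\<Sum>s\<in>D k. P s) = (\<Prod>j<d. \<Sum>i\<in>{..<3} - {q (t k j)}. p i)"
        unfolding D_def P_def by (rule prod_sum_PiE[symmetric]) auto
      also have "\<dots> \<le> (\<Prod>j<d. 1 - \<delta>)"
      proof (intro prod_mono conjI)
        fix j
        show "0 \<le> (\<Sum>i\<in>{..<3} - {q (t k j)}. p i)"
          using p_pos by (intro sum_nonneg) (auto intro: less_imp_le)
        have "(\<Sum>i\<in>{..<3} - {q (t k j)}. p i) = 1 - p (q (t k j))"
          using p_sum by (subst sum_diff1) (auto simp: q_def)
        then show "(\<Sum>i\<in>{..<3} - {q (t k j)}. p i) \<le> 1 - \<delta>" by (simp add: \<delta>_def q_def)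
      qed
      finally show "(\<Sum>s\<in>D k. P s) \<le> (1 - \<delta>) ^ d" by simp
    qed
    finally show "(\<Sum>s\<in>E. P s) \<le> real n * (1 - \<delta>) ^ d" by simp
    have "(\<Sum>s\<in>E. (b s)\<^sup>2 / P s) \<le> (\<Sum>s\<in>S. (b s)\<^sup>2 / P s)"
      using P by (intro sum_mono2 finS ES divide_nonneg_nonneg) (auto intro: less_imp_le)
    also have "\<dots> \<le> (\<Sum>k<n. \<Sum>l<n. c k * c l * (\<Prod>j<d. kernel1 (t k j) (t l j)))"
      unfolding S_def b_def P_def using t by (intro Bessel_prod) auto
    finally show "(\<Sum>s\<in>E. (b s)\<^sup>2 / P s) \<le> (\<Sum>k<n. \<Sum>l<n. c k * c l * (\<Prod>j<d. kernel1 (t k j) (t l j)))" .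
    show "0 \<le> real n * (1 - \<delta>) ^ d" using \<delta> by simp
    show "0 \<le> (\<Sum>s\<in>E. (b s)\<^sup>2 / P s)"
      using P ES by (intro sum_nonneg divide_nonneg_nonneg) (auto intro: less_imp_le)
  qed
  finally show ?thesis .
qed

end


section \<open>Fooling functions in the multivariate space\<close>

context sobolev_space
begin

lemma ip_comb_comb:
  fixes t :: "nat \<Rightarrow> nat \<Rightarrow> real"
  assumes "finite I" "\<And>k. k \<in> I \<Longrightarrow> t k \<in> unit_cube d"
  shows "(\<lambda>x. \<Sum>k\<in>I. c k * ksection (t k) x) \<in> F"
    and "g \<in> F \<Longrightarrow> ip (\<lambda>x. \<Sum>k\<in>I. c k * ksection (t k) x) g = (\<Sum>k\<in>I. c k * g (t k))"
    and "ip (\<lambda>x. \<Sum>k\<in>I. c k * ksection (t k) x) (\<lambda>x. \<Sum>k\<in>I. c k * ksection (t k) x)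
      = (\<Sum>k\<in>I. \<Sum>l\<in>I. c k * c l * (\<Prod>j<d. kernel1 (t k j) (t l j)))"
proof -
  show F: "(\<lambda>x. \<Sum>k\<in>I. c k * ksection (t k) x) \<in> F"
    using assms by (intro sum_closed section_closed) auto
  show ip: "ip (\<lambda>x. \<Sum>k\<in>I. c k * ksection (t k) x) g = (\<Sum>k\<in>I. c k * g (t k))" if g: "g \<in> F" for g
  proof -
    have "ip (\<lambda>x. \<Sum>k\<in>I. c k * ksection (t k) x) g = (\<Sum>k\<in>I. c k * ip (ksection (t k)) g)"
      using assms g by (intro ip_sum_left section_closed) auto
    also have "\<dots> = (\<Sum>k\<in>I. c k * g (t k))"
      using assms reproducing[OF g] ip_commute[OF g section_closed] by (intro sum.cong) auto
    finally show ?thesis .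
  qed
  show "ip (\<lambda>x. \<Sum>k\<in>I. c k * ksection (t k) x) (\<lambda>x. \<Sum>k\<in>I. c k * ksection (t k) x)
      = (\<Sum>k\<in>I. \<Sum>l\<in>I. c k * c l * (\<Prod>j<d. kernel1 (t k j) (t l j)))"
    unfolding ip[OF F] sum_distrib_left
    using assms(2) by (intro sum.cong refl) (auto simp: kernel_section_def sobolev_kernel_eq mult.assoc)
qed

lemma eigfunp_zero_index:
  "x \<in> unit_cube d \<Longrightarrow> eigfunp d zero_index x = (\<Prod>j<d. eigfun 0 (x j))"
  by (auto simp: eigfunp_def zero_index_def intro!: prod.cong)

text \<open>The fooling function is \<open>e - w\<close>, where \<open>w\<close> projects the
  leading eigenfunction \<open>e\<close> onto the span of the kernel sections at the sample points.
  The estimate for point functionals gives \<open>ip w w \<le> \<kappa>\<close>, and the component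
  of \<open>e - w\<close> along \<open>e\<close> alone already provides the stated
  \<open>L\<^sub>2\<close>-norm.\<close>

lemma Lambda_std_minimal_error_ge:
  assumes split: "splitting a (eigfun 0) h p"
  shows "(1 - real n * (1 - splitting.\<delta> p) ^ d) * sqrt (eig 0 ^ d)
    \<le> minimal_error F ip M (APP d) (Lambda_std (unit_cube d)) n"
proof (rule minimal_error_ge[OF Lambda_std_bounded])
  interpret splitting a "eigfun 0" h p by (rule split)
  show "Lambda_std (unit_cube d) \<noteq> {}"
    unfolding Lambda_std_def unit_cube_def by (auto simp: PiE_eq_empty_iff)
  fix L assume L: "\<And>j. j < n \<Longrightarrow> L j \<in> Lambda_std (unit_cube d)"
  have "\<exists>x\<in>unit_cube d. L k = (\<lambda>f. f x)" if "k < n" for k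
    using L[OF that] by (auto simp: Lambda_std_def)
  then obtain t where t: "\<And>k. k < n \<Longrightarrow> t k \<in> unit_cube d" and Lt: "\<And>k. k < n \<Longrightarrow> L k = (\<lambda>f. f (t k))"
    by metis
  define e where "e = eigfunp d zero_index"
  define lam where "lam = eig 0 ^ d"
  define \<kappa> where "\<kappa> = real n * (1 - \<delta>) ^ d"
  have \<kappa>0: "0 \<le> \<kappa>" using \<delta> by (simp add: \<kappa>_def)
  have lam0: "0 < lam" using eig_pos by (simp add: lam_def)
  have e: "e \<in> F" unfolding e_def by (rule eigfunp_F(1))
  have ee: "ip e e = 1" unfolding e_def using ip_eigfunp_eigfunp[OF zero_index(1) zero_index(1)] by simp
  have fe: "(LINT x|M. f x * e x) = lam * ip f e" if "f \<in> F" for f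
    using eigfunp_F(2)[OF that, of zero_index] eig_pos[of 0] by (simp add: e_def zero_index(2) lam_def)
  have et: "e (t k) = (\<Prod>j<d. eigfun 0 (t k j))" if "k < n" for k
    unfolding e_def by (rule eigfunp_zero_index[OF t[OF that]])
  define v where "v c x = (\<Sum>k<n. c k * ksection (t k) x)" for c x
  have vF: "v c \<in> F" and ipv: "g \<in> F \<Longrightarrow> ip (v c) g = (\<Sum>k<n. c k * g (t k))"
    and vv: "ip (v c) (v c) = (\<Sum>k<n. \<Sum>l<n. c k * c l * (\<Prod>j<d. kernel1 (t k j) (t l j)))" for c g
    unfolding v_def[abs_def] using ip_comb_comb[of "{..<n}" t] t by auto
  have bound: "(ip (v c) e)\<^sup>2 \<le> \<kappa> * ip (v c) (v c)" for c
  proof -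
    have "ip (v c) e = (\<Sum>k<n. c k * (\<Prod>j<d. eigfun 0 (t k j)))"
      unfolding ipv[OF e] using et by (intro sum.cong) auto
    then show ?thesis
      unfolding vv \<kappa>_def using point_functional_le[of n d t c] unit_cube_nth[OF t] by simp
  qed
  have V: "is_subspace (range v)"
    unfolding is_subspace_def
  proof (intro conjI ballI allI)
    show "range v \<subseteq> F" using vF by blast
    have "(\<lambda>x. 0) = v (\<lambda>_. 0)" by (simp add: v_def fun_eq_iff)
    then show "(\<lambda>x. 0) \<in> range v" by blast
    fix f assume "f \<in> range v"
    then obtain b where f: "f = v b" by blast
    show "(\<lambda>x. c * f x) \<in> range v" for c
    proof -
      have "(\<lambda>x. c * f x) = v (\<lambda>k. c * b k)"
        by (simp add: f v_def fun_eq_iff sum_distrib_left mult.assoc)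
      then show ?thesis by blast
    qed
    fix g assume "g \<in> range v"
    then obtain b' where g: "g = v b'" by blast
    have "(\<lambda>x. f x + g x) = v (\<lambda>k. b k + b' k)"
      by (simp add: f g v_def fun_eq_iff sum.distrib distrib_right)
    then show "(\<lambda>x. f x + g x) \<in> range v" by blast
  qed
  obtain w u where w: "w \<in> F" and u: "\<And>m. u m \<in> range v"
    and lim: "(\<lambda>m. ip_norm ip (\<lambda>x. u m x - w x)) \<longlonglongrightarrow> 0"
    and rep: "\<And>f. f \<in> range v \<Longrightarrow> ip f w = ip f e"
  proof (rule subspace_representer[OF V, of "\<lambda>f. ip f e" \<kappa>])
    show "ip (\<lambda>x. f x + g x) e = ip f e + ip g e" if "f \<in> range v" "g \<in> range v" for f g
      using that vF by (intro ip_add_left e) auto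
    show "ip (\<lambda>x. c * f x) e = c * ip f e" if "f \<in> range v" for f c
      using that vF by (intro ip_scale_left e) auto
    show "(ip f e)\<^sup>2 \<le> \<kappa> * ip f f" if "f \<in> range v" for f
      using that bound by auto
  qed blast
  have uF: "u m \<in> F" for m using u[of m] vF by auto
  \<comment> \<open>\<open>w\<close> is a limit of elements of \<open>range v\<close>, so its
    representing property extends to \<open>w\<close> itself; this is the orthogonality of
    \<open>w\<close> and \<open>e - w\<close>.\<close>
  have ww: "ip w w = ip w e"
    using LIMSEQ_unique[OF tendsto_ip_left[OF uF w w lim]] tendsto_ip_left[OF uF w e lim] rep[OF u] by simp
  have "(ip w e)\<^sup>2 \<le> \<kappa> * ip w w"
  proof (rule LIMSEQ_le)
    show "(\<lambda>m. (ip (u m) e)\<^sup>2) \<longlonglongrightarrow> (ip w e)\<^sup>2" by (intro tendsto_intros tendsto_ip_left[OF uF w e lim])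
    show "(\<lambda>m. \<kappa> * ip (u m) (u m)) \<longlonglongrightarrow> \<kappa> * ip w w" by (intro tendsto_intros tendsto_ip_self[OF uF w lim])
    have "(ip (u m) e)\<^sup>2 \<le> \<kappa> * ip (u m) (u m)" for m
      using u[of m] bound by auto
    then show "\<exists>N. \<forall>m\<ge>N. (ip (u m) e)\<^sup>2 \<le> \<kappa> * ip (u m) (u m)" by blast
  qed
  then have "ip w w * ip w w \<le> \<kappa> * ip w w" by (simp add: ww power2_eq_square)
  then have w\<kappa>: "ip w w \<le> \<kappa>"
    using \<kappa>0 ip_nonneg[OF w] by (cases "ip w w = 0") (auto simp: mult_le_cancel_right)
  define f where "f x = e x - w x" for x
  have f: "f \<in> F" unfolding f_def[abs_def] by (rule diff_closed[OF e w])
  have ff: "ip f f = 1 - ip w w"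
    using ip_diff_diff[OF e w] ww ip_commute[OF w e] ee unfolding f_def[abs_def] by simp
  have fe': "ip f e = ip f f"
    using ip_diff_left[OF e w e] ww ee ff unfolding f_def[abs_def] by simp
  have ball: "f \<in> unit_ball F ip" using f ff ip_nonneg[OF w] by (simp add: unit_ball_iff)
  have "L k f = 0" if k: "k < n" for k
  proof -
    \<comment> \<open>The kernel section at a sample point is one of the combinations, so
      \<open>w\<close> and \<open>e\<close> have the same inner product with it and agree at that
      point.\<close>
    have "ksection (t k) = v (\<lambda>l. if l = k then 1 else 0)"
      using k by (simp add: v_def fun_eq_iff if_distrib[of "\<lambda>a. a * b" for b] cong: if_cong)
    then have "ip (ksection (t k)) w = ip (ksection (t k)) e" using rep by simp
    then have "w (t k) = e (t k)"
      using reproducing[OF w t[OF k]] reproducing[OF e t[OF k]]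
        ip_commute[OF w section_closed[OF t[OF k]]] ip_commute[OF e section_closed[OF t[OF k]]] by simp
    then show ?thesis by (simp add: Lt[OF k] f_def)
  qed
  moreover have "(1 - \<kappa>) * sqrt lam \<le> L2_norm M f"
  proof -
    \<comment> \<open>The coefficient \<open>ip f f\<close> equals \<open>ip f e\<close>, so
      \<open>ip f f * e\<close> is the \<open>L\<^sub>2\<close> projection of \<open>f\<close> onto
      the line through \<open>e\<close>. The inequality says that projecting does not increase the
      norm.\<close>
    have "0 \<le> (LINT x|M. (f x - ip f f * e x) * (f x - ip f f * e x))" by simp
    also have "\<dots> = (LINT x|M. f x * f x + (ip f f)\<^sup>2 * (e x * e x) - 2 * ip f f * (f x * e x))"
      by (simp add: power2_eq_square algebra_simps)
    also have "\<dots> = (LINT x|M. f x * f x) + (ip f f)\<^sup>2 * (LINT x|M. e x * e x) - 2 * ip f f * (LINT x|M. f x * e x)"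
      using integrable_F_F[OF f f] integrable_F_F[OF e e] integrable_F_F[OF f e] by simp
    also have "\<dots> = (LINT x|M. f x * f x) - lam * (ip f f)\<^sup>2"
      unfolding fe[OF e] fe[OF f] fe' ee by (simp add: power2_eq_square)
    finally have "lam * (ip f f)\<^sup>2 \<le> (LINT x|M. f x * f x)" by simp
    then have "sqrt (lam * (ip f f)\<^sup>2) \<le> L2_norm M f" unfolding L2_norm_eq by (rule real_sqrt_le_mono)
    moreover have "sqrt (lam * (ip f f)\<^sup>2) = ip f f * sqrt lam"
      using ip_nonneg[OF f] by (simp add: real_sqrt_mult)
    moreover have "(1 - \<kappa>) * sqrt lam \<le> ip f f * sqrt lam"
      using w\<kappa> ff lam0 by (intro mult_right_mono) auto
    ultimately show ?thesis by simp
  qed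
  ultimately show "\<exists>f\<in>unit_ball F ip. (\<forall>k<n. L k f = 0) \<and> (1 - real n * (1 - \<delta>) ^ d) * sqrt (eig 0 ^ d) \<le> L2_norm M f"
    using ball unfolding \<kappa>_def lam_def by blast
qed

end


section \<open>Splitting the leading univariate eigenfunction\<close>

lemma unit_cube_1:
  "x \<in> {0..1} \<Longrightarrow> (\<lambda>j\<in>{..<1}. x) \<in> unit_cube 1"
  "y \<in> unit_cube 1 \<Longrightarrow> (\<lambda>j\<in>{..<1}. y 0) = y"
  "y \<in> unit_cube 1 \<Longrightarrow> y 0 \<in> {0..1}"
  by (auto simp: unit_cube_def PiE_def extensional_def Pi_def)

lemma eigfun_0_eq: "\<exists>b>0. \<forall>x. eigfun 0 x = b * cos (freq 0 * (1 - x))"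
proof (intro exI conjI allI)
  show "0 < 1 / (freq 0 * sqrt (cosfun_sq 0))" using freq_pos[of 0] cosfun_sq_ge[of 0] by simp
  show "eigfun 0 x = 1 / (freq 0 * sqrt (cosfun_sq 0)) * cos (freq 0 * (1 - x))" for x
    by (simp add: eigfun_def cosfun_def)
qed

text \<open>Needed for the part supported in \<open>[0, 1/2]\<close> not to vanish identically.\<close>

lemma eigfun_0_not_affine: "\<exists>x\<in>{0..1/2}. eigfun 0 x \<noteq> eigfun 0 (1/2) / (3/2) * (1 + x)"
proof (rule ccontr)
  assume "\<not> ?thesis"
  then have *: "eigfun 0 x = eigfun 0 (1/2) / (3/2) * (1 + x)" if "x \<in> {0..1/2}" for x
    using that by blast
  obtain b where b: "0 < b" "\<And>x. eigfun 0 x = b * cos (freq 0 * (1 - x))" using eigfun_0_eq by blast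
  let ?w = "freq 0"
  \<comment> \<open>An affine function satisfies the midpoint identity on \<open>[0, 1/2]\<close>;
    for this cosine the identity would force \<open>cos (freq 0 / 4) = 1\<close>.\<close>
  have "eigfun 0 0 + eigfun 0 (1/2) = 2 * eigfun 0 (1/4)"
    using *[of 0] *[of "1/4"] by simp
  then have "b * (cos ?w + cos (?w / 2)) = b * (2 * cos (3 * ?w / 4))"
    unfolding b(2) by (simp add: algebra_simps)
  then have "cos ?w + cos (?w / 2) = 2 * cos (3 * ?w / 4)" using b(1) by simp
  moreover have "cos ?w + cos (?w / 2) = 2 * cos (3 * ?w / 4) * cos (?w / 4)"
    using cos_plus_cos[of ?w "?w / 2"] by (simp add: field_simps)
  ultimately have "cos (3 * ?w / 4) * (1 - cos (?w / 4)) = 0" by (simp add: algebra_simps)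
  moreover have "0 < cos (3 * ?w / 4)"
    using freq_pos[of 0] freq_0_less_1 pi_gt3 by (intro cos_gt_zero_pi) auto
  moreover have "cos (?w / 4) < cos 0"
    using freq_pos[of 0] freq_0_less_1 pi_gt3 by (intro cos_monotone_0_pi) auto
  ultimately show False by simp
qed

text \<open>These inequalities keep two parts of the splitting from vanishing: the one supported in
  \<open>[1/2, 1]\<close>, by its value at 1, and the multiple of the kernel section, by its value
  at \<open>1/2\<close>.\<close>

lemma eigfun_0_less: "eigfun 0 (1/2) < eigfun 0 1" and eigfun_0_half_pos: "0 < eigfun 0 (1/2)"
proof -
  obtain b where b: "0 < b" "\<And>x. eigfun 0 x = b * cos (freq 0 * (1 - x))" using eigfun_0_eq by blast
  have "cos (freq 0 * (1 - 1/2)) < cos 0"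
    using freq_pos[of 0] freq_0_less_1 pi_gt3 by (intro cos_monotone_0_pi) auto
  then show "eigfun 0 (1/2) < eigfun 0 1" unfolding b(2) using b(1) by simp
  have "0 < cos (freq 0 * (1 - 1/2))"
    using freq_pos[of 0] freq_0_less_1 pi_gt3 by (intro cos_gt_zero_pi) auto
  then show "0 < eigfun 0 (1/2)" unfolding b(2) using b(1) by simp
qed

text \<open>In the univariate space, \<open>w x = eigfun 0 (min x (1/2))\<close> is the projection of \<open>eigfun 0\<close> onto the
  functions that are constant on \<open>[1/2, 1]\<close>, and a multiple of the kernel section at \<open>1/2\<close> splits off
  the value at \<open>1/2\<close>.\<close>

lemma splitting_exists:
  assumes "sobolev_space 1 F ip"
  shows "\<exists>h p. splitting (1/2) (eigfun 0) h p"
proof -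
  interpret sobolev_space 1 F ip by (rule assms)
  \<comment> \<open>Identifies a number in \<open>[0, 1]\<close> with the point of the
    one-dimensional cube, whose elements are functions on \<open>{..<1}\<close>.\<close>
  define pt where "pt x = (\<lambda>j\<in>{..<1 :: nat}. x :: real)" for x
  have pt: "pt x \<in> unit_cube 1" if "x \<in> {0..1}" for x unfolding pt_def by (rule unit_cube_1(1)[OF that])
  have pt0: "pt x 0 = x" for x by (simp add: pt_def)
  have pt_eq: "pt (y 0) = y" if "y \<in> unit_cube 1" for y unfolding pt_def by (rule unit_cube_1(2)[OF that])
  define k where "k x = ksection (pt x)" for x
  have k: "k x \<in> F" if "x \<in> {0..1}" for x unfolding k_def by (rule section_closed[OF pt[OF that]])
  have k_pt: "k x (pt y) = kernel1 x y" if "y \<in> {0..1}" for x y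
    using pt[OF that] by (simp add: k_def kernel_section_def sobolev_kernel_eq pt0 kernel1_commute)
  have rep: "ip f (k x) = f (pt x)" if "f \<in> F" "x \<in> {0..1}" for f x
    unfolding k_def by (rule reproducing[OF that(1) pt[OF that(2)]])
  have rep': "ip (k x) f = f (pt x)" if "f \<in> F" "x \<in> {0..1}" for f x
    using rep[OF that] ip_commute[OF that(1) k[OF that(2)]] by simp
  define e where "e = eigfunp 1 zero_index"
  have e: "e \<in> F" unfolding e_def by (rule eigfunp_F(1))
  have ee: "ip e e = 1" unfolding e_def using ip_eigfunp_eigfunp[OF zero_index(1) zero_index(1)] by simp
  have e_pt: "e (pt x) = eigfun 0 x" if "x \<in> {0..1}" for x
    using pt[OF that] unfolding e_def by (subst eigfunp_zero_index) (simp_all add: pt0)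
  define V where "V = {f \<in> F. \<forall>x\<in>{1/2..1}. f (pt x) = f (pt (1/2))}"
  have VI: "f \<in> V" if "f \<in> F" "\<And>x. x \<in> {1/2..1} \<Longrightarrow> f (pt x) = f (pt (1/2))" for f
    unfolding V_def using that by blast
  have VF: "f \<in> F" if "f \<in> V" for f using that unfolding V_def by blast
  have VD: "f (pt x) = f (pt (1/2))" if "f \<in> V" "x \<in> {1/2..1}" for f x
    using that unfolding V_def by blast
  have V: "is_subspace V"
    unfolding is_subspace_def
  proof (intro conjI ballI allI)
    show "V \<subseteq> F" using VF by blast
    show "(\<lambda>x. 0) \<in> V" by (rule VI[OF zero_closed]) simp
    fix f assume f: "f \<in> V"
    show "(\<lambda>x. c * f x) \<in> V" for c
      using VD[OF f] by (intro VI scale_closed VF[OF f]) metis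
    fix g assume g: "g \<in> V"
    show "(\<lambda>x. f x + g x) \<in> V"
      using VD[OF f] VD[OF g] by (intro VI add_closed VF[OF f] VF[OF g]) metis
  qed
  obtain w u where w: "w \<in> F" and u: "\<And>m. u m \<in> V"
    and lim: "(\<lambda>m. ip_norm ip (\<lambda>x. u m x - w x)) \<longlonglongrightarrow> 0"
    and w_rep: "\<And>f. f \<in> V \<Longrightarrow> ip f w = ip f e"
  proof (rule subspace_representer[OF V, of "\<lambda>f. ip f e" "ip e e"])
    show "ip (\<lambda>x. f x + g x) e = ip f e + ip g e" if "f \<in> V" "g \<in> V" for f g
      by (rule ip_add_left[OF VF[OF that(1)] VF[OF that(2)] e])
    show "ip (\<lambda>x. c * f x) e = c * ip f e" if "f \<in> V" for f c
      by (rule ip_scale_left[OF VF[OF that] e])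
    show "(ip f e)\<^sup>2 \<le> ip e e * ip f f" if "f \<in> V" for f
      using ip_Cauchy_Schwarz[OF VF[OF that] e] by (simp add: mult.commute)
  qed blast
  have uF: "u m \<in> F" for m by (rule VF[OF u])
  \<comment> \<open>For \<open>x \<le> 1/2\<close> the section \<open>kernel1 x\<close> is constant
    on \<open>[1/2, 1]\<close>, hence lies in \<open>V\<close>; there \<open>w\<close> and
    \<open>e\<close> cannot be told apart.\<close>
  have w_left: "w (pt x) = eigfun 0 x" if "x \<in> {0..1/2}" for x
  proof -
    have x: "x \<in> {0..1}" using that by simp
    have "k x (pt y) = k x (pt (1/2))" if "y \<in> {1/2..1}" for y
      using that \<open>x \<in> {0..1/2}\<close> by (simp add: k_pt kernel1_def)
    then have "k x \<in> V" by (rule VI[OF k[OF x]])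
    from w_rep[OF this] show ?thesis by (simp add: rep'[OF w x] rep'[OF e x] e_pt[OF x])
  qed
  \<comment> \<open>Constancy on \<open>[1/2, 1]\<close> is inherited by \<open>w\<close> as the
    pointwise limit of the \<open>u m\<close>, which are elements of \<open>V\<close>.\<close>
  have w_right: "w (pt x) = eigfun 0 (1/2)" if "x \<in> {1/2..1}" for x
  proof -
    have "(\<lambda>m. u m (pt x)) \<longlonglongrightarrow> w (pt x)" "(\<lambda>m. u m (pt (1/2))) \<longlonglongrightarrow> w (pt (1/2))"
      using that by (intro tendsto_pointwise[OF uF w lim] pt; simp)+
    moreover have "u m (pt x) = u m (pt (1/2))" for m by (rule VD[OF u that])
    ultimately have "w (pt x) = w (pt (1/2))" using LIMSEQ_unique by auto
    then show ?thesis using w_left[of "1/2"] by simp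
  qed
  have half: "(1/2 :: real) \<in> {0..1}" by simp
  \<comment> \<open>As \<open>kernel1 (1/2) (1/2) = 3/2\<close>, the function
    \<open>m * k (1/2)\<close> has the value of \<open>eigfun 0\<close> at
    \<open>1/2\<close>.\<close>
  define m where "m = eigfun 0 (1/2) / (3/2)"
  define H where "H i = (if i = 0 then (\<lambda>y. m * k (1/2) y) else if i = 1 then (\<lambda>y. w y - m * k (1/2) y)
    else (\<lambda>y. e y - w y))" for i :: nat
  have Hs: "H 0 = (\<lambda>y. m * k (1/2) y)" "H 1 = (\<lambda>y. w y - m * k (1/2) y)" "H 2 = (\<lambda>y. e y - w y)"
    by (simp_all add: H_def)
  have H0: "H 0 \<in> F" unfolding Hs by (rule scale_closed[OF k[OF half]])
  have H1: "H 1 \<in> F" using diff_closed[OF w H0] unfolding Hs .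
  have H2: "H 2 \<in> F" unfolding Hs by (rule diff_closed[OF e w])
  have HF: "H i \<in> F" for i using H0 H1 H2 by (auto simp: H_def)
  have wV: "w \<in> V" using w_left[of "1/2"] w_right by (intro VI[OF w]) simp
  have "k (1/2) \<in> V" by (rule VI[OF k[OF half]]) (simp add: k_pt kernel1_def)
  then have H0V: "H 0 \<in> V" using V unfolding Hs by (auto simp: is_subspace_def)
  have H1V: "H 1 \<in> V"
    using VD[OF wV] VD[OF H0V] by (intro VI[OF H1]) (simp only: Hs)
  have o: "ip f (H 2) = 0" if "f \<in> V" for f
  proof -
    have f: "f \<in> F" by (rule VF[OF that])
    show ?thesis unfolding Hs ip_diff_right[OF e w f] using w_rep[OF that] by simp
  qed
  have o01: "ip (H 0) (H 1) = 0"
  proof -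
    have "ip (H 0) (H 1) = m * ip (k (1/2)) (H 1)"
      unfolding Hs(1) by (rule ip_scale_left[OF k[OF half] H1])
    also have "ip (k (1/2)) (H 1) = 0"
      unfolding rep'[OF H1 half] using w_left[of "1/2"] by (simp add: H_def k_pt[OF half] kernel1_def m_def)
    finally show ?thesis by simp
  qed
  have orth: "ip (H i) (H j) = 0" if "i < 3" "j < 3" "i \<noteq> j" for i j
  proof -
    have "i \<in> {0,1,2}" "j \<in> {0,1,2}" using that by auto
    then show ?thesis
      using that o01 o[OF H0V] o[OF H1V] ip_commute[OF H0 H1] ip_commute[OF H0 H2] ip_commute[OF H1 H2]
      by auto
  qed
  define p where "p i = ip (H i) (H i)" for i
  have posI: "0 < ip f f" if "f \<in> F" "f y \<noteq> 0" for f y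
    using ip_nonneg[OF that(1)] ip_definite[OF that(1)] that(2) by (metis less_eq_real_def)
  have p0: "0 < p 0"
    unfolding p_def using eigfun_0_half_pos
    by (intro posI[OF H0, of "pt (1/2)"]) (simp add: H_def m_def k_pt[OF half] kernel1_def)
  obtain x where x: "x \<in> {0..1/2}" "eigfun 0 x \<noteq> m * (1 + x)"
    using eigfun_0_not_affine unfolding m_def by blast
  have x1: "x \<in> {0..1}" using x by simp
  have p1: "0 < p 1"
    unfolding p_def using x w_left[OF x(1)] k_pt[OF x1, of "1/2"]
    by (intro posI[OF H1, of "pt x"]) (simp add: H_def kernel1_def)
  have one: "(1 :: real) \<in> {0..1}" by simp
  have p2: "0 < p 2"
    unfolding p_def using w_right[of 1] e_pt[OF one] eigfun_0_less
    by (intro posI[OF H2, of "pt 1"]) (simp add: H_def)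
  have e_sum: "e = (\<lambda>y. \<Sum>i<3. 1 * H i y)"
    by (simp add: sum_lessThan_3 H_def fun_eq_iff)
  have "1 = ip (\<lambda>y. \<Sum>i<3. 1 * H i y) e" using ee unfolding e_sum[symmetric] by simp
  also have "\<dots> = (\<Sum>i<3. 1 * ip (H i) e)" by (rule ip_sum_left[OF _ HF e]) simp
  also have "\<dots> = (\<Sum>i<3. p i)"
  proof (intro sum.cong refl)
    fix i :: nat assume i: "i \<in> {..<3}"
    have "ip (H i) e = ip e (H i)" by (rule ip_commute[OF HF e])
    also have "\<dots> = (\<Sum>j<3. 1 * ip (H j) (H i))"
      by (subst e_sum) (rule ip_sum_left[OF _ HF HF], simp)
    also have "\<dots> = (\<Sum>j<3. if j = i then p i else 0)"
      using i by (intro sum.cong) (auto simp: orth p_def)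
    also have "\<dots> = p i" using i by simp
    finally show "1 * ip (H i) e = p i" by simp
  qed
  finally have p_sum: "(\<Sum>i<3. p i) = 1" by simp
  have "splitting (1/2) (eigfun 0) (\<lambda>i x. H i (pt x)) p"
  proof
    show "eigfun 0 x = (\<Sum>i<3. H i (pt x))" if "x \<in> {0..1}" for x
      using e_pt[OF that] by (simp add: sum_lessThan_3 H_def)
    show "H 2 (pt x) = 0" if "x \<in> {0..1}" "x \<le> 1/2" for x
      using w_left[of x] e_pt[OF that(1)] that by (simp add: H_def)
    show "H 1 (pt x) = 0" if "x \<in> {0..1}" "1/2 \<le> x" for x
      using w_right[of x] k_pt[OF that(1), of "1/2"] that by (simp add: H_def kernel1_def m_def)
    show "0 < p i" if "i < 3" for i
    proof -
      have "i \<in> {0,1,2}" using that by auto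
      then show ?thesis using p0 p1 p2 by auto
    qed
    show "(\<Sum>i<3. p i) = 1" by (rule p_sum)
    fix I :: "nat set" and t c :: "nat \<Rightarrow> real"
    assume I: "finite I" and t: "\<And>l. l \<in> I \<Longrightarrow> t l \<in> {0..1}"
    have ptt: "pt (t l) \<in> unit_cube 1" if "l \<in> I" for l by (rule pt[OF t[OF that]])
    define v where "v x = (\<Sum>l\<in>I. c l * ksection (pt (t l)) x)" for x
    have v: "v \<in> F" unfolding v_def[abs_def] by (rule ip_comb_comb(1)[OF I ptt])
    define b where "b i = (\<Sum>l\<in>I. c l * H i (pt (t l)))" for i
    have b: "ip v (H i) = b i" for i
      unfolding b_def v_def[abs_def] by (rule ip_comb_comb(2)[OF I ptt HF])
    have vv: "ip v v = (\<Sum>l\<in>I. \<Sum>j\<in>I. c l * c j * (\<Prod>i<1. kernel1 (pt (t l) i) (pt (t j) i)))"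
      unfolding v_def[abs_def] by (rule ip_comb_comb(3)[OF I ptt])
    \<comment> \<open>The orthogonal projection of \<open>v\<close> onto the span of the
      \<open>H i\<close>; Bessel's inequality is \<open>0 \<le> ip (v - q) (v - q)\<close>
      expanded.\<close>
    define q where "q y = (\<Sum>i<3. (b i / p i) * H i y)" for y
    have q: "q \<in> F" unfolding q_def[abs_def] by (rule sum_closed[OF _ HF]) simp
    have qf: "ip q f = (\<Sum>i<3. (b i / p i) * ip (H i) f)" if "f \<in> F" for f
      unfolding q_def[abs_def] by (rule ip_sum_left[OF _ HF that]) simp
    have pos: "0 < p i" if "i < 3" for i
    proof -
      have "i \<in> {0,1,2}" using that by auto
      then show ?thesis using p0 p1 p2 by auto
    qed
    have qv: "ip q v = (\<Sum>i<3. (b i)\<^sup>2 / p i)"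
      unfolding qf[OF v] using ip_commute[OF HF v] b by (simp add: power2_eq_square)
    have "ip q (H i) = b i" if i: "i < 3" for i
    proof -
      have "ip q (H i) = (\<Sum>j<3. if j = i then b i else 0)"
        unfolding qf[OF HF] using i pos[OF i] by (intro sum.cong) (auto simp: orth p_def)
      also have "\<dots> = b i" using i by simp
      finally show ?thesis .
    qed
    then have "ip q q = (\<Sum>i<3. (b i)\<^sup>2 / p i)"
      using ip_commute[OF q HF] by (subst qf[OF q]) (simp add: power2_eq_square)
    moreover have "0 \<le> ip v v - 2 * ip v q + ip q q"
      using ip_nonneg[OF diff_closed[OF v q]] ip_diff_diff[OF v q] by simp
    ultimately have "(\<Sum>i<3. (b i)\<^sup>2 / p i) \<le> ip v v"
      using qv ip_commute[OF q v] by simp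
    then show "(\<Sum>i<3. (\<Sum>l\<in>I. c l * H i (pt (t l)))\<^sup>2 / p i) \<le> (\<Sum>l\<in>I. \<Sum>j\<in>I. c l * c j * kernel1 (t l) (t j))"
      unfolding vv b_def by (simp add: pt0)
  qed
  then show ?thesis by blast
qed

subsection \<open>Tractability\<close>

text \<open>In logarithms, with \<open>L = ln ((k + 1) * pi)\<close>, the claim becomes
  \<open>t * ln (k + 1) + ln d \<le> t * (1 + ln d) * L\<close>. It splits into
  \<open>ln (k + 1) \<le> L\<close> and \<open>ln d \<le> t * ln d * L\<close>; the latter uses
  \<open>L \<ge> 1\<close>, true because \<open>pi > 3 \<ge> exp 1\<close>.\<close>

lemma eig_ratio_Suc_powr_le:
  assumes t: "t > 1" and d: "d \<ge> 1"
  shows "(eig (Suc k) / eig 0) powr (t * (1 + ln d) / 2) \<le> real (Suc k) powr (- t) / d"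
proof -
  define x where "x = real (Suc k) * pi"
  define L where "L = ln x"
  have x: "3 \<le> x" unfolding x_def using pi_gt3 mult_mono[of 1 "real (Suc k)" 3 pi] by simp
  have L1: "1 \<le> L" unfolding L_def using x exp_le by (subst ln_ge_iff) auto
  have "ln (real (Suc k)) \<le> L" unfolding L_def x_def using pi_gt3
    by (subst ln_le_cancel_iff) (auto simp: mult_le_cancel_left1)
  then have "t * ln (real (Suc k)) \<le> t * L" using t by (intro mult_left_mono) auto
  moreover have "1 * ln d * 1 \<le> t * ln d * L"
    using t d L1 by (intro mult_mono) auto
  ultimately have *: "t * ln (real (Suc k)) + ln d \<le> t * (1 + ln d) * L" by (simp add: algebra_simps)
  have "eig (Suc k) / eig 0 \<le> eig (Suc k)"
    using eig_0_gt_1 eig_pos[of "Suc k"] by (simp add: divide_le_eq mult_le_cancel_left1)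
  also have "\<dots> \<le> 1 / x\<^sup>2" unfolding x_def by (rule eig_Suc_le)
  finally have "(eig (Suc k) / eig 0) powr (t * (1 + ln d) / 2) \<le> (1 / x\<^sup>2) powr (t * (1 + ln d) / 2)"
    using t d eig_pos[of 0] eig_pos[of "Suc k"] by (intro powr_mono2) auto
  also have "\<dots> = exp (- (t * (1 + ln d) * L))"
    using x by (simp add: powr_def L_def ln_div ln_realpow)
  also have "\<dots> \<le> exp (- (t * ln (real (Suc k)) + ln d))" using * by simp
  also have "\<dots> = real (Suc k) powr (- t) / d"
    using d by (simp add: powr_def exp_diff)
  finally show ?thesis .
qed

context sobolev_space
begin

lemma complexity_Lambda_all_upper:
  assumes t: "t > 1" and d: "d \<ge> 1" and \<epsilon>: "0 < \<epsilon>" "\<epsilon> < 1"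
  shows "ereal_of_enat (information_complexity F ip M (APP d) (Lambda_all F ip) \<epsilon>)
    \<le> ereal (exp (\<Sum>k. real (Suc k) powr (- t)) * exp (t * (1 + ln (1 / \<epsilon>)) * (1 + ln (real d))))"
proof -
  define Z where "Z = (\<Sum>k. real (Suc k) powr (- t))"
  have Zsum: "summable (\<lambda>k. real (Suc k) powr (- t))"
    using summable_real_powr_iff[of "- t"] t by (subst summable_Suc_iff) simp
  have Z0: "0 \<le> Z" unfolding Z_def by (rule suminf_nonneg[OF Zsum]) simp
  define \<tau> where "\<tau> = t * (1 + ln (real d)) / 2"
  have \<tau>: "0 < \<tau>" using t d by (simp add: \<tau>_def add_pos_nonneg)
  define \<mu> where "\<mu> k = eig k / eig 0" for k
  have \<mu>_pos: "0 < \<mu> k" for k by (simp add: \<mu>_def eig_pos)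
  have \<mu>_le: "\<mu> k \<le> 1" for k using eig_antimono[of 0 k] eig_pos[of 0] by (simp add: \<mu>_def)
  have eigp_eq: "eigp d s = (\<Prod>j<d. \<mu> (s j)) * eig 0 ^ d" for s
    using eig_pos[of 0] by (simp add: eigp_def \<mu>_def prod_dividef)
  define A where "A = {s \<in> multi_indices d. \<epsilon>\<^sup>2 < (\<Prod>j<d. \<mu> (s j))}"
  have "\<mu> \<longlonglongrightarrow> 0"
    unfolding \<mu>_def[abs_def] using tendsto_divide[OF summable_LIMSEQ_zero[OF summable_eig] tendsto_const, of "eig 0"]
      eig_pos[of 0] by simp
  then have "\<forall>\<^sub>F k in sequentially. \<mu> k < \<epsilon>\<^sup>2" using \<epsilon> by (intro order_tendstoD) auto
  then obtain m0 where m0: "\<And>k. k \<ge> m0 \<Longrightarrow> \<mu> k < \<epsilon>\<^sup>2" by (auto simp: eventually_sequentially)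
  \<comment> \<open>The successor guarantees that the sum over \<open>k < m\<close> contains the
    index 0, whose term \<open>\<mu> 0 = 1\<close> is split off below.\<close>
  define m where "m = Suc m0"
  have A_sub: "A \<subseteq> {..<d} \<rightarrow>\<^sub>E {..<m}"
  proof
    fix s assume s: "s \<in> A"
    have "s j < m" if j: "j < d" for j
    proof (rule ccontr)
      assume "\<not> s j < m"
      then have "\<mu> (s j) < \<epsilon>\<^sup>2" by (intro m0) (simp add: m_def)
      moreover have "(\<Prod>j<d. \<mu> (s j)) = \<mu> (s j) * (\<Prod>i\<in>{..<d} - {j}. \<mu> (s i))"
        using j by (intro prod.remove) auto
      moreover have "(\<Prod>i\<in>{..<d} - {j}. \<mu> (s i)) \<le> 1"
        using \<mu>_le \<mu>_pos by (intro prod_le_1) (auto intro: less_imp_le)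
      then have "\<mu> (s j) * (\<Prod>i\<in>{..<d} - {j}. \<mu> (s i)) \<le> \<mu> (s j) * 1"
        using \<mu>_pos[of "s j"] by (intro mult_left_mono) auto
      ultimately show False using s by (simp add: A_def)
    qed
    then show "s \<in> {..<d} \<rightarrow>\<^sub>E {..<m}" using s by (auto simp: A_def PiE_iff)
  qed
  have finP: "finite ({..<d} \<rightarrow>\<^sub>E {..<m})" by (intro finite_PiE) auto
  have finA: "finite A" by (rule finite_subset[OF A_sub finP])
  have "\<epsilon>\<^sup>2 < 1" using \<epsilon> by (simp add: power_less_one_iff)
  moreover have "(\<Prod>j<d. \<mu> (zero_index j)) = 1"
    using eigp_eq[of zero_index] eig_pos[of 0] unfolding zero_index(2) by simp
  ultimately have "zero_index \<in> A" unfolding A_def using zero_index(1) by simp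
  then have A_ne: "A \<noteq> {}" by blast
  have "information_complexity F ip M (APP d) (Lambda_all F ip) \<epsilon> \<le> enat (card A)"
  proof (rule complexity_Lambda_all_le[OF finA _ A_ne])
    show "A \<subseteq> multi_indices d" unfolding A_def by blast
    show "0 \<le> \<epsilon>" using \<epsilon> by simp
    show "eigp d s \<le> \<epsilon>\<^sup>2 * eig 0 ^ d" if "s \<in> multi_indices d - A" for s
    proof -
      have "\<not> \<epsilon>\<^sup>2 < (\<Prod>j<d. \<mu> (s j))" using that unfolding A_def by blast
      then show ?thesis
        unfolding eigp_eq using eig_pos[of 0] by (intro mult_right_mono) auto
    qed
  qed
  then have "ereal_of_enat (information_complexity F ip M (APP d) (Lambda_all F ip) \<epsilon>) \<le> ereal_of_enat (enat (card A))"
    by (simp only: ereal_of_enat_le_iff)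
  also have "\<dots> = ereal (real (card A))" by simp
  also have "real (card A) \<le> exp Z * exp (t * (1 + ln (1 / \<epsilon>)) * (1 + ln (real d)))"
  proof -
    \<comment> \<open>Markov-type counting: on \<open>A\<close> the quotient by
      \<open>\<epsilon>^2\<close> exceeds 1, so its power with exponent \<open>\<tau>\<close> is at
      least 1. Extending the sum from \<open>A\<close> to the box makes it factorize.\<close>
    have "real (card A) = (\<Sum>s\<in>A. 1)" by simp
    also have "\<dots> \<le> (\<Sum>s\<in>A. ((\<Prod>j<d. \<mu> (s j)) / \<epsilon>\<^sup>2) powr \<tau>)"
    proof (rule sum_mono)
      fix s assume "s \<in> A"
      then have "1 \<le> (\<Prod>j<d. \<mu> (s j)) / \<epsilon>\<^sup>2" using \<epsilon> by (simp add: A_def le_divide_eq)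
      then show "1 \<le> ((\<Prod>j<d. \<mu> (s j)) / \<epsilon>\<^sup>2) powr \<tau>" using \<tau> by (intro ge_one_powr_ge_zero) auto
    qed
    also have "\<dots> \<le> (\<Sum>s\<in>{..<d} \<rightarrow>\<^sub>E {..<m}. ((\<Prod>j<d. \<mu> (s j)) / \<epsilon>\<^sup>2) powr \<tau>)"
      by (intro sum_mono2 finP A_sub) auto
    also have "\<dots> = (\<Sum>s\<in>{..<d} \<rightarrow>\<^sub>E {..<m}. (1 / \<epsilon>\<^sup>2) powr \<tau> * (\<Prod>j<d. \<mu> (s j) powr \<tau>))"
      using \<mu>_pos \<epsilon> by (intro sum.cong refl)
        (simp add: powr_divide prod_powr_distrib less_imp_le prod_nonneg)
    also have "\<dots> = (1 / \<epsilon>\<^sup>2) powr \<tau> * (\<Prod>j<d. \<Sum>k<m. \<mu> k powr \<tau>)"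
      by (subst prod_sum_PiE) (auto simp: sum_distrib_left)
    also have "\<dots> = (1 / \<epsilon>\<^sup>2) powr \<tau> * (\<Sum>k<m. \<mu> k powr \<tau>) ^ d" by simp
    \<comment> \<open>The factor \<open>1 / d\<close> won by the exponent \<open>\<tau>\<close> in
      every univariate sum is what keeps the \<open>d\<close>-th power below \<open>exp Z\<close>
      for all \<open>d\<close>.\<close>
    also have "\<dots> \<le> (1 / \<epsilon>\<^sup>2) powr \<tau> * (1 + Z / real d) ^ d"
    proof (intro mult_left_mono power_mono)
      have "(\<Sum>k<m. \<mu> k powr \<tau>) = 1 + (\<Sum>k<m0. \<mu> (Suc k) powr \<tau>)"
        unfolding m_def using eig_pos[of 0] by (subst sum.lessThan_Suc_shift) (simp add: \<mu>_def)
      also have "(\<Sum>k<m0. \<mu> (Suc k) powr \<tau>) \<le> (\<Sum>k<m0. real (Suc k) powr (- t) / real d)"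
        unfolding \<mu>_def \<tau>_def using t d by (intro sum_mono eig_ratio_Suc_powr_le) auto
      also have "\<dots> = (\<Sum>k<m0. real (Suc k) powr (- t)) / real d" by (simp add: sum_divide_distrib)
      also have "\<dots> \<le> Z / real d"
        unfolding Z_def by (intro divide_right_mono sum_le_suminf[OF Zsum]) auto
      finally show "(\<Sum>k<m. \<mu> k powr \<tau>) \<le> 1 + Z / real d" by simp
    qed (auto intro: sum_nonneg)
    also have "(1 / \<epsilon>\<^sup>2) powr \<tau> * (1 + Z / real d) ^ d \<le> (1 / \<epsilon>\<^sup>2) powr \<tau> * exp Z"
      using d Z0 by (intro mult_left_mono exp_ge_one_plus_x_over_n_power_n) auto
    also have "(1 / \<epsilon>\<^sup>2) powr \<tau> = exp (t * ln (1 / \<epsilon>) * (1 + ln (real d)))"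
      using \<epsilon> by (simp add: powr_def \<tau>_def ln_div ln_realpow)
    also have "\<dots> * exp Z \<le> exp (t * (1 + ln (1 / \<epsilon>)) * (1 + ln (real d))) * exp Z"
      using t d by (intro mult_right_mono) (auto intro!: mult_right_mono mult_left_mono)
    finally show ?thesis by (simp add: mult.commute)
  qed
  finally show ?thesis unfolding Z_def by simp
qed

text \<open>The indices with exactly \<open>k\<close> coordinates equal to 1 and all others 0 have the same eigenvalue.\<close>

lemma complexity_Lambda_all_ge_binomial:
  assumes k: "k \<le> d" and \<epsilon>: "0 \<le> \<epsilon>" "\<epsilon>\<^sup>2 < (eig 1 / eig 0) ^ k"
  shows "enat (d choose k) \<le> information_complexity F ip M (APP d) (Lambda_all F ip) \<epsilon>"
proof -
  define S where "S = {U. U \<subseteq> {..<d} \<and> card U = k}"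
  define g where "g U = (\<lambda>j\<in>{..<d}. if j \<in> U then 1 else 0 :: nat)" for U
  have inj: "inj_on g S"
  proof (rule inj_onI)
    fix U V assume U: "U \<in> S" "V \<in> S" and eq: "g U = g V"
    have "j \<in> U \<longleftrightarrow> j \<in> V" if "j < d" for j
      using fun_cong[OF eq, of j] that by (simp add: g_def split: if_splits)
    then show "U = V" using U by (auto simp: S_def)
  qed
  have "finite S" unfolding S_def by simp
  then have "enat (card (g ` S)) \<le> information_complexity F ip M (APP d) (Lambda_all F ip) \<epsilon>"
  proof (intro complexity_Lambda_all_ge)
    have "g U \<in> multi_indices d" for U
      unfolding g_def by (rule restrict_PiE_iff[THEN iffD2]) simp
    then show "g ` S \<subseteq> multi_indices d" by blast
    fix s assume "s \<in> g ` S"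
    then obtain U where U: "U \<subseteq> {..<d}" "card U = k" and s: "s = g U" by (auto simp: S_def)
    have "eigp d s = (\<Prod>j<d. if j \<in> U then eig 1 else eig 0)"
      unfolding eigp_def s g_def by (intro prod.cong) auto
    also have "\<dots> = (\<Prod>j\<in>U. eig 1) * (\<Prod>j\<in>{..<d} - U. eig 0)"
      using U(1) by (subst prod.If_cases) (auto simp: Int_absorb1 Diff_eq)
    also have "\<dots> = eig 1 ^ k * eig 0 ^ (d - k)"
      using U finite_subset[OF U(1)] by (simp add: card_Diff_subset)
    also have "\<dots> = (eig 1 / eig 0) ^ k * (eig 0 ^ k * eig 0 ^ (d - k))"
      using eig_pos[of 0] by (simp add: power_divide)
    also have "eig 0 ^ k * eig 0 ^ (d - k) = eig 0 ^ d"
      using k by (simp flip: power_add)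
    finally show "\<epsilon>\<^sup>2 * eig 0 ^ d < eigp d s" using \<epsilon>(2) eig_pos[of 0] by simp
  qed (use \<epsilon> in auto)
  moreover have "card (g ` S) = d choose k"
    using card_image[OF inj] n_subsets[of "{..<d}" k] by (simp add: S_def)
  ultimately show ?thesis by simp
qed

text \<open>For \<open>n\<close> below the bound, \<open>n * (1 - \<delta>) ^ d < 1 / 2\<close>, so
  more than half of the initial error remains, and this exceeds the share
  \<open>\<epsilon> \<le> 1 / 4\<close>.\<close>

lemma complexity_Lambda_std_ge:
  assumes split: "splitting a (eigfun 0) h p" and \<epsilon>: "0 < \<epsilon>" "\<epsilon> \<le> 1 / 4"
  shows "ereal (1 / 2 * (1 / (1 - splitting.\<delta> p)) ^ d)
    \<le> ereal_of_enat (information_complexity F ip M (APP d) (Lambda_std (unit_cube d)) \<epsilon>)"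
proof -
  interpret splitting a "eigfun 0" h p by (rule split)
  define B where "B = 1 / 2 * (1 / (1 - \<delta>)) ^ d"
  have "enat (nat \<lceil>B\<rceil>) \<le> information_complexity F ip M (APP d) (Lambda_std (unit_cube d)) \<epsilon>"
  proof (rule complexity_ge)
    fix n assume "n < nat \<lceil>B\<rceil>"
    then have "real n < B" by linarith
    then have "real n * (1 - \<delta>) ^ d < B * (1 - \<delta>) ^ d" using \<delta> by (intro mult_strict_right_mono) auto
    also have "\<dots> = 1 / 2" using \<delta> by (simp add: B_def power_divide)
    finally have "1 / 4 < 1 - real n * (1 - \<delta>) ^ d" by simp
    then have "\<epsilon> * sqrt (eig 0 ^ d) < (1 - real n * (1 - \<delta>) ^ d) * sqrt (eig 0 ^ d)"
      using \<epsilon> eig_pos[of 0] by (intro mult_strict_right_mono) auto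
    also have "\<dots> \<le> minimal_error F ip M (APP d) (Lambda_std (unit_cube d)) n"
      by (rule Lambda_std_minimal_error_ge[OF split])
    finally show "\<epsilon> * sqrt (eig 0 ^ d) < minimal_error F ip M (APP d) (Lambda_std (unit_cube d)) n" .
  qed
  then have "ereal_of_enat (enat (nat \<lceil>B\<rceil>)) \<le> ereal_of_enat (information_complexity F ip M (APP d) (Lambda_std (unit_cube d)) \<epsilon>)"
    by (simp only: ereal_of_enat_le_iff)
  moreover have "ereal B \<le> ereal_of_enat (enat (nat \<lceil>B\<rceil>))"
    by (simp add: real_nat_ceiling_ge)
  ultimately show ?thesis unfolding B_def by (rule order_trans[rotated])
qed

end

text \<open>The first \<open>N\<close> eigenvalues are at least \<open>1 / (N * pi)^2\<close>, while
  for this \<open>\<epsilon>\<close> the threshold is \<open>1 / (2 * N * pi)^2\<close>; the factor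
  2 in \<open>\<epsilon>\<close> provides strictness.\<close>

lemma univariate_complexity_ge:
  assumes "sobolev_space 1 F ip" and N: "N \<ge> 1"
  shows "enat N \<le> information_complexity F ip (cube_measure 1) (APP 1) (Lambda_all F ip)
    (1 / (2 * real N * pi * sqrt (eig 0)))"
proof -
  interpret sobolev_space 1 F ip by (rule assms)
  define g where "g k = (\<lambda>j\<in>{..<1 :: nat}. k :: nat)" for k
  have inj: "inj_on g {..<N}"
    by (rule inj_onI) (auto simp: g_def fun_eq_iff restrict_def split: if_splits)
  let ?\<epsilon> = "1 / (2 * real N * pi * sqrt (eig 0))"
  have "enat (card (g ` {..<N})) \<le> information_complexity F ip (cube_measure 1) (APP 1) (Lambda_all F ip) ?\<epsilon>"
  proof (rule complexity_Lambda_all_ge)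
    have "g k \<in> multi_indices 1" for k
      unfolding g_def by (rule restrict_PiE_iff[THEN iffD2]) simp
    then show "g ` {..<N} \<subseteq> multi_indices 1" by blast
    show "0 \<le> ?\<epsilon>" using eig_pos[of 0] by simp
    fix s assume "s \<in> g ` {..<N}"
    then obtain k where k: "k < N" and s: "s = g k" by auto
    have "?\<epsilon>\<^sup>2 * eig 0 ^ 1 = 1 / (2 * (real N * pi))\<^sup>2"
      using eig_pos[of 0] by (simp add: power_divide power_mult_distrib)
    also have "\<dots> < 1 / (real N * pi)\<^sup>2"
      using N by (intro divide_strict_left_mono) (auto simp: power_mult_distrib)
    also have "\<dots> \<le> 1 / (real (Suc k) * pi)\<^sup>2"
      using k by (intro divide_left_mono power_mono mult_right_mono) auto
    also have "\<dots> \<le> eig k" by (rule eig_ge)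
    also have "eig k = eigp 1 s" by (simp add: eigp_def s g_def)
    finally show "?\<epsilon>\<^sup>2 * eig 0 ^ 1 < eigp 1 s" .
  qed simp
  then show ?thesis by (simp add: card_image[OF inj])
qed

theorem corollary8:
  fixes F :: "nat \<Rightarrow> ((nat \<Rightarrow> real) \<Rightarrow> real) set"
    and ip :: "nat \<Rightarrow> ((nat \<Rightarrow> real) \<Rightarrow> real) \<Rightarrow> ((nat \<Rightarrow> real) \<Rightarrow> real) \<Rightarrow> real"
  assumes "\<And>d. d \<ge> 1 \<Longrightarrow> rkhs (unit_cube d) (F d) (ip d) (sobolev_kernel d)"
  shows "quasi_polynomially_tractable (APP_complexity F ip (\<lambda>d. Lambda_all (F d) (ip d))) \<and>
         \<not> polynomially_tractable (APP_complexity F ip (\<lambda>d. Lambda_all (F d) (ip d))) \<and>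
         qpt_exponent (APP_complexity F ip (\<lambda>d. Lambda_all (F d) (ip d))) = 1 \<and>
         curse_of_dimensionality (APP_complexity F ip (\<lambda>d. Lambda_std (unit_cube d)))"
proof -
  let ?N = "APP_complexity F ip (\<lambda>d. Lambda_all (F d) (ip d))"
  have sp: "sobolev_space d (F d) (ip d)" if "d \<ge> 1" for d
    unfolding sobolev_space_def by (rule assms[OF that])
  have upper: "\<exists>C\<ge>0. qpt_bound ?N C t" if t: "t > 1" for t
    unfolding qpt_bound_def APP_complexity_def
    using sobolev_space.complexity_Lambda_all_upper[OF sp t]
    by (intro exI[of _ "exp (\<Sum>k. real (Suc k) powr (- t))"]) auto
  have lower: "1 \<le> t" if t: "t \<ge> 0" and C: "C \<ge> 0" "qpt_bound ?N C t" for t C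
  proof (rule ccontr)
    assume "\<not> 1 \<le> t"
    then have t1: "t < 1" by simp
    define b where "b = 2 * pi * sqrt (eig 0)"
    have s1: "1 < sqrt (eig 0)" using eig_0_gt_1 by simp
    have b1: "1 < b" unfolding b_def using s1 pi_gt3 by (intro less_1_mult) auto
    \<comment> \<open>For \<open>d = 1\<close> the factor \<open>1 + ln d\<close> is 1. At the
      \<open>\<epsilon>\<close> that forces complexity at least \<open>n\<close>, the assumed bound
      becomes \<open>n \<le> D * n powr t\<close>.\<close>
    define D where "D = C * exp t * b powr t"
    have D: "real n powr (1 - t) \<le> D" if n: "n \<ge> 1" for n
    proof -
      have bn: "1 < b * real n" using b1 n by (simp add: less_1_mult' mult_le_cancel_left1 order_less_le_trans)
      have eq: "2 * real n * pi * sqrt (eig 0) = b * real n" by (simp add: b_def)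
      have "enat n \<le> ?N (1 / (b * real n)) 1"
        using univariate_complexity_ge[OF sp[OF order_refl] n] unfolding APP_complexity_def eq .
      then have "ereal_of_enat (enat n) \<le> ereal_of_enat (?N (1 / (b * real n)) 1)"
        by (simp only: ereal_of_enat_le_iff)
      also have "\<dots> \<le> ereal (C * exp (t * (1 + ln (1 / (1 / (b * real n)))) * (1 + ln (real 1))))"
        using C(2) bn unfolding qpt_bound_def by (intro C(2)[unfolded qpt_bound_def, rule_format]) auto
      finally have "real n \<le> C * exp (t * (1 + ln (b * real n)))" by simp
      also have "\<dots> = D * real n powr t"
        using b1 n by (simp add: D_def powr_def exp_add ln_mult algebra_simps)
      finally have "real n \<le> D * real n powr t" .
      then have "real n powr (1 - t) * real n powr t \<le> D * real n powr t"
        using n by (simp flip: powr_add)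
      then show ?thesis using n by (simp add: mult_le_cancel_right)
    qed
    \<comment> \<open>Chosen so that \<open>y powr (1 - t) = \<bar>D\<bar> + 1\<close>, which no
      bound by \<open>D\<close> allows.\<close>
    define y where "y = (\<bar>D\<bar> + 1) powr (1 / (1 - t))"
    define n where "n = nat \<lceil>y\<rceil> + 1"
    have "y \<le> real n" unfolding n_def by linarith
    then have "y powr (1 - t) \<le> real n powr (1 - t)" using t1 by (intro powr_mono2) (auto simp: y_def)
    moreover have "y powr (1 - t) = \<bar>D\<bar> + 1" using t1 by (simp add: y_def powr_powr)
    ultimately show False using D[of n] by (simp add: n_def)
  qed
  have qpt: "quasi_polynomially_tractable ?N"
  proof -
    obtain C where "C \<ge> 0" "qpt_bound ?N C 2" using upper[of 2] by auto
    then show ?thesis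
      unfolding quasi_polynomially_tractable_def by (intro exI[of _ C] exI[of _ 2] conjI) auto
  qed
  have exponent: "qpt_exponent ?N = 1"
    unfolding qpt_exponent_def
  proof (rule antisym)
    let ?T = "{t. t \<ge> 0 \<and> (\<exists>C\<ge>0. qpt_bound ?N C t)}"
    have bdd: "bdd_below ?T" by (intro bdd_belowI[of _ 0]) auto
    show "Inf ?T \<le> 1"
    \<comment> \<open>Bounds are available only for \<open>t > 1\<close>, with constants that grow
      without limit as \<open>t\<close> decreases to 1, so the infimum is estimated by
      density.\<close>
    proof (rule dense_ge)
      fix t :: real assume "1 < t"
      then show "Inf ?T \<le> t" using upper[of t] by (intro cInf_lower bdd) auto
    qed
    have "2 \<in> ?T" using upper[of 2] by simp
    then have "?T \<noteq> {}" by blast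
    then show "1 \<le> Inf ?T" using lower by (intro cInf_greatest) blast+
  qed
  have not_pt: "\<not> polynomially_tractable ?N"
  proof
    assume "polynomially_tractable ?N"
    then obtain C p q where Cpq: "C \<ge> 0" "p \<ge> 0" "q \<ge> 0"
      and bound: "\<And>\<epsilon> d. \<epsilon> \<in> {0<..<1} \<Longrightarrow> d \<ge> 1 \<Longrightarrow>
        ereal_of_enat (?N \<epsilon> d) \<le> ereal (C * \<epsilon> powr (- p) * real d powr q)"
      unfolding polynomially_tractable_def by blast
    \<comment> \<open>One more than the assumed degree in \<open>d\<close>: the complexity is at
      least \<open>d choose k\<close>, hence at least \<open>(d / k) ^ k\<close>, and this outgrows
      \<open>d powr q\<close>.\<close>
    define k where "k = nat \<lceil>q\<rceil> + 1"
    have k: "k \<ge> 1" "q + 1 \<le> real k" unfolding k_def by linarith+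
    define r where "r = eig 1 / eig 0"
    have r: "0 < r" "r \<le> 1" using eig_pos[of 0] eig_pos[of 1] eig_antimono[of 0 1] by (auto simp: r_def)
    \<comment> \<open>As \<open>r ^ k \<le> 1\<close>, this value satisfies
      \<open>\<epsilon>^2 < r ^ k\<close>. It does not depend on \<open>d\<close>, so the factor
      with \<open>\<epsilon>\<close> in the assumed bound is a constant.\<close>
    define \<epsilon> where "\<epsilon> = r ^ k / 2"
    have rk: "0 < r ^ k" "r ^ k \<le> 1" using r by (auto intro: power_le_one)
    have \<epsilon>: "0 < \<epsilon>" "\<epsilon> < 1" using rk by (auto simp: \<epsilon>_def)
    have "\<epsilon>\<^sup>2 = r ^ k * (r ^ k / 4)" by (simp add: \<epsilon>_def power2_eq_square)
    also have "\<dots> < r ^ k * 1" using rk by (intro mult_strict_left_mono) auto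
    finally have \<epsilon>2: "\<epsilon>\<^sup>2 < r ^ k" by simp
    define D where "D = C * \<epsilon> powr (- p) * real k ^ k"
    have D: "real d \<le> D" if d: "d \<ge> k" for d
    proof -
      have d1: "d \<ge> 1" using d k by simp
      have "ereal_of_enat (enat (d choose k)) \<le> ereal_of_enat (?N \<epsilon> d)"
        using sobolev_space.complexity_Lambda_all_ge_binomial[OF sp[OF d1] d less_imp_le[OF \<epsilon>(1)] \<epsilon>2[unfolded r_def]]
        unfolding APP_complexity_def by (simp only: ereal_of_enat_le_iff)
      also have "\<dots> \<le> ereal (C * \<epsilon> powr (- p) * real d powr q)" using \<epsilon> d1 by (intro bound) auto
      finally have "real (d choose k) \<le> C * \<epsilon> powr (- p) * real d powr q" by simp
      moreover have "(real d / real k) ^ k \<le> real (d choose k)" by (rule binomial_ge_n_over_k_pow_k[OF d])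
      ultimately have "(real d / real k) ^ k \<le> C * \<epsilon> powr (- p) * real d powr q" by simp
      then have "real d ^ k \<le> D * real d powr q"
        using k by (simp add: D_def power_divide divide_le_eq mult_ac)
      moreover have "real d * real d powr q \<le> real d ^ k"
      proof -
        have "real d * real d powr q = real d powr (q + 1)" using d1 by (simp add: powr_add mult.commute)
        also have "\<dots> \<le> real d powr real k" using d1 k by (intro powr_mono) auto
        also have "\<dots> = real d ^ k" using d1 by (simp add: powr_realpow)
        finally show ?thesis .
      qed
      ultimately have "real d * real d powr q \<le> D * real d powr q" by simp
      then show ?thesis using d1 by (simp add: mult_le_cancel_right)
    qed
    define d where "d = max k (nat \<lceil>D\<rceil> + 1)"
    have "D < real d" unfolding d_def by linarith
    then show False using D[of d] by (simp add: d_def)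
  qed
  have curse: "curse_of_dimensionality (APP_complexity F ip (\<lambda>d. Lambda_std (unit_cube d)))"
  proof -
    \<comment> \<open>The splitting concerns univariate functions only. It is obtained once, in
      \<open>F 1\<close>, and serves every dimension, so that \<open>\<delta>\<close> does not
      depend on \<open>d\<close>.\<close>
    obtain h p where split: "splitting (1/2) (eigfun 0) h p"
      using splitting_exists[OF sp[of 1]] by auto
    define \<delta> where "\<delta> = splitting.\<delta> p"
    have \<delta>: "0 < \<delta>" "\<delta> < 1" unfolding \<delta>_def using splitting.\<delta>[OF split] by auto
    let ?S = "{d. d \<ge> 1 \<and> (\<forall>\<epsilon>\<in>{0<..1/4}. ereal (1 / 2 * (1 + (1 / (1 - \<delta>) - 1)) ^ d)
      \<le> ereal_of_enat (APP_complexity F ip (\<lambda>d. Lambda_std (unit_cube d)) \<epsilon> d))}"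
    have "{1..} \<subseteq> ?S"
      using sobolev_space.complexity_Lambda_std_ge[OF sp split]
      by (auto simp: APP_complexity_def \<delta>_def)
    then have "infinite ?S" using infinite_super infinite_Ici by blast
    then show ?thesis unfolding curse_of_dimensionality_def
      using \<delta> by (intro exI[of _ "1 / (1 - \<delta>) - 1"] exI[of _ "1/2"] bexI[of _ "1/4"] conjI) auto
  qed
  show ?thesis using qpt not_pt exponent curse by blast
qed

end
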